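(* There exists a pencil of quartic curves in the complex projective plane $\mathbb{P}^2$ such that: (1) the base locus is set-theoretically reduced to one point; (2) all the quartics of the pencil are irreducible; (3) the general element of the pencil is smooth; (4) the pencil is non-isotrivial.
   Context: The ground field is $\mathbb{C}$. A pencil of plane quartics is a family $\{\lambda F+\mu G=0\}_{(\lambda:\mu)\in\mathbb{P}^1}$ with $F,G$ linearly independent quartic forms; its base locus is $\{F=G=0\}$. A pencil with smooth general member is isotrivial if its general smooth members are mutually isomorphic; it is non-isotrivial otherwise. *)

theory Defs
  imports
    "HOL-Analysis.Analysis"
    "HOL-Library.Poly_Mapping"
    "HOL-Computational_Algebra.Factorial_Ring"
begin

section \<open>Polynomials in finitely many variables\<close>

text \<open>
  The polynomial ring over the complex numbers in variables indexed by a finite type: a finitely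
  supported map from exponent vectors to coefficients, with the convolution product of
  \<^theory>\<open>HOL-Library.Poly_Mapping\<close>.
\<close>

type_synonym 'n cpoly = "('n \<Rightarrow>\<^sub>0 nat) \<Rightarrow>\<^sub>0 complex"

definition const_poly :: "complex \<Rightarrow> 'n cpoly" where
  "const_poly c = Poly_Mapping.single 0 c"

definition eval_poly :: "'n::finite cpoly \<Rightarrow> complex ^ 'n \<Rightarrow> complex" where
  "eval_poly p v =
    (\<Sum>m\<in>Poly_Mapping.keys p. Poly_Mapping.lookup p m * (\<Prod>i\<in>UNIV. (v $ i) ^ Poly_Mapping.lookup m i))"

text \<open>The zero polynomial is a form of every degree.\<close>

definition is_form :: "nat \<Rightarrow> 'n::finite cpoly \<Rightarrow> bool" where
  "is_form d p \<longleftrightarrow> (\<forall>m\<in>Poly_Mapping.keys p. (\<Sum>i\<in>UNIV. Poly_Mapping.lookup m i) = d)"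

text \<open>
  If the variable does not occur in the monomial, the truncated subtraction of exponents is
  harmless, because the coefficient is then zero.
\<close>

definition partial_deriv :: "'n \<Rightarrow> 'n cpoly \<Rightarrow> 'n cpoly" where
  "partial_deriv i p =
    (\<Sum>m\<in>Poly_Mapping.keys p.
       Poly_Mapping.single (m - Poly_Mapping.single i 1)
         (of_nat (Poly_Mapping.lookup m i) * Poly_Mapping.lookup p m))"


section \<open>Projective spaces and plane curves\<close>

text \<open>
  A point of the projective space is a line through the origin; the projective plane and the
  projective line are \<open>proj_space\<close> at types \<open>3\<close> and \<open>2\<close>.
\<close>

definition proj_pt :: "complex ^ 'n \<Rightarrow> (complex ^ 'n) set" where
  "proj_pt v = vec.span {v}"

definition proj_space :: "(complex ^ 'n) set set" where
  "proj_space = {proj_pt v | v. v \<noteq> 0}"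

text \<open>Used only for forms, for which vanishing does not depend on the representative \<open>v\<close>.\<close>

definition zero_locus :: "'n::finite cpoly \<Rightarrow> (complex ^ 'n) set set" where
  "zero_locus p = {proj_pt v | v. v \<noteq> 0 \<and> eval_poly p v = 0}"

definition smooth_form :: "'n::finite cpoly \<Rightarrow> bool" where
  "smooth_form p \<longleftrightarrow>
    (\<forall>v. v \<noteq> 0 \<longrightarrow> eval_poly p v = 0 \<longrightarrow> (\<exists>i. eval_poly (partial_deriv i p) v \<noteq> 0))"


section \<open>Isomorphism of projective varieties\<close>

text \<open>
  Near every point of \<open>X\<close> the map is given by forms \<open>h\<close> of a common degree without common zero
  at that point. Asking for this on the whole open set where the \<open>h i\<close> do not all vanish is no
  loss of generality: a smaller neighbourhood is a union of sets where some form \<open>g\<close> does not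
  vanish, and one can replace each \<open>h i\<close> by \<open>g * h i\<close>.
\<close>

definition regular_map_on ::
    "(complex ^ 'n::finite) set set \<Rightarrow> ((complex ^ 'n) set \<Rightarrow> (complex ^ 'm::finite) set) \<Rightarrow> bool" where
  "regular_map_on X f \<longleftrightarrow>
    (\<forall>v. v \<noteq> 0 \<longrightarrow> proj_pt v \<in> X \<longrightarrow>
      (\<exists>d (h :: 'm \<Rightarrow> 'n cpoly).
         (\<forall>i. is_form d (h i)) \<and>
         (\<chi> i. eval_poly (h i) v) \<noteq> 0 \<and>
         (\<forall>w. w \<noteq> 0 \<longrightarrow> proj_pt w \<in> X \<longrightarrow> (\<chi> i. eval_poly (h i) w) \<noteq> 0 \<longrightarrow>
            f (proj_pt w) = proj_pt (\<chi> i. eval_poly (h i) w))))"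

definition proj_isomorphic ::
    "(complex ^ 'n::finite) set set \<Rightarrow> (complex ^ 'm::finite) set set \<Rightarrow> bool" where
  "proj_isomorphic X Y \<longleftrightarrow>
    (\<exists>f g. regular_map_on X f \<and> f ` X \<subseteq> Y \<and> (\<forall>P\<in>X. g (f P) = P) \<and>
           regular_map_on Y g \<and> g ` Y \<subseteq> X \<and> (\<forall>Q\<in>Y. f (g Q) = Q))"


section \<open>Pencils of plane curves\<close>

text \<open>The member of the pencil at \<open>(t $ 1 : t $ 2)\<close>, given up to a nonzero scalar.\<close>

definition pencil_member :: "3 cpoly \<Rightarrow> 3 cpoly \<Rightarrow> complex ^ 2 \<Rightarrow> 3 cpoly" where
  "pencil_member F G t = const_poly (t $ 1) * F + const_poly (t $ 2) * G"

definition is_pencil :: "nat \<Rightarrow> 3 cpoly \<Rightarrow> 3 cpoly \<Rightarrow> bool" where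
  "is_pencil d F G \<longleftrightarrow>
    is_form d F \<and> is_form d G \<and>
    (\<forall>a b. const_poly a * F + const_poly b * G = 0 \<longrightarrow> a = 0 \<and> b = 0)"

definition base_locus :: "3 cpoly \<Rightarrow> 3 cpoly \<Rightarrow> (complex ^ 3) set set" where
  "base_locus F G = zero_locus F \<inter> zero_locus G"

text \<open>
  ``General'' means away from a proper Zariski closed subset of the projective line, that is, away
  from a finite set of parameters.
\<close>

definition general_member_smooth :: "3 cpoly \<Rightarrow> 3 cpoly \<Rightarrow> bool" where
  "general_member_smooth F G \<longleftrightarrow>
    (\<exists>S \<subseteq> proj_space. finite S \<and>
      (\<forall>t. t \<noteq> 0 \<longrightarrow> proj_pt t \<notin> S \<longrightarrow> smooth_form (pencil_member F G t)))"

text \<open>Meaningful only for pencils with smooth general member.\<close>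

definition isotrivial :: "3 cpoly \<Rightarrow> 3 cpoly \<Rightarrow> bool" where
  "isotrivial F G \<longleftrightarrow>
    (\<exists>S \<subseteq> proj_space. finite S \<and>
      (\<forall>s t. s \<noteq> 0 \<longrightarrow> t \<noteq> 0 \<longrightarrow> proj_pt s \<notin> S \<longrightarrow> proj_pt t \<notin> S \<longrightarrow>
         smooth_form (pencil_member F G s) \<longrightarrow> smooth_form (pencil_member F G t) \<longrightarrow>
         proj_isomorphic (zero_locus (pencil_member F G s)) (zero_locus (pencil_member F G t))))"

end

theory Submission
  imports Defs
    "HOL-Computational_Algebra.Polynomial_Factorial"
    "HOL-Computational_Algebra.Fundamental_Theorem_Algebra"
    "HOL-Computational_Algebra.Field_as_Ring"
begin

text \<open>
  The pencil is spanned by \<open>F = y^2 z^2 - x^2 y^2 - x z^3 + 2 x^3 z\<close> and \<open>G = y^4 - x y^2 z + x^4\<close>. It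
  comes from looking for pencils invariant under \<open>y \<mapsto> - y\<close>: in \<open>Y = y^2\<close> the members are curves in the
  weighted plane \<open>P(1,2,1)\<close> that meet in one point with multiplicity eight, and \<open>G\<close> is a rational
  curve with a node there. In the chart \<open>x = 1\<close> a member is a cubic in \<open>z\<close> over \<open>\<complex>[y]\<close>, and it is
  irreducible because it has no root in \<open>\<complex>[y]\<close>.

  An isomorphism \<open>h\<close> between smooth plane quartics is linear, because it pulls holomorphic
  differentials back to holomorphic differentials and these are the linear forms. In elementary terms,
  \<open>h\<close> can be rescaled by its Jacobian to a vector function on the affine cone that is homogeneous of
  degree one and locally a quotient of polynomials. Such a function is a polynomial in each of the
  charts \<open>x = 1\<close> and \<open>z = 1\<close>, and comparing the two polynomials shows that it is linear.

  Isomorphic members therefore have the same absolute invariant. If \<open>N\<close> is the product of the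
  catalecticant of a quartic with the catalecticant of its contravariant quartic of degree two, then
  \<open>tr N\<close> and \<open>tr N^2\<close> are invariants of degree 3 and 6. On \<open>F + t G\<close> they are proportional to \<open>t\<close> and
  to \<open>8 t^4 + (5329 / 4) t^2 - 1\<close>, so \<open>tr N^2 / (tr N)^2\<close> is not constant.
\<close>

text \<open>Regular maps are given only by local forms, so the obstacle is to reach a global linear
  map without divisors or cohomology. Degree four enters twice: for the source it makes the
  canonical bundle O(d - 3) equal to O(1), so the rescaled map has degree one; for the target it
  makes the Jacobian factor cancel exactly the freedom in the choice of the local forms. The point
  (0:1:0) lies on \<open>F + t G\<close> only for t = 0. For other t the charts x = 1 and z = 1
  cover the curve, and in both of them the equation has a constant leading coefficient in y.
  Projection along y is then finite, and pseudo-division in y does the work of the Nullstellensatz.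
  For this, both chart equations must be prime; the second one inherits this from the first. A
  linear map carrying one curve onto another still has to be turned into proportional equations,
  with a nonzero factor. For that the points of the target curve must span the whole space.\<close>

section \<open>Evaluation of polynomials and forms\<close>

definition monomial :: "complex ^ 'n::finite \<Rightarrow> ('n \<Rightarrow>\<^sub>0 nat) \<Rightarrow> complex" where
  "monomial v m = (\<Prod>i\<in>UNIV. (v $ i) ^ Poly_Mapping.lookup m i)"

lemma monomial_0 [simp]: "monomial v 0 = 1"
  by (simp add: monomial_def)

lemma monomial_add: "monomial v (m + n) = monomial v m * monomial v n"
  by (simp add: monomial_def lookup_add power_add prod.distrib)

lemma monomial_scale: "monomial (c *s v) m = c ^ (\<Sum>i\<in>UNIV. Poly_Mapping.lookup m i) * monomial v m"
  by (simp add: monomial_def power_mult_distrib prod.distrib power_sum)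

lemma eval_poly_superset:
  assumes "finite S" "Poly_Mapping.keys p \<subseteq> S"
  shows "eval_poly p v = (\<Sum>m\<in>S. Poly_Mapping.lookup p m * monomial v m)"
  unfolding eval_poly_def monomial_def[symmetric]
  by (rule sum.mono_neutral_left) (use assms in \<open>auto simp: in_keys_iff\<close>)

lemma eval_poly_single [simp]: "eval_poly (Poly_Mapping.single m c) v = c * monomial v m"
  by (subst eval_poly_superset[of "{m}"]) auto

lemma eval_poly_0 [simp]: "eval_poly 0 v = 0"
  by (simp add: eval_poly_def)

lemma eval_poly_add [simp]: "eval_poly (p + q) v = eval_poly p v + eval_poly q v"
proof -
  let ?S = "Poly_Mapping.keys p \<union> Poly_Mapping.keys q"
  have "Poly_Mapping.keys (p + q) \<subseteq> ?S"
    by (rule keys_add)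
  then show ?thesis
    by (simp add: eval_poly_superset[of ?S] lookup_add sum.distrib distrib_right)
qed

lemma eval_poly_uminus [simp]: "eval_poly (- p) v = - eval_poly p v"
  by (metis add_eq_0_iff eval_poly_0 eval_poly_add add.right_inverse)

lemma eval_poly_diff [simp]: "eval_poly (p - q) v = eval_poly p v - eval_poly q v"
  by (metis add_uminus_conv_diff eval_poly_add eval_poly_uminus)

lemma eval_poly_sum [simp]: "eval_poly (sum f A) v = (\<Sum>x\<in>A. eval_poly (f x) v)"
  by (induction A rule: infinite_finite_induct) auto

lemma cpoly_eq_sum_single:
  "p = (\<Sum>m\<in>Poly_Mapping.keys p. Poly_Mapping.single m (Poly_Mapping.lookup p m))"
  by (rule poly_mapping_eqI)
    (auto simp: lookup_sum lookup_single when_def in_keys_iff)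

lemma eval_poly_mult [simp]: "eval_poly (p * q) v = eval_poly p v * eval_poly q v"
proof -
  have "eval_poly (p * q) v = (\<Sum>m\<in>Poly_Mapping.keys p. \<Sum>n\<in>Poly_Mapping.keys q.
      Poly_Mapping.lookup p m * monomial v m * (Poly_Mapping.lookup q n * monomial v n))"
    by (subst cpoly_eq_sum_single[of p], subst cpoly_eq_sum_single[of q])
      (simp add: sum_product mult_single monomial_add mult_ac)
  also have "\<dots> = eval_poly p v * eval_poly q v"
    by (simp add: eval_poly_def monomial_def[symmetric] sum_product)
  finally show ?thesis .
qed

lemma eval_poly_const [simp]: "eval_poly (const_poly c) v = c"
  by (simp add: const_poly_def)

lemma eval_poly_1 [simp]: "eval_poly 1 v = 1"
  by (metis eval_poly_const const_poly_def single_one)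

lemma eval_poly_power [simp]: "eval_poly (p ^ n) v = eval_poly p v ^ n"
  by (induction n) auto

lemma eval_poly_prod [simp]: "eval_poly (prod f A) v = (\<Prod>x\<in>A. eval_poly (f x) v)"
  by (induction A rule: infinite_finite_induct) auto

definition var_poly :: "'n \<Rightarrow> 'n cpoly" where
  "var_poly i = Poly_Mapping.single (Poly_Mapping.single i 1) 1"

lemma eval_poly_var [simp]: "eval_poly (var_poly i) v = v $ i"
proof -
  have "monomial v (Poly_Mapping.single i 1) = (\<Prod>j\<in>UNIV. if j = i then v $ i else 1)"
    unfolding monomial_def by (rule prod.cong) (auto simp: lookup_single when_def)
  then show ?thesis by (simp add: var_poly_def)
qed

lemma is_form_0 [simp]: "is_form d 0"
  by (simp add: is_form_def)

lemma is_form_const [simp]: "is_form 0 (const_poly c)"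
  by (auto simp: is_form_def const_poly_def)

lemma is_form_var [simp]: "is_form 1 (var_poly i)"
  by (auto simp: is_form_def var_poly_def lookup_single when_def)

lemma is_form_add: "is_form d p \<Longrightarrow> is_form d q \<Longrightarrow> is_form d (p + q)"
  unfolding is_form_def using keys_add[of p q] by blast

lemma is_form_uminus: "is_form d p \<Longrightarrow> is_form d (- p)"
  by (simp add: is_form_def in_keys_iff)

lemma is_form_diff: "is_form d p \<Longrightarrow> is_form d q \<Longrightarrow> is_form d (p - q)"
  using is_form_add[of d p "- q"] is_form_uminus[of d q] by simp

lemma is_form_mult: "is_form d p \<Longrightarrow> is_form e q \<Longrightarrow> is_form (d + e) (p * q)"
  unfolding is_form_def
proof
  fix m assume H: "\<forall>m\<in>Poly_Mapping.keys p. (\<Sum>i\<in>UNIV. Poly_Mapping.lookup m i) = d"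
    "\<forall>m\<in>Poly_Mapping.keys q. (\<Sum>i\<in>UNIV. Poly_Mapping.lookup m i) = e"
    and "m \<in> Poly_Mapping.keys (p * q)"
  then obtain a b where "m = a + b" "a \<in> Poly_Mapping.keys p" "b \<in> Poly_Mapping.keys q"
    using keys_mult[of p q] by blast
  with H show "(\<Sum>i\<in>UNIV. Poly_Mapping.lookup m i) = d + e"
    by (simp add: lookup_add sum.distrib)
qed

lemma is_form_power: "is_form d p \<Longrightarrow> is_form (n * d) (p ^ n)"
proof (induction n)
  case 0
  then show ?case using is_form_const[of 1] by (simp add: const_poly_def)
next
  case (Suc n)
  then show ?case using is_form_mult[of d p "n * d" "p ^ n"] by simp
qed

lemma is_form_const_mult: "is_form d p \<Longrightarrow> is_form d (const_poly c * p)"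
  using is_form_mult[OF is_form_const] by fastforce

lemma is_form_sum: "(\<And>x. x \<in> A \<Longrightarrow> is_form d (f x)) \<Longrightarrow> is_form d (sum f A)"
  by (induction A rule: infinite_finite_induct) (auto intro: is_form_add)

lemma is_form_prod:
  "finite A \<Longrightarrow> (\<And>x. x \<in> A \<Longrightarrow> is_form (d x) (f x)) \<Longrightarrow> is_form (sum d A) (prod f A)"
proof (induction A rule: finite_induct)
  case empty
  then show ?case using is_form_const[of 1] by (simp add: const_poly_def)
qed (auto intro: is_form_mult)

lemma eval_form_scale:
  assumes "is_form d p"
  shows "eval_poly p (c *s v) = c ^ d * eval_poly p v"
proof -
  have "eval_poly p (c *s v)
      = (\<Sum>m\<in>Poly_Mapping.keys p. Poly_Mapping.lookup p m * (c ^ d * monomial v m))"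
    unfolding eval_poly_def monomial_def[symmetric]
    by (rule sum.cong) (use assms in \<open>auto simp: monomial_scale is_form_def\<close>)
  also have "\<dots> = c ^ d * eval_poly p v"
    by (simp add: eval_poly_def monomial_def sum_distrib_left mult_ac)
  finally show ?thesis .
qed

lemma eval_form_0: "is_form d p \<Longrightarrow> d > 0 \<Longrightarrow> eval_poly p 0 = 0"
  using eval_form_scale[of d p 0 0] by (simp add: power_0_left)

definition subst_poly :: "'m::finite cpoly \<Rightarrow> ('m \<Rightarrow> 'n::finite cpoly) \<Rightarrow> 'n cpoly" where
  "subst_poly p l = (\<Sum>m\<in>Poly_Mapping.keys p.
     const_poly (Poly_Mapping.lookup p m) * (\<Prod>i\<in>UNIV. l i ^ Poly_Mapping.lookup m i))"

lemma eval_subst_poly [simp]: "eval_poly (subst_poly p l) v = eval_poly p (\<chi> i. eval_poly (l i) v)"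
  by (simp add: subst_poly_def eval_poly_def[of p])

lemma is_form_subst:
  assumes "is_form d p" "\<And>i. is_form e (l i)"
  shows "is_form (d * e) (subst_poly p l)"
  unfolding subst_poly_def
proof (intro is_form_sum is_form_const_mult)
  fix m assume "m \<in> Poly_Mapping.keys p"
  then have "(\<Sum>i\<in>UNIV. Poly_Mapping.lookup m i) = d"
    using assms(1) by (simp add: is_form_def)
  moreover have "is_form (\<Sum>i\<in>UNIV. Poly_Mapping.lookup m i * e) (\<Prod>i\<in>UNIV. l i ^ Poly_Mapping.lookup m i)"
    by (intro is_form_prod is_form_power assms(2)) simp
  ultimately show "is_form (d * e) (\<Prod>i\<in>UNIV. l i ^ Poly_Mapping.lookup m i)"
    by (simp add: sum_distrib_right[symmetric])
qed


section \<open>Bivariate polynomials\<close>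

text \<open>\<open>x\<close> goes into the coefficients and \<open>y\<close> into the main variable.
  Degrees, leading coefficients and pseudo-division always refer to the variable of the second
  argument.\<close>

definition ev2 :: "complex poly poly \<Rightarrow> complex \<Rightarrow> complex \<Rightarrow> complex" where
  "ev2 A x y = poly (poly A [:y:]) x"

lemma ev2_simps [simp]:
  "ev2 0 x y = 0" "ev2 1 x y = 1" "ev2 (A + B) x y = ev2 A x y + ev2 B x y"
  "ev2 (A - B) x y = ev2 A x y - ev2 B x y" "ev2 (- A) x y = - ev2 A x y"
  "ev2 (A * B) x y = ev2 A x y * ev2 B x y" "ev2 (A ^ n) x y = ev2 A x y ^ n"
  "ev2 (pCons p A) x y = poly p x + y * ev2 A x y" "ev2 (smult p A) x y = poly p x * ev2 A x y"
  by (simp_all add: ev2_def)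

lemma ev2_monom [simp]: "ev2 (monom p n) x y = poly p x * y ^ n"
  by (simp add: ev2_def poly_monom)

lemma ev2_sum [simp]: "ev2 (sum f S) x y = (\<Sum>i\<in>S. ev2 (f i) x y)"
  by (induction S rule: infinite_finite_induct) auto

text \<open>Restriction to the fibre over \<open>x\<close> of the projection along the main
  variable.\<close>

definition spec :: "complex \<Rightarrow> complex poly poly \<Rightarrow> complex poly" where
  "spec x A = map_poly (\<lambda>c. poly c x) A"

lemma coeff_spec [simp]: "coeff (spec x A) n = poly (coeff A n) x"
  by (simp add: spec_def coeff_map_poly)

lemma spec_pCons [simp]: "spec x (pCons p A) = pCons (poly p x) (spec x A)"
  by (rule poly_eqI) (auto simp: coeff_pCons split: nat.splits)

lemma poly_spec: "poly (spec x A) y = ev2 A x y"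
proof (induction A)
  case 0
  then show ?case by (simp add: spec_def)
qed simp

lemma degree_spec_le: "degree (spec x A) \<le> degree A"
  by (simp add: degree_le coeff_eq_0)

lemma spec_mult: "spec x (A * B) = spec x A * spec x B"
  by (rule poly_eq_poly_eq_iff[THEN iffD1]) (simp add: fun_eq_iff poly_spec)

lemma spec_diff: "spec x (A - B) = spec x A - spec x B"
  by (rule poly_eqI) simp

lemma ev2_coeff_sum:
  assumes "degree A \<le> n"
  shows "ev2 A x y = (\<Sum>j\<le>n. poly (coeff A j) x * y ^ j)"
proof -
  have "degree (spec x A) \<le> n"
    using assms degree_spec_le[of x A] by simp
  then have "poly (spec x A) y = (\<Sum>j\<le>n. coeff (spec x A) j * y ^ j)"
    unfolding poly_altdef by (intro sum.mono_neutral_left) (auto simp: coeff_eq_0 simp del: coeff_spec)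
  then show ?thesis
    by (simp add: poly_spec)
qed

lemma ev2_eq_0_imp:
  assumes "\<And>x y. ev2 A x y = 0"
  shows "A = 0"
proof (rule poly_eqI)
  fix n
  have "spec x A = 0" for x
    using assms by (simp add: poly_all_0_iff_0[symmetric] poly_spec)
  then have "poly (coeff A n) x = 0" for x
    by (metis coeff_spec coeff_0)
  then show "coeff A n = coeff 0 n"
    using poly_all_0_iff_0[of "coeff A n"] by simp
qed

lemma ev2_eq_imp: "(\<And>x y. ev2 A x y = ev2 B x y) \<Longrightarrow> A = B"
  using ev2_eq_0_imp[of "A - B"] by simp

text \<open>The closure rules below prove that an expression is polynomial without writing down the
  representing element of the polynomial ring.\<close>

definition is_poly2 :: "(complex \<Rightarrow> complex \<Rightarrow> complex) \<Rightarrow> bool" where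
  "is_poly2 f \<longleftrightarrow> (\<exists>A. \<forall>x y. f x y = ev2 A x y)"

lemma is_poly2_ev2: "is_poly2 (ev2 A)"
  by (auto simp: is_poly2_def)

lemma is_poly2_const: "is_poly2 (\<lambda>x y. c)"
  unfolding is_poly2_def by (rule exI[of _ "[:[:c:]:]"]) simp

lemma is_poly2_fst: "is_poly2 (\<lambda>x y. x)"
  unfolding is_poly2_def by (rule exI[of _ "[:[:0,1:]:]"]) simp

lemma is_poly2_snd: "is_poly2 (\<lambda>x y. y)"
  unfolding is_poly2_def by (rule exI[of _ "[:0,1:]"]) simp

lemma is_poly2_add: "is_poly2 f \<Longrightarrow> is_poly2 g \<Longrightarrow> is_poly2 (\<lambda>x y. f x y + g x y)"
  unfolding is_poly2_def by (metis ev2_simps(3))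

lemma is_poly2_diff: "is_poly2 f \<Longrightarrow> is_poly2 g \<Longrightarrow> is_poly2 (\<lambda>x y. f x y - g x y)"
  unfolding is_poly2_def by (metis ev2_simps(4))

lemma is_poly2_uminus: "is_poly2 f \<Longrightarrow> is_poly2 (\<lambda>x y. - f x y)"
  unfolding is_poly2_def by (metis ev2_simps(5))

lemma is_poly2_mult: "is_poly2 f \<Longrightarrow> is_poly2 g \<Longrightarrow> is_poly2 (\<lambda>x y. f x y * g x y)"
  unfolding is_poly2_def by (metis ev2_simps(6))

lemma is_poly2_power: "is_poly2 f \<Longrightarrow> is_poly2 (\<lambda>x y. f x y ^ n)"
  unfolding is_poly2_def by (metis ev2_simps(7))

lemma is_poly2_sum: "(\<And>i. i \<in> S \<Longrightarrow> is_poly2 (f i)) \<Longrightarrow> is_poly2 (\<lambda>x y. \<Sum>i\<in>S. f i x y)"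
  by (induction S rule: infinite_finite_induct) (auto intro: is_poly2_add is_poly2_const)

lemma is_poly2_prod: "(\<And>i. i \<in> S \<Longrightarrow> is_poly2 (f i)) \<Longrightarrow> is_poly2 (\<lambda>x y. \<Prod>i\<in>S. f i x y)"
  by (induction S rule: infinite_finite_induct) (auto intro: is_poly2_mult is_poly2_const)

lemmas is_poly2_intros = is_poly2_const is_poly2_fst is_poly2_snd is_poly2_add is_poly2_diff
  is_poly2_uminus is_poly2_mult is_poly2_power is_poly2_sum is_poly2_prod

lemma is_poly2_eval_poly:
  assumes "\<And>i. is_poly2 (\<lambda>x y. v x y $ i)"
  shows "is_poly2 (\<lambda>x y. eval_poly p (v x y))"
  unfolding eval_poly_def by (intro is_poly2_intros assms)

lemma is_poly2_swap:
  assumes "is_poly2 f"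
  shows "is_poly2 (\<lambda>x y. f y x)"
proof -
  obtain A where A: "\<And>x y. f x y = ev2 A x y"
    using assms by (auto simp: is_poly2_def)
  have "is_poly2 (\<lambda>x y. poly p y)" for p
    unfolding poly_altdef by (intro is_poly2_intros)
  then have "is_poly2 (\<lambda>x y. \<Sum>j\<le>degree A. poly (coeff A j) y * x ^ j)"
    by (intro is_poly2_intros)
  then show ?thesis
    by (simp add: A ev2_coeff_sum[OF order.refl])
qed

lemma field_differentiable_ev2:
  assumes "f field_differentiable at s" "g field_differentiable at s"
  shows "(\<lambda>s. ev2 A (f s) (g s)) field_differentiable at s"
proof -
  have P: "(\<lambda>s. poly p (f s)) field_differentiable at s" for p
    by (induction p) (auto intro!: derivative_intros assms)
  show ?thesis
    by (induction A) (auto intro!: derivative_intros assms P)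
qed

section \<open>Regular functions on affine plane curves\<close>

lemma dvd_low_degree_imp_0: "f dvd p \<Longrightarrow> degree p < degree f \<Longrightarrow> p = 0"
  for f p :: "'a::idom poly"
  using dvd_imp_degree_le[of f p] by (cases "p = 0") auto

text \<open>A prime of positive degree in the main variable cannot divide a nonzero polynomial in
  the base variable alone.\<close>

lemma dvd_mult_const_poly_poly:
  fixes F r :: "complex poly poly"
  assumes F: "prime_elem F" "degree F > 0" and a: "a \<noteq> 0" and "F dvd smult a r"
  shows "F dvd r"
proof -
  have "F dvd [:a:] * r"
    using assms by simp
  moreover have "\<not> F dvd [:a:]"
    using F(2) a dvd_imp_degree_le[of F "[:a:]"] by auto
  ultimately show ?thesis
    using F(1) prime_elem_dvd_multD by blast
qed

text \<open>A substitute for the resultant. Take a nonzero combination r of q and F of least degree.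
  Pseudo-division of F by r leaves remainder 0, so a multiple b F factors as r e. If r had positive
  degree, primality of F would force F to divide e, and then r would divide the constant b.\<close>

lemma elimination:
  fixes F q :: "complex poly poly"
  assumes F: "prime_elem F" "degree F > 0" and q: "\<not> F dvd q"
  shows "\<exists>u v n. n \<noteq> 0 \<and> u * q + v * F = [:n:]"
proof -
  define S where "S = {r. r \<noteq> 0 \<and> (\<exists>u v. r = u * q + v * F)}"
  have F0: "F \<noteq> 0" using F by auto
  have red: "\<exists>a d. a \<noteq> 0 \<and> smult a f = g * d + pseudo_mod f g \<and>
      (pseudo_mod f g = 0 \<or> degree (pseudo_mod f g) < degree g)"
    if "g \<noteq> 0" for f g :: "complex poly poly"
    using pseudo_mod[OF that, of f] by blast
  obtain a d where ad: "a \<noteq> 0" "smult a q = F * d + pseudo_mod q F"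
    "pseudo_mod q F = 0 \<or> degree (pseudo_mod q F) < degree F"
    using red[OF F0] by blast
  have "pseudo_mod q F \<noteq> 0"
    using dvd_mult_const_poly_poly[OF F ad(1)] q ad(2) by auto
  moreover have "pseudo_mod q F = [:a:] * q + (- d) * F"
    using ad(2) by (simp add: algebra_simps)
  ultimately have S1: "pseudo_mod q F \<in> S"
    unfolding S_def by blast
  have S2: "degree (pseudo_mod q F) < degree F"
    using ad(3) \<open>pseudo_mod q F \<noteq> 0\<close> by blast
  obtain r where rS: "r \<in> S" and rmin: "\<And>s. s \<in> S \<Longrightarrow> degree r \<le> degree s"
    using arg_min_nat_lemma[of "\<lambda>r. r \<in> S" _ degree, OF S1] by blast
  have r0: "r \<noteq> 0" and rF: "degree r < degree F"
    using rS S2 rmin[OF S1] by (auto simp: S_def)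
  obtain u v where uv: "r = u * q + v * F"
    using rS by (auto simp: S_def)
  have "degree r = 0"
  proof (rule ccontr)
    assume r1: "degree r \<noteq> 0"
    obtain b e where be: "b \<noteq> 0" "smult b F = r * e + pseudo_mod F r"
      "pseudo_mod F r = 0 \<or> degree (pseudo_mod F r) < degree r"
      using red[OF r0] by blast
    have "pseudo_mod F r = (- e * u) * q + ([:b:] - e * v) * F"
      using be(2) uv by (simp add: algebra_simps)
    then have "pseudo_mod F r \<in> S \<or> pseudo_mod F r = 0"
      unfolding S_def by blast
    with be(3) have p0: "pseudo_mod F r = 0"
      using rmin[of "pseudo_mod F r"] by linarith
    have eq: "smult b F = r * e"
      using be(2) p0 by simp
    then have "F dvd r * e"
      unfolding eq[symmetric] by (simp add: dvd_smult)
    moreover have "\<not> F dvd r"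
      using rF r0 dvd_low_degree_imp_0 by blast
    ultimately obtain e' where e': "e = F * e'"
      using F(1) prime_elem_dvd_multD by blast
    have "F * [:b:] = F * (r * e')"
      using eq e' by (simp add: mult_ac)
    then have "[:b:] = r * e'"
      using F0 by (simp only: mult_cancel_left) simp
    moreover from this be(1) have "e' \<noteq> 0"
      by auto
    ultimately show False
      using r1 r0 degree_mult_eq[of r e'] by (metis degree_pCons_0 add_is_0)
  qed
  then obtain n where "r = [:n:]"
    using degree_eq_zeroE by blast
  then show ?thesis
    using uv r0 by (metis pCons_0_0)
qed

text \<open>The constant leading coefficient makes the projection to the base variable finite: each
  fibre has \<open>degree F\<close> points, counted with multiplicity, and none escapes to
  infinity.\<close>

locale affine_curve =
  fixes F :: "complex poly poly"
  assumes prime: "prime_elem F"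
    and deg: "degree F > 0"
    and lead: "degree (lead_coeff F) = 0"
begin

lemma F_nz: "F \<noteq> 0"
  using deg by auto

lemma degree_spec: "degree (spec x F) = degree F" "spec x F \<noteq> 0"
proof -
  obtain c where c: "lead_coeff F = [:c:]"
    using lead degree_eq_zeroE by blast
  with F_nz have "c \<noteq> 0"
    by auto
  then have *: "coeff (spec x F) (degree F) \<noteq> 0"
    using c by simp
  then show "spec x F \<noteq> 0"
    by (metis coeff_0)
  show "degree (spec x F) = degree F"
    using le_degree[OF *] degree_spec_le[of x F] by simp
qed

lemma ex_point: "\<exists>y. ev2 F x y = 0"
proof -
  have "\<not> constant (poly (spec x F))"
    using deg by (simp add: constant_degree degree_spec)
  then show ?thesis
    using fundamental_theorem_of_algebra[of "spec x F"] by (auto simp: poly_spec)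
qed

text \<open>Otherwise elimination gives a nonzero polynomial in the base variable that vanishes at
  every x, since a point of the curve lies over every x.\<close>

lemma vanishing_imp_dvd:
  assumes "\<And>x y. ev2 F x y = 0 \<Longrightarrow> ev2 q x y = 0"
  shows "F dvd q"
proof (rule ccontr)
  assume "\<not> F dvd q"
  then obtain u v n where n: "n \<noteq> 0" "u * q + v * F = [:n:]"
    using elimination prime deg by blast
  have "poly n x = 0" for x
  proof -
    obtain y where y: "ev2 F x y = 0"
      using ex_point by blast
    have "poly n x = ev2 (u * q + v * F) x y"
      by (simp only: n(2)) simp
    also have "\<dots> = 0"
      using y assms by simp
    finally show ?thesis .
  qed
  then show False
    using n(1) poly_all_0_iff_0[of n] by simp
qed

lemma dvd_imp_vanishing: "F dvd q \<Longrightarrow> ev2 F x y = 0 \<Longrightarrow> ev2 q x y = 0"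
  by (auto elim!: dvdE)

lemma low_degree_eq_0:
  assumes "degree q < degree F" "\<And>x y. ev2 F x y = 0 \<Longrightarrow> ev2 q x y = 0"
  shows "q = 0"
  using vanishing_imp_dvd[OF assms(2)] assms(1) by (rule dvd_low_degree_imp_0)

text \<open>After division by the gcd, a root of the remaining factor d of f would also be a root of
  the local multiplier q, because d is coprime to the rest of p.\<close>

lemma dvd_local:
  fixes f p :: "complex poly"
  assumes f: "f \<noteq> 0" and loc: "\<And>a. poly f a = 0 \<Longrightarrow> \<exists>q. poly q a \<noteq> 0 \<and> f dvd q * p"
  shows "f dvd p"
proof -
  define g where "g = gcd f p"
  obtain d where d: "f = g * d"
    unfolding g_def by (meson dvdE gcd_dvd1)
  obtain e where e: "p = g * e"
    unfolding g_def by (meson dvdE gcd_dvd2)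
  have g0: "g \<noteq> 0"
    using f by (simp add: g_def)
  have "coprime d e"
  proof -
    have "gcd (g * d) (g * e) = normalize (g * gcd d e)"
      by (rule gcd_mult_left)
    moreover have "gcd (g * d) (g * e) = g"
      using d e g_def by metis
    ultimately have "normalize (g * gcd d e) = g"
      by simp
    then have "g * gcd d e dvd g * 1"
      by (metis dvd_refl mult.right_neutral normalize_dvd_iff)
    then have "gcd d e dvd 1"
      using g0 by (simp only: dvd_mult_cancel_left) simp
    then show ?thesis
      by (simp add: coprime_iff_gcd_eq_1 is_unit_gcd_iff)
  qed
  have "degree d = 0"
  proof (rule ccontr)
    assume "degree d \<noteq> 0"
    then obtain a where a: "poly d a = 0"
      using fundamental_theorem_of_algebra[of d] by (auto simp: constant_degree)
    with d have "poly f a = 0" by simp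
    then obtain q where q: "poly q a \<noteq> 0" "f dvd q * p"
      using loc by blast
    have "g * d dvd g * (q * e)"
      using q(2) d e by (simp add: mult_ac)
    then have "d dvd q * e"
      using g0 by (simp only: dvd_mult_cancel_left) simp
    then have "d dvd q"
      using \<open>coprime d e\<close> by (simp add: coprime_dvd_mult_left_iff)
    with a q(1) show False
      by (auto elim!: dvdE)
  qed
  then have "is_unit d"
    using f d by (auto simp: is_unit_iff_degree)
  then obtain k where k: "1 = d * k"
    by (rule dvdE)
  have "p = g * (d * k) * e"
    by (simp add: k[symmetric] e)
  then have "p = f * (k * e)"
    by (simp add: d mult_ac)
  then show ?thesis ..
qed

text \<open>
  Among all denominators in the base variable take one of minimal degree. At a root of it the
  numerator vanishes on the whole fibre with multiplicities, so the root can be cancelled.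
\<close>

lemma locally_regular_imp_polynomial:
  assumes loc: "\<And>x0 y0. ev2 F x0 y0 = 0 \<Longrightarrow> \<exists>p q. ev2 q x0 y0 \<noteq> 0 \<and>
      (\<forall>x y. ev2 F x y = 0 \<longrightarrow> ev2 q x y * \<phi> x y = ev2 p x y)"
  shows "\<exists>P. degree P < degree F \<and> (\<forall>x y. ev2 F x y = 0 \<longrightarrow> \<phi> x y = ev2 P x y)"
proof -
  define good where "good n \<longleftrightarrow> n \<noteq> 0 \<and> (\<exists>P. degree P < degree F \<and>
     (\<forall>x y. ev2 F x y = 0 \<longrightarrow> poly n x * \<phi> x y = ev2 P x y))" for n
  \<comment> \<open>One local quotient suffices for a start: elimination turns its denominator into
    a polynomial in x, and pseudo-division by F lowers the degree of the numerator.\<close>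
  have "\<exists>n. good n"
  proof -
    obtain y0 where "ev2 F 0 y0 = 0"
      using ex_point by blast
    then obtain p q where pq: "ev2 q 0 y0 \<noteq> 0" "\<And>x y. ev2 F x y = 0 \<Longrightarrow> ev2 q x y * \<phi> x y = ev2 p x y"
      using loc by metis
    have "\<not> F dvd q"
      using dvd_imp_vanishing pq(1) \<open>ev2 F 0 y0 = 0\<close> by blast
    then obtain u v n where n: "n \<noteq> 0" "u * q + v * F = [:n:]"
      using elimination prime deg by blast
    obtain a d where ad: "a \<noteq> 0" "smult a (u * p) = F * d + pseudo_mod (u * p) F"
      "pseudo_mod (u * p) F = 0 \<or> degree (pseudo_mod (u * p) F) < degree F"
      using pseudo_mod[OF F_nz, of "u * p"] by blast
    have "poly (a * n) x * \<phi> x y = ev2 (pseudo_mod (u * p) F) x y" if V: "ev2 F x y = 0" for x y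
    proof -
      have "poly n x = ev2 (u * q + v * F) x y"
        by (simp only: n(2)) simp
      then have "poly n x = ev2 u x y * ev2 q x y"
        using V by simp
      then have "poly (a * n) x * \<phi> x y = ev2 (smult a (u * p)) x y"
        using pq(2)[OF V] by (simp add: mult_ac)
      then show ?thesis
        using V by (simp add: ad(2))
    qed
    moreover have "degree (pseudo_mod (u * p) F) < degree F"
      using ad(3) deg by auto
    ultimately have "good (a * n)"
      unfolding good_def using n(1) ad(1) by auto
    then show ?thesis ..
  qed
  then obtain n where n: "good n" and nmin: "\<And>m. good m \<Longrightarrow> degree n \<le> degree m"
    using arg_min_nat_lemma[of good _ degree] by metis
  obtain P where n0: "n \<noteq> 0" and P: "degree P < degree F"
    "\<And>x y. ev2 F x y = 0 \<Longrightarrow> poly n x * \<phi> x y = ev2 P x y"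
    using n by (auto simp: good_def)
  have "degree n = 0"
  proof (rule ccontr)
    assume "degree n \<noteq> 0"
    then obtain x0 where x0: "poly n x0 = 0"
      using fundamental_theorem_of_algebra[of n] by (auto simp: constant_degree)
    then obtain n' where n': "n = [:- x0, 1:] * n'"
      by (auto simp: poly_eq_0_iff_dvd elim!: dvdE)
    \<comment> \<open>Two fractions for the same function agree on the curve, so their cross
      products agree modulo F.\<close>
    have cross: "F dvd q * P - smult n p"
      if "\<And>x y. ev2 F x y = 0 \<Longrightarrow> ev2 q x y * \<phi> x y = ev2 p x y" for p q
    proof (rule vanishing_imp_dvd)
      fix x y assume V: "ev2 F x y = 0"
      have "ev2 q x y * ev2 P x y = poly n x * (ev2 q x y * \<phi> x y)"
        using P(2)[OF V] by simp
      then show "ev2 (q * P - smult n p) x y = 0"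
        using that[OF V] by simp
    qed
    have "spec x0 F dvd spec x0 P"
    proof (rule dvd_local)
      show "spec x0 F \<noteq> 0"
        by (rule degree_spec)
      fix a assume "poly (spec x0 F) a = 0"
      then have "ev2 F x0 a = 0"
        by (simp add: poly_spec)
      then obtain p q where pq: "ev2 q x0 a \<noteq> 0" "\<And>x y. ev2 F x y = 0 \<Longrightarrow> ev2 q x y * \<phi> x y = ev2 p x y"
        using loc by metis
      obtain s where s: "q * P - smult n p = F * s"
        using cross[OF pq(2)] by blast
      have "spec x0 q * spec x0 P = spec x0 F * spec x0 s"
        using arg_cong[OF s, of "spec x0"] x0
        by (simp add: spec_diff spec_mult) (simp add: poly_eq_iff x0)
      with pq(1) show "\<exists>q. poly q a \<noteq> 0 \<and> spec x0 F dvd q * spec x0 P"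
        by (metis poly_spec dvd_triv_left)
    qed
    then have "spec x0 P = 0"
      by (rule dvd_low_degree_imp_0) (use degree_spec_le[of x0 P] P(1) degree_spec(1)[of x0] in simp)
    then have "[:- x0, 1:] dvd coeff P i" for i
      by (metis coeff_spec coeff_0 poly_eq_0_iff_dvd)
    then have "[:[:- x0, 1:]:] dvd P"
      by (simp add: const_poly_dvd_iff)
    then obtain P' where P': "P = smult [:- x0, 1:] P'"
      by (auto elim!: dvdE)
    have "poly n' x * \<phi> x y = ev2 P' x y" if V: "ev2 F x y = 0" for x y
    proof -
      obtain p q where pq: "ev2 q x y \<noteq> 0" "\<And>x y. ev2 F x y = 0 \<Longrightarrow> ev2 q x y * \<phi> x y = ev2 p x y"
        using loc V by metis
      have eq: "q * P - smult n p = smult [:- x0, 1:] (q * P' - smult n' p)"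
        by (simp add: P' n' smult_diff_right)
      \<comment> \<open>The factor x - x0 is cancelled modulo F; a pointwise cancellation would say
        nothing on the fibre over x0.\<close>
      have "F dvd smult [:- x0, 1:] (q * P' - smult n' p)"
        using cross[OF pq(2)] by (simp only: eq)
      then have "F dvd q * P' - smult n' p"
        by (rule dvd_mult_const_poly_poly[OF prime deg, rotated]) simp
      from dvd_imp_vanishing[OF this V]
      have "ev2 q x y * ev2 P' x y = poly n' x * (ev2 q x y * \<phi> x y)"
        using pq(2)[OF V] by simp
      with pq(1) show ?thesis
        by simp
    qed
    moreover have "degree P' < degree F"
      using P(1) by (simp add: P' degree_smult_eq)
    moreover have "n' \<noteq> 0"
      using n0 n' by auto
    ultimately have "good n'"
      by (auto simp: good_def)
    then have "degree n \<le> degree n'"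
      by (rule nmin)
    moreover have "degree n = degree [:- x0, 1:] + degree n'"
      unfolding n' by (rule degree_mult_eq) (use \<open>n' \<noteq> 0\<close> in auto)
    ultimately show False
      by simp
  qed
  then obtain c where c: "n = [:c:]"
    using degree_eq_zeroE by blast
  then have c0: "c \<noteq> 0"
    using n0 by auto
  have "\<phi> x y = ev2 (smult [:1 / c:] P) x y" if "ev2 F x y = 0" for x y
    using P(2)[OF that] c c0 by (simp add: field_simps)
  moreover have "degree (smult [:1 / c:] P) < degree F"
    using P(1) degree_smult_le[of "[:1 / c:]" P] by simp
  ultimately show ?thesis
    by blast
qed

end

section \<open>Directional derivatives\<close>

definition dir_deriv :: "'n::finite cpoly \<Rightarrow> complex ^ 'n \<Rightarrow> complex ^ 'n \<Rightarrow> complex" where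
  "dir_deriv p v \<tau> = (\<Sum>i\<in>UNIV. eval_poly (partial_deriv i p) v * \<tau> $ i)"

lemma has_field_derivative_prod_fin:
  fixes f :: "'a \<Rightarrow> complex \<Rightarrow> complex"
  assumes "finite A" "\<And>i. i \<in> A \<Longrightarrow> (f i has_field_derivative f' i) (at s)"
  shows "((\<lambda>s. \<Prod>i\<in>A. f i s) has_field_derivative (\<Sum>i\<in>A. f' i * (\<Prod>j\<in>A - {i}. f j s))) (at s)"
  using assms
proof (induction A rule: finite_induct)
  case (insert a A)
  have "(\<Sum>i\<in>A. f' i * (\<Prod>j\<in>insert a A - {i}. f j s)) = f a s * (\<Sum>i\<in>A. f' i * (\<Prod>j\<in>A - {i}. f j s))"
    unfolding sum_distrib_left
  proof (rule sum.cong)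
    fix i assume "i \<in> A"
    then have "insert a A - {i} = insert a (A - {i})"
      using insert.hyps by auto
    then show "f' i * (\<Prod>j\<in>insert a A - {i}. f j s) = f a s * (f' i * (\<Prod>j\<in>A - {i}. f j s))"
      using insert.hyps by simp
  qed simp
  moreover have "((\<lambda>s. f a s * (\<Prod>i\<in>A. f i s)) has_field_derivative
     f' a * (\<Prod>i\<in>A. f i s) + (\<Sum>i\<in>A. f' i * (\<Prod>j\<in>A - {i}. f j s)) * f a s) (at s)"
    by (rule DERIV_mult) (use insert in auto)
  ultimately show ?case
    using insert.hyps by (simp add: mult.commute)
qed simp

lemma eval_partial_deriv:
  "eval_poly (partial_deriv i p) v = (\<Sum>m\<in>Poly_Mapping.keys p. Poly_Mapping.lookup p m *
     (of_nat (Poly_Mapping.lookup m i) * (v $ i) ^ (Poly_Mapping.lookup m i - 1) *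
      (\<Prod>j\<in>UNIV - {i}. (v $ j) ^ Poly_Mapping.lookup m j)))"
proof -
  have "monomial v (m - Poly_Mapping.single i 1) = (v $ i) ^ (Poly_Mapping.lookup m i - 1) *
      (\<Prod>j\<in>UNIV - {i}. (v $ j) ^ Poly_Mapping.lookup m j)" for m
    unfolding monomial_def
    by (subst prod.remove[of UNIV i]) (auto simp: lookup_minus lookup_single when_def intro!: prod.cong)
  then show ?thesis
    by (simp add: partial_deriv_def mult_ac)
qed

text \<open>Links the formal partial derivatives to analysis. The sum, product and chain rules below
  then follow from uniqueness of derivatives, with no manipulation of coefficients.\<close>

lemma has_field_derivative_eval_poly:
  assumes "\<And>i. ((\<lambda>s. \<gamma> s $ i) has_field_derivative \<tau> $ i) (at s)"
  shows "((\<lambda>s. eval_poly p (\<gamma> s)) has_field_derivative dir_deriv p (\<gamma> s) \<tau>) (at s)"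
proof -
  have "((\<lambda>s. \<Sum>m\<in>Poly_Mapping.keys p. Poly_Mapping.lookup p m * (\<Prod>i\<in>UNIV. (\<gamma> s $ i) ^ Poly_Mapping.lookup m i))
     has_field_derivative (\<Sum>m\<in>Poly_Mapping.keys p. Poly_Mapping.lookup p m *
       (\<Sum>i\<in>UNIV. (of_nat (Poly_Mapping.lookup m i) * (\<gamma> s $ i) ^ (Poly_Mapping.lookup m i - 1) * \<tau> $ i) *
          (\<Prod>j\<in>UNIV - {i}. (\<gamma> s $ j) ^ Poly_Mapping.lookup m j)))) (at s)"
    by (intro DERIV_sum DERIV_cmult has_field_derivative_prod_fin)
      (auto intro!: derivative_eq_intros assms)
  moreover have "(\<Sum>m\<in>Poly_Mapping.keys p. Poly_Mapping.lookup p m *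
       (\<Sum>i\<in>UNIV. (of_nat (Poly_Mapping.lookup m i) * (\<gamma> s $ i) ^ (Poly_Mapping.lookup m i - 1) * \<tau> $ i) *
          (\<Prod>j\<in>UNIV - {i}. (\<gamma> s $ j) ^ Poly_Mapping.lookup m j))) = dir_deriv p (\<gamma> s) \<tau>"
    unfolding dir_deriv_def eval_partial_deriv sum_distrib_left sum_distrib_right
    by (subst sum.swap) (simp add: mult_ac)
  ultimately show ?thesis
    by (simp add: eval_poly_def)
qed

lemma has_field_derivative_line:
  "((\<lambda>s. (v + s *s \<tau>) $ i) has_field_derivative \<tau> $ i) (at s)"
  by (auto intro!: derivative_eq_intros)

lemma dir_deriv_has_field_derivative:
  "((\<lambda>s. eval_poly p (v + s *s \<tau>)) has_field_derivative dir_deriv p v \<tau>) (at 0)"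
  using has_field_derivative_eval_poly[where p = p and \<gamma> = "\<lambda>s. v + s *s \<tau>" and s = 0 and \<tau> = \<tau>,
      OF has_field_derivative_line] by simp

lemma dir_deriv_eqI:
  "((\<lambda>s. eval_poly p (v + s *s \<tau>)) has_field_derivative D) (at 0) \<Longrightarrow> dir_deriv p v \<tau> = D"
  using DERIV_unique dir_deriv_has_field_derivative by blast

lemma dir_deriv_var [simp]: "dir_deriv (var_poly i) v \<tau> = \<tau> $ i"
  by (rule dir_deriv_eqI) (simp, auto intro!: derivative_eq_intros)

lemma dir_deriv_const [simp]: "dir_deriv (const_poly c) v \<tau> = 0"
  by (rule dir_deriv_eqI) simp

lemma dir_deriv_add [simp]: "dir_deriv (p + q) v \<tau> = dir_deriv p v \<tau> + dir_deriv q v \<tau>"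
  by (rule dir_deriv_eqI) (simp, intro DERIV_add dir_deriv_has_field_derivative)

lemma dir_deriv_diff [simp]: "dir_deriv (p - q) v \<tau> = dir_deriv p v \<tau> - dir_deriv q v \<tau>"
  by (rule dir_deriv_eqI) (simp, intro DERIV_diff dir_deriv_has_field_derivative)

lemma dir_deriv_mult [simp]: "dir_deriv (p * q) v \<tau> = dir_deriv p v \<tau> * eval_poly q v + eval_poly p v * dir_deriv q v \<tau>"
  using DERIV_mult[OF dir_deriv_has_field_derivative[of p v \<tau>] dir_deriv_has_field_derivative[of q v \<tau>]]
  by (intro dir_deriv_eqI) (simp add: algebra_simps)

lemma dir_deriv_power [simp]: "dir_deriv (p ^ n) v \<tau> = of_nat n * eval_poly p v ^ (n - 1) * dir_deriv p v \<tau>"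
  using DERIV_power[OF dir_deriv_has_field_derivative[of p v \<tau>], of n]
  by (intro dir_deriv_eqI) (simp add: algebra_simps)

lemma dir_deriv_subst:
  "dir_deriv (subst_poly p h) v \<tau> = dir_deriv p (\<chi> i. eval_poly (h i) v) (\<chi> i. dir_deriv (h i) v \<tau>)"
proof (rule dir_deriv_eqI)
  have "((\<lambda>s. eval_poly p (\<chi> i. eval_poly (h i) (v + s *s \<tau>))) has_field_derivative
    dir_deriv p (\<chi> i. eval_poly (h i) (v + 0 *s \<tau>)) (\<chi> i. dir_deriv (h i) v \<tau>)) (at 0)"
    by (rule has_field_derivative_eval_poly) (simp add: dir_deriv_has_field_derivative)
  then show "((\<lambda>s. eval_poly (subst_poly p h) (v + s *s \<tau>)) has_field_derivative
    dir_deriv p (\<chi> i. eval_poly (h i) v) (\<chi> i. dir_deriv (h i) v \<tau>)) (at 0)"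
    by simp
qed

lemma dir_deriv_axis: "dir_deriv p v (axis i 1) = eval_poly (partial_deriv i p) v"
proof -
  have "dir_deriv p v (axis i 1) = (\<Sum>j\<in>UNIV. if j = i then eval_poly (partial_deriv i p) v else 0)"
    unfolding dir_deriv_def by (rule sum.cong) (auto simp: axis_def)
  then show ?thesis by simp
qed

lemma dir_deriv_lin_add: "dir_deriv p v (\<tau> + \<sigma>) = dir_deriv p v \<tau> + dir_deriv p v \<sigma>"
  by (simp add: dir_deriv_def algebra_simps sum.distrib)

lemma dir_deriv_lin_diff: "dir_deriv p v (\<tau> - \<sigma>) = dir_deriv p v \<tau> - dir_deriv p v \<sigma>"
  by (simp add: dir_deriv_def algebra_simps sum_subtractf)

lemma dir_deriv_lin_scale: "dir_deriv p v (c *s \<tau>) = c * dir_deriv p v \<tau>"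
  by (simp add: dir_deriv_def sum_distrib_left mult_ac)

text \<open>The extra factor c on the left avoids the truncated exponent d - 1.\<close>

lemma dir_deriv_scale:
  assumes "is_form d p"
  shows "c * dir_deriv p (c *s v) \<tau> = c ^ d * dir_deriv p v \<tau>"
proof -
  have "((\<lambda>s. eval_poly p (c *s (v + s *s \<tau>))) has_field_derivative dir_deriv p (c *s (v + 0 *s \<tau>)) (c *s \<tau>)) (at 0)"
    by (rule has_field_derivative_eval_poly) (auto intro!: derivative_eq_intros)
  moreover have "((\<lambda>s. c ^ d * eval_poly p (v + s *s \<tau>)) has_field_derivative c ^ d * dir_deriv p v \<tau>) (at 0)"
    by (intro DERIV_cmult dir_deriv_has_field_derivative)
  ultimately have "dir_deriv p (c *s (v + 0 *s \<tau>)) (c *s \<tau>) = c ^ d * dir_deriv p v \<tau>"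
    unfolding eval_form_scale[OF assms] by (rule DERIV_unique)
  then show ?thesis
    by (simp add: dir_deriv_lin_scale)
qed

lemma dir_deriv_euler:
  assumes "is_form d p"
  shows "dir_deriv p v v = of_nat d * eval_poly p v"
proof (rule dir_deriv_eqI)
  have "((\<lambda>s. (1 + s) ^ d * eval_poly p v) has_field_derivative of_nat d * eval_poly p v) (at 0)"
    by (auto intro!: derivative_eq_intros)
  moreover have "(\<lambda>s. eval_poly p (v + s *s v)) = (\<lambda>s. (1 + s) ^ d * eval_poly p v)"
  proof
    fix s
    have "v + s *s v = (1 + s) *s v"
      by (simp add: vec_eq_iff algebra_simps)
    then show "eval_poly p (v + s *s v) = (1 + s) ^ d * eval_poly p v"
      by (simp only: eval_form_scale[OF assms])
  qed
  ultimately show "((\<lambda>s. eval_poly p (v + s *s v)) has_field_derivative of_nat d * eval_poly p v) (at 0)"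
    by simp
qed


section \<open>The cross product\<close>

definition cross :: "complex ^ 3 \<Rightarrow> complex ^ 3 \<Rightarrow> complex ^ 3" where
  "cross a b = vector [a $ 2 * b $ 3 - a $ 3 * b $ 2, a $ 3 * b $ 1 - a $ 1 * b $ 3, a $ 1 * b $ 2 - a $ 2 * b $ 1]"

lemma cross_nth [simp]:
  "cross a b $ 1 = a $ 2 * b $ 3 - a $ 3 * b $ 2"
  "cross a b $ 2 = a $ 3 * b $ 1 - a $ 1 * b $ 3"
  "cross a b $ 3 = a $ 1 * b $ 2 - a $ 2 * b $ 1"
  by (simp_all add: cross_def)

lemma vec3_eq_iff: "(a::complex ^ 3) = b \<longleftrightarrow> a $ 1 = b $ 1 \<and> a $ 2 = b $ 2 \<and> a $ 3 = b $ 3"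
  by (simp add: vec_eq_iff forall_3)

lemma cross_self [simp]: "cross a a = 0"
  by (simp add: vec3_eq_iff)

lemma cross_scale: "cross (c *s a) b = c *s cross a b" "cross a (c *s b) = c *s cross a b"
  by (simp_all add: vec3_eq_iff algebra_simps)

lemma cross_lin: "cross a (b + c) = cross a b + cross a c" "cross a (b - c) = cross a b - cross a c"
  by (simp_all add: vec3_eq_iff algebra_simps)

lemma cross_anti: "cross a b = - cross b a"
  by (simp add: vec3_eq_iff algebra_simps)

lemma cross_0 [simp]: "cross 0 b = 0" "cross a 0 = 0"
  by (simp_all add: vec3_eq_iff)

lemma cross_eq_0_imp:
  assumes "cross a b = 0" "a \<noteq> 0"
  shows "\<exists>c. b = c *s a"
proof -
  have eqs: "a $ 2 * b $ 3 = a $ 3 * b $ 2" "a $ 3 * b $ 1 = a $ 1 * b $ 3" "a $ 1 * b $ 2 = a $ 2 * b $ 1"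
    using assms(1) by (simp_all add: vec3_eq_iff)
  consider "a $ 1 \<noteq> 0" | "a $ 2 \<noteq> 0" | "a $ 3 \<noteq> 0"
    using assms(2) by (auto simp: vec3_eq_iff)
  then show ?thesis
  proof cases
    case 1
    then show ?thesis using eqs
      by (intro exI[of _ "b $ 1 / a $ 1"]) (simp add: vec3_eq_iff field_simps)
  next
    case 2
    then show ?thesis using eqs
      by (intro exI[of _ "b $ 2 / a $ 2"]) (simp add: vec3_eq_iff field_simps)
  next
    case 3
    then show ?thesis using eqs
      by (intro exI[of _ "b $ 3 / a $ 3"]) (simp add: vec3_eq_iff field_simps)
  qed
qed

text \<open>Uses n x (a x b) = (n . b) a - (n . a) b.\<close>

lemma cross_parallel_normal:
  assumes "n $ 1 * a $ 1 + n $ 2 * a $ 2 + n $ 3 * a $ 3 = 0"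
    "n $ 1 * b $ 1 + n $ 2 * b $ 2 + n $ 3 * b $ 3 = 0" "n \<noteq> 0"
  shows "\<exists>J. cross a b = J *s n"
proof -
  have "cross n (cross a b) = 0"
    unfolding vec3_eq_iff cross_nth zero_index using assms(1,2) by (intro conjI; algebra)
  then show ?thesis
    using cross_eq_0_imp assms(3) by blast
qed

section \<open>Gradients and tangent vectors of the cone\<close>

definition grad :: "3 cpoly \<Rightarrow> complex ^ 3 \<Rightarrow> complex ^ 3" where
  "grad p v = (\<chi> i. eval_poly (partial_deriv i p) v)"

lemma grad_nth: "grad p v $ i = dir_deriv p v (axis i 1)"
  by (simp add: grad_def dir_deriv_axis)

lemma dir_deriv_grad: "dir_deriv p v \<tau> = grad p v $ 1 * \<tau> $ 1 + grad p v $ 2 * \<tau> $ 2 + grad p v $ 3 * \<tau> $ 3"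
  by (simp add: dir_deriv_def grad_def sum_3)

lemma grad_scale: "is_form d p \<Longrightarrow> c *s grad p (c *s v) = c ^ d *s grad p v"
  by (simp add: vec_eq_iff grad_nth dir_deriv_scale)

text \<open>A tangent field that is polynomial in v; a choice of local parameters on the curve would
  not be.\<close>

definition tangent :: "3 cpoly \<Rightarrow> 3 \<Rightarrow> complex ^ 3 \<Rightarrow> complex ^ 3" where
  "tangent p k v = cross (grad p v) (axis k 1)"

lemma dir_deriv_tangent: "dir_deriv p v (tangent p k v) = 0"
  by (simp add: dir_deriv_grad tangent_def algebra_simps)

lemma tangent_scale: "is_form d p \<Longrightarrow> c *s tangent p k (c *s v) = c ^ d *s tangent p k v"
  unfolding tangent_def by (simp add: cross_scale[symmetric] grad_scale)

lemma axis3: "(axis k 1 :: complex ^ 3) $ 1 = (if k = 1 then 1 else 0)"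
  "(axis k 1 :: complex ^ 3) $ 2 = (if k = 2 then 1 else 0)"
  "(axis k 1 :: complex ^ 3) $ 3 = (if k = 3 then 1 else 0)"
  by (auto simp: axis_def)

text \<open>
  By Euler's formula the tangent plane of the cone contains \<open>v\<close>; the vectors \<open>tangent p k v\<close> are
  therefore determined modulo \<open>v\<close> by \<open>v $ k\<close>.
\<close>

lemma cross_tangent:
  assumes "dir_deriv p v v = 0"
  shows "cross v (tangent p k v) = v $ k *s grad p v"
proof -
  have *: "grad p v $ 1 * v $ 1 + grad p v $ 2 * v $ 2 + grad p v $ 3 * v $ 3 = 0"
    using assms by (simp add: dir_deriv_grad)
  consider "k = 1" | "k = 2" | "k = 3"
    using exhaust_3 by blast
  then show ?thesis
  proof cases
    case 1
    show ?thesis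
      unfolding vec3_eq_iff tangent_def cross_nth axis3 1 by (intro conjI; simp; use * in algebra)
  next
    case 2
    show ?thesis
      unfolding vec3_eq_iff tangent_def cross_nth axis3 2 by (intro conjI; simp; use * in algebra)
  next
    case 3
    show ?thesis
      unfolding vec3_eq_iff tangent_def cross_nth axis3 3 by (intro conjI; simp; use * in algebra)
  qed
qed

lemma tangent_rel:
  assumes "dir_deriv p v v = 0" "v \<noteq> 0"
  shows "\<exists>c. v $ k *s tangent p l v - v $ l *s tangent p k v = c *s v"
proof -
  have "cross v (v $ k *s tangent p l v - v $ l *s tangent p k v) = 0"
    by (simp add: cross_lin cross_scale cross_tangent[OF assms(1)] vec3_eq_iff)
  then show ?thesis
    using cross_eq_0_imp assms(2) by blast
qed

section \<open>Plane quartics in two affine charts\<close>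

text \<open>Used for k = 1 and k = 3. Both charts keep y as the main variable, so they share the
  leading coefficient of a form at y.\<close>

definition chart_pt :: "3 \<Rightarrow> complex \<Rightarrow> complex \<Rightarrow> complex ^ 3" where
  "chart_pt k a y = (\<chi> i. if i = k then 1 else if i = 2 then y else a)"

definition other_coord :: "3 \<Rightarrow> 3" where
  "other_coord k = (if k = 1 then 3 else 1)"

lemma chart_pt_simps [simp]:
  "chart_pt 1 a y $ 1 = 1" "chart_pt 1 a y $ 2 = y" "chart_pt 1 a y $ 3 = a"
  "chart_pt 3 a y $ 1 = a" "chart_pt 3 a y $ 2 = y" "chart_pt 3 a y $ 3 = 1"
  by (simp_all add: chart_pt_def)

lemma chart_pt_nth_self [simp]: "chart_pt k a y $ k = 1"
  by (simp add: chart_pt_def)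

lemma chart_pt_nz [simp]: "chart_pt k a y \<noteq> 0"
  by (metis chart_pt_nth_self zero_index zero_neq_one)

lemma scale_pt:
  assumes "k = 1 \<or> k = 3" "v $ k \<noteq> 0"
  shows "v = v $ k *s chart_pt k (v $ other_coord k / v $ k) (v $ 2 / v $ k)"
  using assms by (auto simp: vec3_eq_iff other_coord_def)

lemma is_poly2_pt: "is_poly2 (\<lambda>a y. chart_pt k a y $ i)"
  by (cases "i = k"; cases "i = 2") (simp_all add: chart_pt_def is_poly2_intros)

lemmas is_poly2_eval_pt = is_poly2_eval_poly[OF is_poly2_pt]

definition chart :: "3 \<Rightarrow> 3 cpoly \<Rightarrow> complex poly poly" where
  "chart k p = (\<Sum>m\<in>Poly_Mapping.keys p.
     monom (monom (Poly_Mapping.lookup p m) (Poly_Mapping.lookup m (other_coord k))) (Poly_Mapping.lookup m 2))"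

lemma UNIV_3_prod: "(\<Prod>i\<in>(UNIV::3 set). f i) = f 1 * f 2 * f 3" for f :: "3 \<Rightarrow> 'a::comm_monoid_mult"
  unfolding UNIV_3 by (simp add: mult_ac)

lemma ev2_chart:
  assumes "k = 1 \<or> k = 3"
  shows "ev2 (chart k p) a y = eval_poly p (chart_pt k a y)"
  using assms by (auto simp: chart_def eval_poly_def other_coord_def poly_monom UNIV_3_prod mult_ac)

lemma degree_chart_le:
  assumes "is_form d p"
  shows "degree (chart k p) \<le> d"
proof -
  have "Poly_Mapping.lookup m 2 \<le> d" if "m \<in> Poly_Mapping.keys p" for m
    using assms that by (auto simp: is_form_def sum_3)
  then show ?thesis
    unfolding chart_def by (intro degree_sum_le) (auto intro: order.trans[OF degree_monom_le])
qed

text \<open>Among the monomials of degree d only the pure power of y has exponent d in y, and its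
  coefficient is the value at (0:1:0).\<close>

lemma coeff_chart:
  assumes "is_form d p"
  shows "coeff (chart k p) d = [:eval_poly p (axis 2 1):]"
proof -
  have *: "coeff (monom (monom (Poly_Mapping.lookup p m) (Poly_Mapping.lookup m (other_coord k))) (Poly_Mapping.lookup m 2)) d
    = [:Poly_Mapping.lookup p m * (\<Prod>i\<in>UNIV. (axis 2 1 $ i) ^ Poly_Mapping.lookup m i):]"
    if "m \<in> Poly_Mapping.keys p" for m
  proof -
    have s: "Poly_Mapping.lookup m 1 + Poly_Mapping.lookup m 2 + Poly_Mapping.lookup m 3 = d"
      using assms that by (auto simp: is_form_def sum_3)
    show ?thesis
    proof (cases "Poly_Mapping.lookup m 2 = d")
      case True
      with s have "Poly_Mapping.lookup m 1 = 0" "Poly_Mapping.lookup m 3 = 0"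
        by auto
      then show ?thesis
        using True by (simp add: UNIV_3_prod axis3 monom_0 other_coord_def)
    next
      case False
      with s have "Poly_Mapping.lookup m 1 \<noteq> 0 \<or> Poly_Mapping.lookup m 3 \<noteq> 0"
        by auto
      then show ?thesis
        using False by (auto simp: UNIV_3_prod axis3)
    qed
  qed
  have "[:eval_poly p (axis 2 1):] = (\<Sum>m\<in>Poly_Mapping.keys p.
      [:Poly_Mapping.lookup p m * (\<Prod>i\<in>UNIV. (axis 2 1 $ i) ^ Poly_Mapping.lookup m i):])"
    unfolding eval_poly_def by (simp add: sum_to_poly)
  then show ?thesis
    unfolding chart_def coeff_sum using * by simp
qed

section \<open>Affine cones and points of projective space\<close>

definition affine_cone :: "3 cpoly \<Rightarrow> (complex ^ 3) set" where
  "affine_cone p = {v. v \<noteq> 0 \<and> eval_poly p v = 0}"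

lemma cone_scale: "is_form d p \<Longrightarrow> v \<in> affine_cone p \<Longrightarrow> c \<noteq> 0 \<Longrightarrow> c *s v \<in> affine_cone p"
  by (simp add: affine_cone_def eval_form_scale)

lemma mem_proj_pt: "w \<in> proj_pt v \<longleftrightarrow> (\<exists>c. w = c *s v)"
  by (auto simp: proj_pt_def vec.span_singleton)

lemma proj_pt_eq_imp:
  assumes "proj_pt u = proj_pt w" "w \<noteq> 0"
  shows "\<exists>c. c \<noteq> 0 \<and> w = c *s u"
proof -
  have "w \<in> proj_pt u"
    using assms(1) mem_proj_pt[of w w] by (metis vector_smult_lid)
  then show ?thesis
    using assms(2) by (auto simp: mem_proj_pt)
qed

lemma proj_pt_scale: "c \<noteq> 0 \<Longrightarrow> proj_pt (c *s v) = proj_pt v"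
proof (intro set_eqI iffI)
  fix w assume c: "c \<noteq> 0" and "w \<in> proj_pt v"
  then obtain b where "w = b *s v"
    by (auto simp: mem_proj_pt)
  then have "w = (b / c) *s (c *s v)"
    using c by simp
  then show "w \<in> proj_pt (c *s v)"
    unfolding mem_proj_pt ..
qed (auto simp: mem_proj_pt)

lemma proj_pt_in_zero_locus:
  assumes "is_form d p" "v \<noteq> 0"
  shows "proj_pt v \<in> zero_locus p \<longleftrightarrow> eval_poly p v = 0"
proof
  assume "proj_pt v \<in> zero_locus p"
  then obtain w where w: "proj_pt v = proj_pt w" "w \<noteq> 0" "eval_poly p w = 0"
    by (auto simp: zero_locus_def)
  then obtain c where "v = c *s w"
    using proj_pt_eq_imp[of w v] assms(2) by metis
  then show "eval_poly p v = 0"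
    using w(3) by (simp add: eval_form_scale[OF assms(1)])
qed (use assms in \<open>auto simp: zero_locus_def\<close>)

lemma zero_locus_eq_cone: "zero_locus p = proj_pt ` affine_cone p"
  by (auto simp: zero_locus_def affine_cone_def)

text \<open>\<open>apex\<close> keeps (0:1:0) off the curve: the charts x = 1 and z = 1 then cover
  it, and both satisfy \<open>affine_curve\<close>.\<close>

locale plane_quartic =
  fixes F :: "3 cpoly"
  assumes form: "is_form 4 F"
    and smooth: "smooth_form F"
    and apex: "eval_poly F (axis 2 1) \<noteq> 0"
    and prime_chart: "prime_elem (chart 1 F)" "prime_elem (chart 3 F)"
begin

lemma degree_chart: "degree (chart k F) = 4" "degree (lead_coeff (chart k F)) = 0"
proof -
  have c: "coeff (chart k F) 4 = [:eval_poly F (axis 2 1):]"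
    by (rule coeff_chart[OF form])
  then have "coeff (chart k F) 4 \<noteq> 0"
    using apex by simp
  then show d: "degree (chart k F) = 4"
    using le_degree[of "chart k F" 4] degree_chart_le[OF form, of k] by auto
  show "degree (lead_coeff (chart k F)) = 0"
    unfolding d c by simp
qed

lemma affine_chart: "k = 1 \<or> k = 3 \<Longrightarrow> affine_curve (chart k F)"
  using prime_chart degree_chart[of k] by unfold_locales auto

lemma cone_chart:
  assumes "v \<in> affine_cone F"
  obtains k where "k = 1 \<or> k = 3" "v $ k \<noteq> 0"
proof -
  have False if "v $ 1 = 0" "v $ 3 = 0"
  proof -
    have "v = v $ 2 *s axis 2 1"
      using that by (simp add: vec3_eq_iff axis3)
    then have "eval_poly F v = (v $ 2) ^ 4 * eval_poly F (axis 2 1)"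
      by (metis eval_form_scale[OF form])
    then show False
      using assms apex that by (auto simp: affine_cone_def vec3_eq_iff)
  qed
  then show ?thesis
    using that by blast
qed

lemma chart_pt_in_cone: "k = 1 \<or> k = 3 \<Longrightarrow> chart_pt k a y \<in> affine_cone F \<longleftrightarrow> ev2 (chart k F) a y = 0"
  by (simp add: affine_cone_def ev2_chart)

lemma dvd_chart:
  assumes "k = 1 \<or> k = 3" "\<And>w. w \<in> affine_cone F \<Longrightarrow> eval_poly q w = 0"
  shows "chart k F dvd chart k q"
proof (rule affine_curve.vanishing_imp_dvd[OF affine_chart[OF assms(1)]])
  fix a y assume "ev2 (chart k F) a y = 0"
  then show "ev2 (chart k q) a y = 0"
    using assms(2) chart_pt_in_cone[OF assms(1)] by (simp add: ev2_chart[OF assms(1)])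
qed

text \<open>The line through v in direction tau leaves the cone, so vanishing on the cone cannot be
  differentiated directly. In a chart q is a multiple of the equation, hence q = F S near v with S
  differentiable along the line, and the product rule gives 0 because both F and its derivative
  vanish.\<close>

lemma vanishing_derivative:
  assumes q: "is_form e q" "\<And>w. w \<in> affine_cone F \<Longrightarrow> eval_poly q w = 0"
    and v: "v \<in> affine_cone F" and tau: "dir_deriv F v \<tau> = 0"
  shows "dir_deriv q v \<tau> = 0"
proof -
  obtain k where k: "k = 1 \<or> k = 3" and vk: "v $ k \<noteq> 0"
    using cone_chart v by blast
  obtain R where R: "chart k q = chart k F * R"
    using dvd_chart[OF k q(2)] by blast
  define w where "w s = v + s *s \<tau>" for s
  \<comment> \<open>The powers of the k-th coordinate pass from the chart back to the cone; they are
    divided because e may be smaller than 4.\<close>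
  define S where "S s = w s $ k ^ e / w s $ k ^ 4 * ev2 R (w s $ other_coord k / w s $ k) (w s $ 2 / w s $ k)" for s
  have w_diff: "(\<lambda>s. w s $ i) field_differentiable at 0" for i
    unfolding w_def field_differentiable_def using has_field_derivative_line by blast
  have "S field_differentiable at 0"
    unfolding S_def
    by (intro field_differentiable_mult field_differentiable_divide field_differentiable_power
        field_differentiable_ev2 w_diff) (use vk in \<open>auto simp: w_def\<close>)
  then obtain S' where S': "(S has_field_derivative S') (at 0)"
    by (auto simp: field_differentiable_def)
  have F': "((\<lambda>s. eval_poly F (w s)) has_field_derivative 0) (at 0)"
    using dir_deriv_has_field_derivative[of F v \<tau>] tau by (simp add: w_def)
  have deriv: "((\<lambda>s. eval_poly F (w s) * S s) has_field_derivative 0) (at 0)"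
    using DERIV_mult[OF F' S'] v by (simp add: w_def affine_cone_def)
  have eq: "eventually (\<lambda>s. eval_poly F (w s) * S s = eval_poly q (w s)) (nhds 0)"
  proof -
    have "isCont (\<lambda>s. w s $ k) 0"
      using w_diff by (rule field_differentiable_imp_continuous_at)
    then have "((\<lambda>s. w s $ k) \<longlongrightarrow> w 0 $ k) (nhds 0)"
      unfolding isCont_def by (rule tendsto_at_iff_tendsto_nhds[where g = "\<lambda>s. w s $ k", THEN iffD1])
    moreover have "w 0 $ k \<noteq> 0"
      using vk by (simp add: w_def)
    ultimately have "eventually (\<lambda>s. w s $ k \<noteq> 0) (nhds 0)"
      by (rule tendsto_imp_eventually_ne)
    then show ?thesis
    proof eventually_elim
      case (elim s)
      let ?p = "chart_pt k (w s $ other_coord k / w s $ k) (w s $ 2 / w s $ k)"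
      have sc: "eval_poly r (w s) = w s $ k ^ d * eval_poly r ?p" if "is_form d r" for r d
        using scale_pt[OF k elim] eval_form_scale[OF that] by metis
      have "eval_poly q ?p = eval_poly F ?p * ev2 R (w s $ other_coord k / w s $ k) (w s $ 2 / w s $ k)"
        using arg_cong[OF R, of "\<lambda>C. ev2 C (w s $ other_coord k / w s $ k) (w s $ 2 / w s $ k)"]
        by (simp add: ev2_chart[OF k])
      then show ?case
        using elim unfolding S_def sc[OF q(1)] sc[OF form] by simp
    qed
  qed
  have "((\<lambda>s. eval_poly q (w s)) has_field_derivative 0) (at 0)"
    using DERIV_cong_ev[OF refl eq refl] deriv by (rule iffD1)
  then show ?thesis
    unfolding w_def by (rule dir_deriv_eqI)
qed

lemma grad_nz: "v \<in> affine_cone F \<Longrightarrow> grad F v \<noteq> 0"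
  using smooth by (force simp: smooth_form_def affine_cone_def grad_def vec_eq_iff)

lemma euler_cone: "v \<in> affine_cone F \<Longrightarrow> dir_deriv F v v = 0"
  by (simp add: dir_deriv_euler[OF form] affine_cone_def)

end

section \<open>Isomorphisms of smooth plane quartics are linear\<close>

definition eval_forms :: "('m \<Rightarrow> 'n::finite cpoly) \<Rightarrow> complex ^ 'n \<Rightarrow> complex ^ 'm" where
  "eval_forms h v = (\<chi> i. eval_poly (h i) v)"

definition dir_deriv_forms :: "('m \<Rightarrow> 'n::finite cpoly) \<Rightarrow> complex ^ 'n \<Rightarrow> complex ^ 'n \<Rightarrow> complex ^ 'm" where
  "dir_deriv_forms h v \<tau> = (\<chi> i. dir_deriv (h i) v \<tau>)"

lemma eval_forms_nth [simp]: "eval_forms h v $ i = eval_poly (h i) v"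
  by (simp add: eval_forms_def)

lemma dir_deriv_forms_nth [simp]: "dir_deriv_forms h v \<tau> $ i = dir_deriv (h i) v \<tau>"
  by (simp add: dir_deriv_forms_def)

lemma eval_forms_scale: "(\<And>i. is_form d (h i)) \<Longrightarrow> eval_forms h (c *s v) = c ^ d *s eval_forms h v"
  by (simp add: vec_eq_iff eval_form_scale)

lemma dir_deriv_forms_scale: "(\<And>i. is_form d (h i)) \<Longrightarrow> c *s dir_deriv_forms h (c *s v) \<tau> = c ^ d *s dir_deriv_forms h v \<tau>"
  by (simp add: vec_eq_iff dir_deriv_scale)

lemma dir_deriv_forms_euler: "(\<And>i. is_form d (h i)) \<Longrightarrow> dir_deriv_forms h v v = of_nat d *s eval_forms h v"
  by (simp add: vec_eq_iff dir_deriv_euler)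

lemma dir_deriv_forms_lin: "dir_deriv_forms h v (\<tau> + \<sigma>) = dir_deriv_forms h v \<tau> + dir_deriv_forms h v \<sigma>"
  "dir_deriv_forms h v (\<tau> - \<sigma>) = dir_deriv_forms h v \<tau> - dir_deriv_forms h v \<sigma>"
  "dir_deriv_forms h v (c *s \<tau>) = c *s dir_deriv_forms h v \<tau>"
  by (simp_all add: vec_eq_iff dir_deriv_lin_add dir_deriv_lin_diff dir_deriv_lin_scale)

lemma dir_deriv_subst_forms: "dir_deriv (subst_poly p h) v \<tau> = dir_deriv p (eval_forms h v) (dir_deriv_forms h v \<tau>)"
  by (simp add: dir_deriv_subst eval_forms_def dir_deriv_forms_def)

lemma eval_subst_forms: "eval_poly (subst_poly p h) v = eval_poly p (eval_forms h v)"
  by (simp add: eval_forms_def)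

locale quartic_map = plane_quartic F for F +
  fixes F' :: "3 cpoly" and f :: "(complex ^ 3) set \<Rightarrow> (complex ^ 3) set"
  assumes form': "is_form 4 F'" and smooth': "smooth_form F'"
    and reg: "regular_map_on (zero_locus F) f"
    and maps: "f ` zero_locus F \<subseteq> zero_locus F'"
begin

definition loc_rep :: "nat \<Rightarrow> (3 \<Rightarrow> 3 cpoly) \<Rightarrow> bool" where
  "loc_rep d h \<longleftrightarrow> (\<forall>i. is_form d (h i)) \<and>
     (\<forall>w\<in>affine_cone F. eval_forms h w \<noteq> 0 \<longrightarrow> f (proj_pt w) = proj_pt (eval_forms h w))"

lemma loc_repD: "loc_rep d h \<Longrightarrow> is_form d (h i)"
  "loc_rep d h \<Longrightarrow> w \<in> affine_cone F \<Longrightarrow> eval_forms h w \<noteq> 0 \<Longrightarrow> f (proj_pt w) = proj_pt (eval_forms h w)"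
  by (auto simp: loc_rep_def)

lemma proj_pt_cone: "v \<in> affine_cone F \<Longrightarrow> proj_pt v \<in> zero_locus F"
  by (simp add: zero_locus_eq_cone)

lemma ex_loc_rep:
  assumes "v \<in> affine_cone F"
  shows "\<exists>d h. loc_rep d h \<and> eval_forms h v \<noteq> 0"
proof -
  obtain d h where h: "\<And>i. is_form d (h i)" "(\<chi> i. eval_poly (h i) v) \<noteq> 0"
    "\<And>w. w \<noteq> 0 \<Longrightarrow> proj_pt w \<in> zero_locus F \<Longrightarrow> (\<chi> i. eval_poly (h i) w) \<noteq> 0 \<Longrightarrow>
       f (proj_pt w) = proj_pt (\<chi> i. eval_poly (h i) w)"
    using reg assms proj_pt_cone[OF assms]
    unfolding regular_map_on_def affine_cone_def mem_Collect_eq by metis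
  have "loc_rep d h"
    unfolding loc_rep_def eval_forms_def using h(1,3) proj_pt_cone by (auto simp: affine_cone_def)
  then show ?thesis
    using h(2) unfolding eval_forms_def by blast
qed

lemma eval_forms_in_curve:
  assumes "loc_rep d h" "w \<in> affine_cone F"
  shows "eval_poly F' (eval_forms h w) = 0"
proof (cases "eval_forms h w = 0")
  case True
  then show ?thesis
    using eval_form_0[OF form'] by simp
next
  case False
  then have "proj_pt (eval_forms h w) \<in> zero_locus F'"
    using loc_repD(2)[OF assms] maps proj_pt_cone[OF assms(2)] by (metis image_eqI subsetD)
  then show ?thesis
    using proj_pt_in_zero_locus[OF form' False] by simp
qed

lemma eval_forms_cone:
  "loc_rep d h \<Longrightarrow> w \<in> affine_cone F \<Longrightarrow> eval_forms h w \<noteq> 0 \<Longrightarrow> eval_forms h w \<in> affine_cone F'"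
  using eval_forms_in_curve by (simp add: affine_cone_def)

lemma grad'_nz: "v \<in> affine_cone F' \<Longrightarrow> grad F' v \<noteq> 0"
  using smooth' by (force simp: smooth_form_def affine_cone_def grad_def vec_eq_iff)

text \<open>F' composed with h vanishes on the cone of F, so the differential of h respects tangent
  planes.\<close>

lemma dir_deriv_forms_tangent:
  assumes "loc_rep d h" "v \<in> affine_cone F" "dir_deriv F v \<tau> = 0"
  shows "dir_deriv F' (eval_forms h v) (dir_deriv_forms h v \<tau>) = 0"
  unfolding dir_deriv_subst_forms[symmetric]
  by (rule vanishing_derivative[where e = "4 * d"])
    (use assms in \<open>auto intro: is_form_subst form' loc_repD simp: eval_subst_forms eval_forms_in_curve
      simp del: eval_subst_poly\<close>)

text \<open>
  \<open>J\<close> is the factor by which \<open>h\<close> multiplies the area forms of the tangent planes of the two cones,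
  where the area form \<open>\<omega>\<close> is given by \<open>v \<times> \<tau> = \<omega>(v, \<tau>) grad F v\<close>. So \<open>J *s h\<close> expresses the
  pullback of the holomorphic differentials of the target; it does not depend on \<open>h\<close>.
\<close>

definition jac :: "(3 \<Rightarrow> 3 cpoly) \<Rightarrow> complex ^ 3 \<Rightarrow> complex \<Rightarrow> bool" where
  "jac h v J \<longleftrightarrow> (\<forall>k. cross (eval_forms h v) (dir_deriv_forms h v (tangent F k v)) =
     (J * v $ k) *s grad F' (eval_forms h v))"

text \<open>For one k with nonzero v_k, h(v) and the image of the tangent vector both lie in the
  tangent plane of the target, so their cross product is a multiple of the gradient. The other
  tangent vectors differ from multiples of this one by multiples of v, and by Euler's formula the
  image of v is parallel to h(v) and drops out.\<close>

lemma ex_jac: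
  assumes h: "loc_rep d h" and v: "v \<in> affine_cone F" and nz: "eval_forms h v \<noteq> 0"
  shows "\<exists>J. jac h v J"
proof -
  let ?H = "eval_forms h v" and ?D = "\<lambda>k. dir_deriv_forms h v (tangent F k v)"
  have Hc: "?H \<in> affine_cone F'"
    by (rule eval_forms_cone[OF h v nz])
  obtain k where k: "v $ k \<noteq> 0"
    using cone_chart[OF v] by blast
  have "dir_deriv F' ?H ?H = 0"
    using Hc by (simp add: dir_deriv_euler[OF form'] affine_cone_def)
  moreover have "dir_deriv F' ?H (?D k) = 0"
    by (rule dir_deriv_forms_tangent[OF h v dir_deriv_tangent])
  ultimately obtain J where J: "cross ?H (?D k) = J *s grad F' ?H"
    using cross_parallel_normal grad'_nz[OF Hc] unfolding dir_deriv_grad by metis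
  have "cross ?H (?D l) = (J / v $ k * v $ l) *s grad F' ?H" for l
  proof -
    obtain c where c: "v $ k *s tangent F l v - v $ l *s tangent F k v = c *s v"
      using tangent_rel[OF euler_cone[OF v]] v by (auto simp: affine_cone_def)
    have "v $ k *s ?D l - v $ l *s ?D k = (c * of_nat d) *s ?H"
      using arg_cong[OF c, of "dir_deriv_forms h v"] dir_deriv_forms_euler[of d h v] loc_repD(1)[OF h]
      by (simp add: dir_deriv_forms_lin)
    from arg_cong[OF this, of "cross ?H"]
    have "v $ k *s cross ?H (?D l) = v $ l *s cross ?H (?D k)"
      by (simp add: cross_lin cross_scale)
    then show ?thesis
      using k unfolding J by (simp add: vec_eq_iff field_simps)
  qed
  then show ?thesis
    unfolding jac_def by blast
qed

text \<open>If h' = rho h at v, differentiating the minors \<open>h i * h' j - h j * h' i\<close>,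
  which vanish on the cone, gives h' x dh' = rho^2 h x dh without any derivative of rho. The
  gradient of the target quartic scales by rho^3, so J' = J / rho, which cancels the factor in
  h'.\<close>

lemma jac_indep:
  assumes h: "loc_rep d h" "eval_forms h v \<noteq> 0" "jac h v J"
    and h': "loc_rep d' h'" "eval_forms h' v \<noteq> 0" "jac h' v J'"
    and v: "v \<in> affine_cone F"
  shows "J *s eval_forms h v = J' *s eval_forms h' v"
proof -
  let ?H = "eval_forms h v" and ?H' = "eval_forms h' v"
  obtain k where k: "v $ k \<noteq> 0"
    using cone_chart[OF v] by blast
  let ?\<tau> = "tangent F k v"
  let ?D = "dir_deriv_forms h v ?\<tau>" and ?D' = "dir_deriv_forms h' v ?\<tau>"
  have par: "\<exists>c. eval_forms h' w = c *s eval_forms h w"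
    if w: "w \<in> affine_cone F" "eval_forms h w \<noteq> 0" "eval_forms h' w \<noteq> 0" for w
    using proj_pt_eq_imp[of "eval_forms h w" "eval_forms h' w"] w loc_repD(2)[OF h(1)] loc_repD(2)[OF h'(1)]
    by metis
  have minor: "dir_deriv (h i * h' j - h j * h' i) v ?\<tau> = 0" for i j
  proof (rule vanishing_derivative[OF _ _ v dir_deriv_tangent])
    show "is_form (d + d') (h i * h' j - h j * h' i)"
      using loc_repD(1)[OF h(1)] loc_repD(1)[OF h'(1)] by (intro is_form_diff is_form_mult)
    fix w assume w: "w \<in> affine_cone F"
    show "eval_poly (h i * h' j - h j * h' i) w = 0"
    proof (cases "eval_forms h w = 0 \<or> eval_forms h' w = 0")
      case True
      then show ?thesis
        by (auto simp: vec_eq_iff)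
    next
      case False
      then obtain c where "eval_forms h' w = c *s eval_forms h w"
        using par w by blast
      then show ?thesis
        by (simp add: vec_eq_iff)
    qed
  qed
  obtain \<rho> where \<rho>: "?H' = \<rho> *s ?H"
    using par[OF v h(2) h'(2)] by blast
  with h'(2) have \<rho>0: "\<rho> \<noteq> 0"
    by auto
  have "cross ?D ?H' + cross ?H ?D' = 0"
    using minor[of 2 3] minor[of 3 1] minor[of 1 2] by (simp add: vec3_eq_iff algebra_simps)
  then have "cross ?H ?D' = \<rho> *s cross ?H ?D"
    unfolding \<rho> cross_scale by (simp add: vec3_eq_iff algebra_simps)
  then have eq: "cross ?H' ?D' = \<rho>\<^sup>2 *s cross ?H ?D"
    unfolding \<rho> cross_scale by (simp add: power2_eq_square)
  have "\<rho> *s grad F' ?H' = \<rho> ^ 4 *s grad F' ?H"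
    unfolding \<rho> by (rule grad_scale[OF form'])
  then have "\<rho> *s grad F' ?H' = \<rho> *s (\<rho> ^ 3 *s grad F' ?H)"
    by (simp add: power3_eq_cube power4_eq_xxxx mult_ac)
  then have g: "grad F' ?H' = \<rho> ^ 3 *s grad F' ?H"
    using \<rho>0 by (simp only: vector_mul_lcancel) simp
  have "(J' * v $ k) *s grad F' ?H' = \<rho>\<^sup>2 *s ((J * v $ k) *s grad F' ?H)"
    using eq h(3) h'(3) unfolding jac_def by metis
  then have "(\<rho>\<^sup>2 * v $ k * (J' * \<rho>)) *s grad F' ?H = (\<rho>\<^sup>2 * v $ k * J) *s grad F' ?H"
    unfolding g by (simp add: mult_ac power3_eq_cube power2_eq_square)
  then have "J' * \<rho> = J"
    using \<rho>0 k grad'_nz[OF eval_forms_cone[OF h(1) v h(2)]] by (simp add: vector_mul_rcancel)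
  then show ?thesis
    unfolding \<rho> by simp
qed

text \<open>On the cone the choice is immaterial by \<open>jac_indep\<close>; nothing is claimed
  elsewhere.\<close>

definition Phi :: "complex ^ 3 \<Rightarrow> complex ^ 3" where
  "Phi v = (SOME u. \<exists>d h J. loc_rep d h \<and> eval_forms h v \<noteq> 0 \<and> jac h v J \<and> u = J *s eval_forms h v)"

lemma Phi_eq:
  assumes "loc_rep d h" "v \<in> affine_cone F" "eval_forms h v \<noteq> 0" "jac h v J"
  shows "Phi v = J *s eval_forms h v"
  unfolding Phi_def by (rule some_equality) (use assms jac_indep in blast)+

text \<open>Under v -> c v the vectors h, dh, the source tangent and the target gradient scale with
  exponents d, d - 1, 3 and 3 d. Hence J scales by c^(1 - d), and J h by c.\<close>

lemma Phi_scale: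
  assumes v: "v \<in> affine_cone F" and c: "c \<noteq> 0"
  shows "Phi (c *s v) = c *s Phi v"
proof -
  obtain d h where h: "loc_rep d h" "eval_forms h v \<noteq> 0"
    using ex_loc_rep[OF v] by blast
  obtain J where J: "jac h v J"
    using ex_jac[OF h(1) v h(2)] by blast
  note hf = loc_repD(1)[OF h(1)]
  have cv: "c *s v \<in> affine_cone F"
    using cone_scale[OF form v c] .
  have ev: "eval_forms h (c *s v) = c ^ d *s eval_forms h v"
    by (rule eval_forms_scale[OF hf])
  have nz: "eval_forms h (c *s v) \<noteq> 0"
    using h(2) c by (simp add: ev)
  have "jac h (c *s v) (J * c / c ^ d)"
    unfolding jac_def
  proof
    fix k
    let ?H = "eval_forms h v" and ?D = "dir_deriv_forms h v (tangent F k v)"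
    have t: "tangent F k (c *s v) = c ^ 3 *s tangent F k v"
      using tangent_scale[OF form, of c k v] c by (simp add: vec_eq_iff power3_eq_cube power4_eq_xxxx)
    have D: "dir_deriv_forms h (c *s v) \<tau> = (c ^ d / c) *s dir_deriv_forms h v \<tau>" for \<tau>
      using dir_deriv_forms_scale[where h = h and c = c and v = v and \<tau> = \<tau>, OF hf] c by (simp add: vec_eq_iff field_simps)
    have g: "grad F' (c ^ d *s ?H) = (c ^ d) ^ 3 *s grad F' ?H"
      using grad_scale[OF form', of "c ^ d" ?H] c
      by (simp add: vec_eq_iff power3_eq_cube power4_eq_xxxx)
    have "cross (eval_forms h (c *s v)) (dir_deriv_forms h (c *s v) (tangent F k (c *s v)))
       = (c ^ d * (c ^ d / c * c ^ 3)) *s cross ?H ?D"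
      by (simp add: ev t D dir_deriv_forms_lin cross_scale mult_ac)
    also have "\<dots> = (c ^ d * (c ^ d / c * c ^ 3) * (J * v $ k)) *s grad F' ?H"
      using J by (simp add: jac_def)
    also have "\<dots> = (J * c / c ^ d * (c *s v) $ k) *s grad F' (eval_forms h (c *s v))"
      unfolding ev g using c by (simp add: power3_eq_cube mult_ac)
    finally show "cross (eval_forms h (c *s v)) (dir_deriv_forms h (c *s v) (tangent F k (c *s v))) =
      (J * c / c ^ d * (c *s v) $ k) *s grad F' (eval_forms h (c *s v))" .
  qed
  from Phi_eq[OF h(1) cv nz this] Phi_eq[OF h(1) v h(2) J] show ?thesis
    using c by (simp add: ev)
qed

lemma Phi_locally_regular:
  assumes k: "k = 1 \<or> k = 3" and p0: "ev2 (chart k F) a0 y0 = 0"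
  shows "\<exists>p q. ev2 q a0 y0 \<noteq> 0 \<and>
    (\<forall>a y. ev2 (chart k F) a y = 0 \<longrightarrow> ev2 q a y * Phi (chart_pt k a y) $ i = ev2 p a y)"
proof -
  have v0: "chart_pt k a0 y0 \<in> affine_cone F"
    using chart_pt_in_cone[OF k] p0 by simp
  obtain d h where h: "loc_rep d h" "eval_forms h (chart_pt k a0 y0) \<noteq> 0"
    using ex_loc_rep[OF v0] by blast
  let ?H = "\<lambda>a y. eval_forms h (chart_pt k a y)"
  obtain l where l: "?H a0 y0 $ l \<noteq> 0"
    using h(2) by (metis vec_eq_iff zero_index)
  obtain j where j: "grad F' (?H a0 y0) $ j \<noteq> 0"
    using grad'_nz[OF eval_forms_cone[OF h(1) v0 h(2)]] by (metis vec_eq_iff zero_index)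
  \<comment> \<open>This is the j-th coordinate of the equation defining J, solved for J h_i; the
    k-th coordinate of the chart point is 1. The additional factor h_l is nonzero at the base point
    and makes both sides vanish wherever h does.\<close>
  define q where "q a y = ?H a y $ l * grad F' (?H a y) $ j" for a y
  define p where "p a y = ?H a y $ l * (?H a y $ i *
     cross (?H a y) (dir_deriv_forms h (chart_pt k a y) (tangent F k (chart_pt k a y))) $ j)" for a y
  have H2: "is_poly2 (\<lambda>a y. ?H a y $ i)" for i
    by (simp add: is_poly2_eval_pt)
  have "is_poly2 q"
    unfolding q_def grad_def by (simp add: is_poly2_mult is_poly2_eval_pt is_poly2_eval_poly H2[simplified])
  then obtain Q where Q: "\<And>a y. q a y = ev2 Q a y"
    by (auto simp: is_poly2_def)
  have crp: "is_poly2 (\<lambda>a y. cross (A a y) (B a y) $ j)"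
    if "\<And>i. is_poly2 (\<lambda>a y. A a y $ i)" "\<And>i. is_poly2 (\<lambda>a y. B a y $ i)" for A B j
    using exhaust_3[of j] by (elim disjE) (simp_all add: that is_poly2_intros)
  have T2: "is_poly2 (\<lambda>a y. tangent F k (chart_pt k a y) $ i)" for i
    unfolding tangent_def by (rule crp) (simp_all add: grad_def is_poly2_eval_pt is_poly2_const)
  have D2: "is_poly2 (\<lambda>a y. dir_deriv_forms h (chart_pt k a y) (tangent F k (chart_pt k a y)) $ i)" for i
    by (simp add: dir_deriv_def is_poly2_sum is_poly2_mult is_poly2_eval_pt T2)
  have "is_poly2 p"
    unfolding p_def by (intro is_poly2_mult H2 crp D2)
  then obtain P where P: "\<And>a y. p a y = ev2 P a y"
    by (auto simp: is_poly2_def)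
  have "q a y * Phi (chart_pt k a y) $ i = p a y" if V: "ev2 (chart k F) a y = 0" for a y
  proof (cases "?H a y = 0")
    case True
    then show ?thesis
      by (simp add: q_def p_def)
  next
    case False
    have v: "chart_pt k a y \<in> affine_cone F"
      using chart_pt_in_cone[OF k] V by simp
    obtain J where J: "jac h (chart_pt k a y) J"
      using ex_jac[OF h(1) v False] by blast
    show ?thesis
      using J Phi_eq[OF h(1) v False J] by (simp add: q_def p_def jac_def)
  qed
  then show ?thesis
    using l j Q P q_def by (metis mult_eq_0_iff)
qed

lemma Phi_chart:
  assumes "k = 1 \<or> k = 3"
  shows "\<exists>P. degree P < 4 \<and> (\<forall>a y. ev2 (chart k F) a y = 0 \<longrightarrow> Phi (chart_pt k a y) $ i = ev2 P a y)"
  using affine_curve.locally_regular_imp_polynomial[OF affine_chart[OF assms], of "\<lambda>a y. Phi (chart_pt k a y) $ i"]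
    Phi_locally_regular[OF assms] by (simp add: degree_chart)

end

section \<open>Comparison of the two charts\<close>

lemma poly_eq_nonzero:
  fixes p q :: "complex poly"
  assumes "\<And>x. x \<noteq> 0 \<Longrightarrow> poly p x = poly q x"
  shows "p = q"
proof -
  have "poly ([:0, 1:] * (p - q)) x = 0" for x
    using assms by (cases "x = 0") auto
  then have "[:0, 1:] * (p - q) = 0"
    by (intro poly_all_0_iff_0[THEN iffD1] allI)
  then show ?thesis
    by simp
qed

text \<open>The change of charts \<open>(x, y) \<mapsto> (1 / x, y / x)\<close>, with denominators cleared.\<close>

lemma ex_chart_change:
  fixes A :: "complex poly poly"
  shows "\<exists>N B. degree B \<le> degree A \<and>
    (\<forall>j x. x \<noteq> 0 \<longrightarrow> x ^ j * poly (coeff B j) x = x ^ N * poly (coeff A j) (1 / x))"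
proof -
  define K where "K = (\<Sum>j\<le>degree A. degree (coeff A j))"
  \<comment> \<open>Large enough that the subtractions in the exponent of \<open>b j\<close> are not
    truncated.\<close>
  define N where "N = degree A + K"
  define b where "b j = monom 1 (N - j - degree (coeff A j)) * reflect_poly (coeff A j)" for j
  define B where "B = (\<Sum>j\<le>degree A. monom (b j) j)"
  have coeff_B: "coeff B j = (if j \<le> degree A then b j else 0)" for j
    by (simp add: B_def coeff_sum)
  have "x ^ j * poly (coeff B j) x = x ^ N * poly (coeff A j) (1 / x)" if x: "x \<noteq> 0" for j x
  proof (cases "j \<le> degree A")
    case True
    then have "degree (coeff A j) \<le> K"
      unfolding K_def by (intro member_le_sum) auto
    with True have N: "N = j + (N - j - degree (coeff A j)) + degree (coeff A j)"
      by (simp add: N_def)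
    have "x ^ N = x ^ j * x ^ (N - j - degree (coeff A j)) * x ^ degree (coeff A j)"
      by (subst N) (simp only: power_add)
    then show ?thesis
      using True x by (simp add: coeff_B b_def poly_monom poly_reflect_poly_nz inverse_eq_divide)
  next
    case False
    then show ?thesis
      by (simp add: coeff_B coeff_eq_0)
  qed
  moreover have "degree B \<le> degree A"
    unfolding B_def by (intro degree_sum_le) (auto intro: order.trans[OF degree_monom_le])
  ultimately show ?thesis
    by blast
qed

lemma chart_change_eval:
  assumes "degree B \<le> degree A"
    and "\<And>j. x ^ j * poly (coeff B j) x = x ^ N * poly (coeff A j) (1 / x)" and "x \<noteq> 0"
  shows "ev2 B x y = x ^ N * ev2 A (1 / x) (y / x)"
proof -
  have "ev2 B x y = (\<Sum>j\<le>degree A. poly (coeff B j) x * y ^ j)"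
    by (rule ev2_coeff_sum[OF assms(1)])
  also have "\<dots> = (\<Sum>j\<le>degree A. x ^ N * (poly (coeff A j) (1 / x) * (y / x) ^ j))"
    by (rule sum.cong) (use assms(2,3) in \<open>auto simp: power_divide field_simps\<close>)
  finally show ?thesis
    by (simp add: ev2_coeff_sum[OF order.refl, of A] sum_distrib_left)
qed

lemma ex_chart_change_eval:
  "\<exists>N B. \<forall>x y. x \<noteq> 0 \<longrightarrow> ev2 B x y = x ^ N * ev2 A (1 / x) (y / x)"
  using ex_chart_change[of A] chart_change_eval[of _ A] by metis

text \<open>The right-hand side contains only exponents at most 1, and the top exponent on the left
  is j + degree p.\<close>

lemma chart_change_linear:
  fixes p r :: "complex poly"
  assumes "\<And>x. x \<noteq> 0 \<Longrightarrow> x ^ j * poly p x = x * poly r (1 / x)"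
  shows "p = 0 \<or> j + degree p \<le> 1"
proof (cases "p = 0")
  case False
  have "monom 1 (degree r + j) * p = [:0, 1:] * reflect_poly r"
  proof (rule poly_eq_nonzero)
    fix x :: complex assume x: "x \<noteq> 0"
    have "poly (monom 1 (degree r + j) * p) x = x ^ degree r * (x ^ j * poly p x)"
      by (simp add: poly_monom power_add)
    also have "\<dots> = poly ([:0, 1:] * reflect_poly r) x"
      unfolding assms[OF x] using x by (simp add: poly_reflect_poly_nz inverse_eq_divide)
    finally show "poly (monom 1 (degree r + j) * p) x = poly ([:0, 1:] * reflect_poly r) x" .
  qed
  from arg_cong[OF this, of degree]
  have "degree r + j + degree p = degree ([:0, 1:] * reflect_poly r)"
    using False by (simp add: degree_mult_eq degree_monom_eq)
  also have "\<dots> \<le> 1 + degree r"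
    using degree_mult_le[of "[:0, 1:]" "reflect_poly r"] degree_reflect_poly_le[of r] by simp
  finally show ?thesis
    by simp
qed simp

context quartic_map
begin

text \<open>Homogeneity gives P(x, y) = x R(1/x, y/x) on the curve. Both sides have degree below 4
  in y, so the identity holds for polynomials. Comparing coefficients of y^j leaves only total
  degree at most 1 for P and determines R from P.\<close>

lemma Phi_linear_nth:
  "\<exists>a b c. \<forall>v\<in>affine_cone F. Phi v $ i = a * v $ 1 + b * v $ 2 + c * v $ 3"
proof -
  obtain P where P: "degree P < 4"
    "\<And>x y. ev2 (chart 3 F) x y = 0 \<Longrightarrow> Phi (chart_pt 3 x y) $ i = ev2 P x y"
    using Phi_chart[of 3 i] by auto
  obtain R where R: "degree R < 4"
    "\<And>z y. ev2 (chart 1 F) z y = 0 \<Longrightarrow> Phi (chart_pt 1 z y) $ i = ev2 R z y"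
    using Phi_chart[of 1 i] by auto
  obtain N B where B: "degree B \<le> degree R"
    "\<And>j x. x \<noteq> 0 \<Longrightarrow> x ^ j * poly (coeff B j) x = x ^ N * poly (coeff R j) (1 / x)"
    using ex_chart_change by blast
  have evB: "ev2 B x y = x ^ N * ev2 R (1 / x) (y / x)" if "x \<noteq> 0" for x y
    using chart_change_eval B that by blast
  define D where "D = smult (monom 1 N) P - smult [:0, 1:] B"
  \<comment> \<open>The factor x makes the claim trivial at x = 0, where the change of charts is
    undefined; it is cancelled afterwards.\<close>
  have vanish: "ev2 (smult [:0, 1:] D) x y = 0" if V: "ev2 (chart 3 F) x y = 0" for x y
  proof (cases "x = 0")
    case False
    have v: "chart_pt 3 x y \<in> affine_cone F"
      using V chart_pt_in_cone[of 3] by simp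
    have eq: "chart_pt 3 x y = x *s chart_pt 1 (1 / x) (y / x)"
      using False by (simp add: vec3_eq_iff)
    have "chart_pt 1 (1 / x) (y / x) = (1 / x) *s chart_pt 3 x y"
      using False by (simp add: vec3_eq_iff)
    then have v1: "chart_pt 1 (1 / x) (y / x) \<in> affine_cone F"
      using cone_scale[OF form v, of "1 / x"] False by simp
    then have "ev2 (chart 1 F) (1 / x) (y / x) = 0"
      using chart_pt_in_cone[of 1] by simp
    then have "ev2 P x y = x * ev2 R (1 / x) (y / x)"
      using P(2)[OF V] R(2) Phi_scale[OF v1 False] eq by simp
    then show ?thesis
      by (simp add: D_def evB[OF False] poly_monom)
  qed (simp add: D_def)
  have "degree D < 4"
    unfolding D_def using P(1) R(1) B(1)
    by (intro le_less_trans[OF degree_diff_le_max]) (simp add: degree_smult_eq del: smult_pCons)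
  then have "degree (smult [:0, 1:] D) < degree (chart 3 F)"
    by (simp add: degree_chart degree_smult_eq)
  then have "smult [:0, 1:] D = 0"
    using affine_curve.low_degree_eq_0[OF affine_chart] vanish by blast
  then have "D = 0"
    by (simp only: smult_eq_0_iff) simp
  have key: "x ^ j * poly (coeff P j) x = x * poly (coeff R j) (1 / x)" if x: "x \<noteq> 0" for j x
  proof -
    have "monom 1 N * coeff P j = [:0, 1:] * coeff B j"
      using arg_cong[OF \<open>D = 0\<close>, of "\<lambda>D. coeff D j"] by (simp add: D_def)
    from arg_cong[OF this, of "\<lambda>p. poly p x"]
    have "x ^ N * poly (coeff P j) x = x * poly (coeff B j) x"
      by (simp add: poly_monom)
    then have "x ^ N * (x ^ j * poly (coeff P j) x) = x * (x ^ j * poly (coeff B j) x)"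
      by (simp add: mult_ac)
    then show ?thesis
      unfolding B(2)[OF x] using x by (simp add: mult_ac)
  qed
  have lin: "coeff P j = 0 \<or> j + degree (coeff P j) \<le> 1" for j
    using chart_change_linear key by blast
  obtain c a where ca: "coeff P 0 = [:c, a:]"
  proof -
    have "degree (coeff P 0) \<le> 1"
      using lin[of 0] by auto
    then have "coeff P 0 = [:coeff (coeff P 0) 0, coeff (coeff P 0) 1:]"
      by (intro poly_eqI) (auto simp: coeff_pCons coeff_eq_0 split: nat.splits)
    then show ?thesis
      using that by blast
  qed
  obtain b where b: "coeff P 1 = [:b:]"
    using lin[of 1] by (metis add_diff_cancel_left' degree_0 degree_eq_zeroE diff_is_0_eq')
  have Pj: "coeff P j = 0" if "j \<ge> 2" for j
    using lin[of j] that by auto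
  have "P = [:[:c, a:], [:b:]:]"
  proof (rule poly_eqI)
    fix j
    show "coeff P j = coeff [:[:c, a:], [:b:]:] j"
      using ca b Pj[of j] by (cases j; cases "j - 1") (auto simp: coeff_pCons split: nat.splits)
  qed
  then have evP: "ev2 P x y = a * x + b * y + c" for x y
    by simp
  have Rj: "poly (coeff R j) z = z / z ^ j * poly (coeff P j) (1 / z)" if "z \<noteq> 0" for j z
    using key[of "1 / z" j] that by (simp add: field_simps)
  have "R = [:[:a, c:], [:b:]:]"
  proof (rule poly_eqI)
    fix j :: nat
    consider "j = 0" | "j = 1" | "j \<ge> 2"
      by linarith
    then show "coeff R j = coeff [:[:a, c:], [:b:]:] j"
    proof cases
      case 1
      have "coeff R 0 = [:a, c:]"
      proof (rule poly_eq_nonzero)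
        fix x :: complex assume x: "x \<noteq> 0"
        have "poly (coeff R 0) x = x * (c + 1 / x * a)"
          using Rj[OF x, of 0] ca by simp
        then show "poly (coeff R 0) x = poly [:a, c:] x"
          using x by (simp add: distrib_left)
      qed
      then show ?thesis
        using 1 by simp
    next
      case 2
      have "coeff R 1 = [:b:]"
      proof (rule poly_eq_nonzero)
        fix x :: complex assume x: "x \<noteq> 0"
        then show "poly (coeff R 1) x = poly [:b:] x"
          using Rj[OF x, of 1] b by simp
      qed
      then show ?thesis
        using 2 by simp
    next
      case 3
      have "coeff R j = 0"
      proof (rule poly_eq_nonzero)
        fix x :: complex assume x: "x \<noteq> 0"
        then show "poly (coeff R j) x = poly 0 x"
          using Rj[OF x, of j] Pj[OF 3] by simp
      qed
      then show ?thesis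
        using 3 by (auto simp: coeff_pCons split: nat.splits)
    qed
  qed
  then have evR: "ev2 R z y = a + b * y + c * z" for z y
    by simp
  have "Phi v $ i = a * v $ 1 + b * v $ 2 + c * v $ 3" if v: "v \<in> affine_cone F" for v
  proof -
    obtain k where k: "k = 1 \<or> k = 3" and vk: "v $ k \<noteq> 0"
      using cone_chart[OF v] by blast
    let ?p = "chart_pt k (v $ other_coord k / v $ k) (v $ 2 / v $ k)"
    have sc: "v = v $ k *s ?p"
      by (rule scale_pt[OF k vk])
    have "(1 / v $ k) *s (v $ k *s ?p) = ?p"
      using vk by simp
    then have "?p = (1 / v $ k) *s v"
      by (simp only: sc[symmetric])
    then have p: "?p \<in> affine_cone F"
      using cone_scale[OF form v, of "1 / v $ k"] vk by simp
    then have ev: "ev2 (chart k F) (v $ other_coord k / v $ k) (v $ 2 / v $ k) = 0"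
      using chart_pt_in_cone[OF k] by simp
    have Phi_v: "Phi v $ i = v $ k * Phi ?p $ i"
      using Phi_scale[OF p vk] sc by (metis vector_smult_component)
    from k show ?thesis
    proof
      assume "k = 1"
      then have "Phi ?p $ i = a + b * (v $ 2 / v $ k) + c * (v $ 3 / v $ k)"
        using R(2) ev by (simp add: evR other_coord_def)
      then show ?thesis
        unfolding Phi_v using vk \<open>k = 1\<close> by (simp add: distrib_left mult_ac)
    next
      assume "k = 3"
      then have "Phi ?p $ i = a * (v $ 1 / v $ k) + b * (v $ 2 / v $ k) + c"
        using P(2) ev by (simp add: evP other_coord_def)
      then show ?thesis
        unfolding Phi_v using vk \<open>k = 3\<close> by (simp add: distrib_left mult_ac)
    qed
  qed
  then show ?thesis
    by blast
qed

lemma Phi_linear: "\<exists>M :: complex ^ 3 ^ 3. \<forall>v\<in>affine_cone F. Phi v = M *v v"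
proof -
  obtain a b c where abc: "\<And>i v. v \<in> affine_cone F \<Longrightarrow> Phi v $ i = a i * v $ 1 + b i * v $ 2 + c i * v $ 3"
    using Phi_linear_nth by metis
  have "Phi v = (\<chi> i j. if j = 1 then a i else if j = 2 then b i else c i) *v v" if "v \<in> affine_cone F" for v
    using abc[OF that] by (simp add: vec_eq_iff matrix_vector_mult_def sum_3)
  then show ?thesis
    by blast
qed

end

section \<open>Isomorphisms and linear equivalence\<close>

locale quartic_iso = quartic_map F F' f + inverse: quartic_map F' F g for F F' f g +
  assumes gf: "\<And>P. P \<in> zero_locus F \<Longrightarrow> g (f P) = P"
    and fg: "\<And>Q. Q \<in> zero_locus F' \<Longrightarrow> f (g Q) = Q"
begin

text \<open>If J = 0, dh sends the tangent vector to a multiple of h(v). Composing with local forms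
  k of the inverse map, whose composite with h is proportional to the identity, would make the
  tangent vector parallel to v. But v x tau is a nonzero multiple of the gradient.\<close>

lemma jac_nz:
  assumes h: "loc_rep d h" and v: "v \<in> affine_cone F" and nz: "eval_forms h v \<noteq> 0" and J: "jac h v J"
  shows "J \<noteq> 0"
proof
  assume "J = 0"
  obtain m where m: "v $ m \<noteq> 0"
    using cone_chart[OF v] by blast
  let ?\<tau> = "tangent F m v" and ?H = "eval_forms h v"
  have Hc: "?H \<in> affine_cone F'"
    by (rule eval_forms_cone[OF h v nz])
  obtain e k where k: "inverse.loc_rep e k" "eval_forms k ?H \<noteq> 0"
    using inverse.ex_loc_rep[OF Hc] by blast
  obtain l where l: "eval_poly (h l) v \<noteq> 0"
    using nz by (metis eval_forms_nth vec_eq_iff zero_index)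
  have par: "\<exists>c. eval_forms k (eval_forms h w) = c *s w"
    if w: "w \<in> affine_cone F" "eval_forms h w \<noteq> 0" "eval_forms k (eval_forms h w) \<noteq> 0" for w
  proof -
    have Hw: "eval_forms h w \<in> affine_cone F'"
      by (rule eval_forms_cone[OF h w(1,2)])
    have "proj_pt (eval_forms k (eval_forms h w)) = g (f (proj_pt w))"
      using loc_repD(2)[OF h w(1,2)] inverse.loc_repD(2)[OF k(1) Hw w(3)] by simp
    also have "\<dots> = proj_pt w"
      by (rule gf[OF proj_pt_cone[OF w(1)]])
    finally show ?thesis
      using proj_pt_eq_imp[of w] w(3) by metis
  qed
  obtain \<mu> where lam: "eval_forms k ?H = \<mu> *s v"
    using par[OF v nz k(2)] by blast
  with k(2) have "\<mu> \<noteq> 0"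
    by auto
  define D where "D = dir_deriv_forms k ?H (dir_deriv_forms h v ?\<tau>)"
  have minor: "?\<tau> $ i * \<mu> * v $ j + v $ i * D $ j = ?\<tau> $ j * \<mu> * v $ i + v $ j * D $ i" for i j
  proof -
    \<comment> \<open>The minors express that k(h(w)) is parallel to w. The factor
      \<open>h l\<close> covers the points where h vanishes, at which constant forms k need not
      vanish.\<close>
    define q where "q = h l * (var_poly i * subst_poly (k j) h - var_poly j * subst_poly (k i) h)"
    have "dir_deriv q v ?\<tau> = 0"
    proof (rule vanishing_derivative[OF _ _ v dir_deriv_tangent])
      show "is_form (d + (1 + e * d)) q"
        unfolding q_def
        by (intro is_form_mult is_form_diff is_form_var is_form_subst loc_repD(1)[OF h] inverse.loc_repD(1)[OF k(1)])
      fix w assume w: "w \<in> affine_cone F"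
      consider "eval_forms h w = 0" | "eval_forms k (eval_forms h w) = 0"
        | c where "eval_forms k (eval_forms h w) = c *s w"
        using par[OF w] by blast
      then show "eval_poly q w = 0"
      proof cases
        case 1
        then have "eval_poly (h l) w = 0"
          by (metis eval_forms_nth zero_index)
        then show ?thesis
          by (simp add: q_def)
      next
        case 2
        then have "eval_poly (k i) (eval_forms h w) = 0" for i
          by (metis eval_forms_nth zero_index)
        then show ?thesis
          by (simp add: q_def eval_subst_forms del: eval_subst_poly)
      next
        case 3
        then have "eval_poly (k i) (eval_forms h w) = c * w $ i" for i
          by (metis eval_forms_nth vector_smult_component)
        then show ?thesis
          by (simp add: q_def eval_subst_forms del: eval_subst_poly)
      qed
    qed
    moreover have "eval_poly (k i) ?H = \<mu> * v $ i" for i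
      using lam by (metis eval_forms_nth vector_smult_component)
    moreover have "dir_deriv (k i) ?H (dir_deriv_forms h v ?\<tau>) = D $ i" for i
      by (simp add: D_def)
    ultimately have "eval_poly (h l) v * (?\<tau> $ i * \<mu> * v $ j + v $ i * D $ j) =
        eval_poly (h l) v * (?\<tau> $ j * \<mu> * v $ i + v $ j * D $ i)"
      by (simp add: q_def eval_subst_forms dir_deriv_subst_forms algebra_simps del: eval_subst_poly)
    then show ?thesis
      using l by simp
  qed
  have "cross ?H (dir_deriv_forms h v ?\<tau>) = 0"
    using J \<open>J = 0\<close> unfolding jac_def by simp
  then obtain c where "dir_deriv_forms h v ?\<tau> = c *s ?H"
    using cross_eq_0_imp nz by blast
  then have "D = (c * of_nat e * \<mu>) *s v"
    by (simp add: D_def dir_deriv_forms_lin dir_deriv_forms_euler[of e k, OF inverse.loc_repD(1)[OF k(1)]] lam)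
  then have "cross ?\<tau> v = 0"
    using minor[of 1 2] minor[of 2 3] minor[of 3 1] \<open>\<mu> \<noteq> 0\<close> by (simp add: vec3_eq_iff mult_ac)
  then have "cross v ?\<tau> = 0"
    by (subst cross_anti) simp
  then have "v $ m *s grad F v = 0"
    using cross_tangent[OF euler_cone[OF v]] by simp
  then show False
    using m grad_nz[OF v] by simp
qed

lemma linear_on_cone:
  "\<exists>M :: complex ^ 3 ^ 3. \<forall>v\<in>affine_cone F. eval_poly F' (M *v v) = 0 \<and> f (proj_pt v) = proj_pt (M *v v)"
proof -
  obtain M where M: "\<And>v. v \<in> affine_cone F \<Longrightarrow> Phi v = M *v v"
    using Phi_linear by blast
  have "eval_poly F' (M *v v) = 0 \<and> f (proj_pt v) = proj_pt (M *v v)" if v: "v \<in> affine_cone F" for v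
  proof -
    obtain d h where h: "loc_rep d h" "eval_forms h v \<noteq> 0"
      using ex_loc_rep[OF v] by blast
    obtain J where J: "jac h v J"
      using ex_jac[OF h(1) v h(2)] by blast
    have "M *v v = J *s eval_forms h v"
      using M[OF v] Phi_eq[OF h(1) v h(2) J] by simp
    then show ?thesis
      using jac_nz[OF h(1) v h(2) J] loc_repD(2)[OF h(1) v h(2)] eval_forms_in_curve[OF h(1) v]
      by (simp add: proj_pt_scale eval_form_scale[OF form'])
  qed
  then show ?thesis
    by blast
qed

lemma linear_equivalence:
  assumes span: "vec.span (affine_cone F') = UNIV"
  shows "\<exists>(M :: complex ^ 3 ^ 3) c. c \<noteq> 0 \<and> (\<forall>v. eval_poly F' (M *v v) = c * eval_poly F v)"
proof -
  obtain M :: "complex ^ 3 ^ 3" where M: "\<And>v. v \<in> affine_cone F \<Longrightarrow> eval_poly F' (M *v v) = 0"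
    "\<And>v. v \<in> affine_cone F \<Longrightarrow> f (proj_pt v) = proj_pt (M *v v)"
    using linear_on_cone by blast
  define l :: "3 \<Rightarrow> 3 cpoly" where "l i = (\<Sum>j\<in>UNIV. const_poly (M $ i $ j) * var_poly j)" for i
  have l: "is_form 1 (l i)" for i
    unfolding l_def by (intro is_form_sum is_form_const_mult is_form_var)
  have evl: "eval_forms l v = M *v v" for v
    by (simp add: vec_eq_iff l_def matrix_vector_mult_def)
  \<comment> \<open>Chosen to cancel the y^4 term of F' o M - c F. In each chart this difference is
    divisible by the equation of F but has smaller degree, so it is zero.\<close>
  define c where "c = eval_poly F' (M *v axis 2 1) / eval_poly F (axis 2 1)"
  define q where "q = subst_poly F' l - const_poly c * F"
  have evq: "eval_poly q v = eval_poly F' (M *v v) - c * eval_poly F v" for v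
    by (simp add: q_def eval_subst_forms evl del: eval_subst_poly)
  have q: "is_form 4 q"
    unfolding q_def using is_form_subst[OF form' l] form by (auto intro: is_form_diff is_form_const_mult)
  have q_apex: "eval_poly q (axis 2 1) = 0"
    using apex by (simp add: evq c_def)
  have chart_q: "chart k q = 0" if k: "k = 1 \<or> k = 3" for k
  proof (rule dvd_low_degree_imp_0)
    show "chart k F dvd chart k q"
      by (rule dvd_chart[OF k]) (simp add: evq M(1), simp add: affine_cone_def)
    have "coeff (chart k q) 4 = 0"
      by (simp add: coeff_chart[OF q] q_apex)
    then have "degree (chart k q) < 4 \<or> chart k q = 0"
      using degree_chart_le[OF q, of k] by (metis le_neq_implies_less leading_coeff_0_iff)
    then show "degree (chart k q) < degree (chart k F)"
      by (auto simp: degree_chart)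
  qed
  have q0: "eval_poly q v = 0" for v
  proof (cases "\<exists>k. (k = 1 \<or> k = 3) \<and> v $ k \<noteq> 0")
    case True
    then obtain k where k: "k = 1 \<or> k = 3" "v $ k \<noteq> 0"
      by blast
    have "eval_poly q (chart_pt k a y) = 0" for a y
      using ev2_chart[OF k(1), of q a y] by (simp add: chart_q[OF k(1)])
    then show ?thesis
      using scale_pt[OF k] eval_form_scale[OF q] by (metis mult_zero_right)
  next
    case False
    then have "v $ 1 = 0" "v $ 3 = 0"
      by blast+
    then have "v = v $ 2 *s axis 2 1"
      by (simp add: vec3_eq_iff axis3)
    then show ?thesis
      using q_apex eval_form_scale[OF q] by (metis mult_zero_right)
  qed
  \<comment> \<open>Surjectivity on points and the spanning assumption make M surjective. As F' does
    not vanish at (0:1:0), c cannot be 0.\<close>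
  have "affine_cone F' \<subseteq> range ((*v) M)"
  proof
    fix u assume u: "u \<in> affine_cone F'"
    have "g (proj_pt u) \<in> zero_locus F"
      using inverse.maps inverse.proj_pt_cone[OF u] by blast
    then obtain v where v: "v \<in> affine_cone F" "g (proj_pt u) = proj_pt v"
      by (auto simp: zero_locus_eq_cone)
    have "proj_pt (M *v v) = proj_pt u"
      using M(2)[OF v(1)] v(2) fg[OF inverse.proj_pt_cone[OF u]] by simp
    then obtain b where "u = b *s (M *v v)"
      using proj_pt_eq_imp u by (metis (mono_tags, lifting) affine_cone_def mem_Collect_eq)
    then show "u \<in> range ((*v) M)"
      by (metis rangeI vector_scalar_commute)
  qed
  moreover have "vec.subspace (range ((*v) M))"
    unfolding vec.subspace_def
    by (auto simp flip: matrix_vector_right_distrib vector_scalar_commute intro: range_eqI[of _ _ 0])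
  ultimately have "vec.span (affine_cone F') \<subseteq> range ((*v) M)"
    by (rule vec.span_minimal)
  then obtain w where "axis 2 1 = M *v w"
    using span by blast
  then have "c * eval_poly F w \<noteq> 0"
    using q0[of w] inverse.apex by (simp add: evq)
  then show ?thesis
    using q0 by (intro exI[of _ M] exI[of _ c]) (auto simp: evq)
qed

end

lemma isomorphic_imp_linear_equivalence:
  assumes "plane_quartic F" "plane_quartic F'" "vec.span (affine_cone F') = UNIV"
    and "proj_isomorphic (zero_locus F) (zero_locus F')"
  shows "\<exists>(M :: complex ^ 3 ^ 3) c. c \<noteq> 0 \<and> (\<forall>v. eval_poly F' (M *v v) = c * eval_poly F v)"
proof -
  obtain f g where fg: "regular_map_on (zero_locus F) f" "f ` zero_locus F \<subseteq> zero_locus F'"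
    "\<forall>P\<in>zero_locus F. g (f P) = P" "regular_map_on (zero_locus F') g"
    "g ` zero_locus F' \<subseteq> zero_locus F" "\<forall>Q\<in>zero_locus F'. f (g Q) = Q"
    using assms(4) by (auto simp: proj_isomorphic_def)
  interpret X: plane_quartic F by fact
  interpret Y: plane_quartic F' by fact
  interpret quartic_iso F F' f g
    by unfold_locales (use fg X.form X.smooth Y.form Y.smooth in auto)
  show ?thesis
    by (rule linear_equivalence) fact
qed

section \<open>Invariants of plane quartics\<close>

type_synonym tensor = "3 \<Rightarrow> 3 \<Rightarrow> 3 \<Rightarrow> 3 \<Rightarrow> complex"

definition next_index :: "3 \<Rightarrow> 3" where "next_index i = (if i = 1 then 2 else if i = 2 then 3 else 1)"
definition prev_index :: "3 \<Rightarrow> 3" where "prev_index i = (if i = 1 then 3 else if i = 2 then 1 else 2)"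

lemma next_prev_index_simps [simp]: "next_index 1 = 2" "next_index 2 = 3" "next_index 3 = 1" "prev_index 1 = 3" "prev_index 2 = 1" "prev_index 3 = 2"
  by (simp_all add: next_index_def prev_index_def)

text \<open>Contraction of two slots with the alternating symbol.\<close>

definition wedge :: "(3 \<Rightarrow> 3 \<Rightarrow> complex) \<Rightarrow> 3 \<Rightarrow> complex" where
  "wedge B i = B (next_index i) (prev_index i) - B (prev_index i) (next_index i)"

definition cofactors :: "complex ^ 3 ^ 3 \<Rightarrow> complex ^ 3 ^ 3" where
  "cofactors M = (\<chi> p i. M $ next_index p $ next_index i * M $ prev_index p $ prev_index i - M $ next_index p $ prev_index i * M $ prev_index p $ next_index i)"

text \<open>The second exterior power of M is its cofactor matrix, once bivectors in dimension three
  are identified with covectors.\<close>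

lemma wedge_slot:
  "wedge (\<lambda>a a'. \<Sum>p\<in>UNIV. \<Sum>p'\<in>UNIV. M $ p $ a * (M $ p' $ a' * G p p')) i = (\<Sum>p\<in>UNIV. cofactors M $ p $ i * wedge G p)"
proof -
  consider "i = 1" | "i = 2" | "i = 3"
    using exhaust_3 by blast
  then show ?thesis
    by cases (simp_all add: wedge_def cofactors_def sum_3 algebra_simps)
qed

lemma wedge_sum: "wedge (\<lambda>a a'. \<Sum>p\<in>S. G p a a') i = (\<Sum>p\<in>S. wedge (G p) i)"
  by (simp add: wedge_def sum_subtractf)

lemma wedge_cmult: "wedge (\<lambda>a a'. c * G a a') i = c * wedge G i"
  by (simp add: wedge_def algebra_simps)

text \<open>
  On the coefficient tensor \<open>\<alpha>\<^sup>4 = \<beta>\<^sup>4\<close> of a quartic this is the contravariant \<open>(\<alpha> \<beta> \<xi>)\<^sup>4\<close> in the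
  symbolic notation of classical invariant theory.
\<close>

definition contravariant :: "tensor \<Rightarrow> tensor \<Rightarrow> tensor" where
  "contravariant T U i j k l = wedge (\<lambda>a a'. wedge (\<lambda>b b'. wedge (\<lambda>c c'. wedge (\<lambda>d d'. T a b c d * U a' b' c' d') l) k) j) i"

text \<open>The slots are transformed one at a time, so that each covariance lemma below applies
  \<open>wedge_slot\<close> to a single contraction.\<close>

definition act1 :: "complex ^ 3 ^ 3 \<Rightarrow> tensor \<Rightarrow> tensor" where
  "act1 M T i j k l = (\<Sum>p\<in>UNIV. M $ p $ i * T p j k l)"
definition act2 :: "complex ^ 3 ^ 3 \<Rightarrow> tensor \<Rightarrow> tensor" where
  "act2 M T i j k l = (\<Sum>p\<in>UNIV. M $ p $ j * T i p k l)"
definition act3 :: "complex ^ 3 ^ 3 \<Rightarrow> tensor \<Rightarrow> tensor" where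
  "act3 M T i j k l = (\<Sum>p\<in>UNIV. M $ p $ k * T i j p l)"
definition act4 :: "complex ^ 3 ^ 3 \<Rightarrow> tensor \<Rightarrow> tensor" where
  "act4 M T i j k l = (\<Sum>p\<in>UNIV. M $ p $ l * T i j k p)"

lemma contravariant_act4: "contravariant (act4 M T) (act4 M U) = act4 (cofactors M) (contravariant T U)"
proof (intro ext)
  fix i j k l
  have "act4 M T a b c d * act4 M U a' b' c' d' =
      (\<Sum>p\<in>UNIV. \<Sum>p'\<in>UNIV. M $ p $ d * (M $ p' $ d' * (T a b c p * U a' b' c' p')))" for a b c d a' b' c' d'
    unfolding act4_def sum_product by (intro sum.cong refl) (simp add: mult_ac)
  then show "contravariant (act4 M T) (act4 M U) i j k l = act4 (cofactors M) (contravariant T U) i j k l"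
    by (simp only: contravariant_def wedge_slot wedge_sum wedge_cmult act4_def)
qed

lemma contravariant_act3: "contravariant (act3 M T) (act3 M U) = act3 (cofactors M) (contravariant T U)"
proof (intro ext)
  fix i j k l
  have "act3 M T a b c d * act3 M U a' b' c' d' =
      (\<Sum>p\<in>UNIV. \<Sum>p'\<in>UNIV. M $ p $ c * (M $ p' $ c' * (T a b p d * U a' b' p' d')))" for a b c d a' b' c' d'
    unfolding act3_def sum_product by (intro sum.cong refl) (simp add: mult_ac)
  then show "contravariant (act3 M T) (act3 M U) i j k l = act3 (cofactors M) (contravariant T U) i j k l"
    by (simp only: contravariant_def wedge_slot wedge_sum wedge_cmult act3_def)
qed

lemma contravariant_act2: "contravariant (act2 M T) (act2 M U) = act2 (cofactors M) (contravariant T U)"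
proof (intro ext)
  fix i j k l
  have "act2 M T a b c d * act2 M U a' b' c' d' =
      (\<Sum>p\<in>UNIV. \<Sum>p'\<in>UNIV. M $ p $ b * (M $ p' $ b' * (T a p c d * U a' p' c' d')))" for a b c d a' b' c' d'
    unfolding act2_def sum_product by (intro sum.cong refl) (simp add: mult_ac)
  then show "contravariant (act2 M T) (act2 M U) i j k l = act2 (cofactors M) (contravariant T U) i j k l"
    by (simp only: contravariant_def wedge_slot wedge_sum wedge_cmult act2_def)
qed

lemma contravariant_act1: "contravariant (act1 M T) (act1 M U) = act1 (cofactors M) (contravariant T U)"
proof (intro ext)
  fix i j k l
  have "act1 M T a b c d * act1 M U a' b' c' d' =
      (\<Sum>p\<in>UNIV. \<Sum>p'\<in>UNIV. M $ p $ a * (M $ p' $ a' * (T p b c d * U p' b' c' d')))" for a b c d a' b' c' d'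
    unfolding act1_def sum_product by (intro sum.cong refl) (simp add: mult_ac)
  then show "contravariant (act1 M T) (act1 M U) i j k l = act1 (cofactors M) (contravariant T U) i j k l"
    by (simp only: contravariant_def wedge_slot wedge_sum wedge_cmult act1_def)
qed

definition act :: "complex ^ 3 ^ 3 \<Rightarrow> tensor \<Rightarrow> tensor" where
  "act M T = act1 M (act2 M (act3 M (act4 M T)))"

lemma contravariant_act: "contravariant (act M T) (act M U) = act (cofactors M) (contravariant T U)"
  by (simp add: act_def contravariant_act1 contravariant_act2 contravariant_act3 contravariant_act4)

section \<open>Catalecticant matrices and the two invariants\<close>

text \<open>The catalecticant as a redundant 9 x 9 matrix on pairs of indices. Compared with the 6 x
  6 matrix on quadratic monomials this needs no multinomial weights, and a substitution acts through
  a Kronecker square.\<close>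

definition flat :: "tensor \<Rightarrow> complex ^ (3 \<times> 3) ^ (3 \<times> 3)" where
  "flat T = (\<chi> x y. T (fst x) (snd x) (fst y) (snd y))"

definition kron :: "complex ^ 3 ^ 3 \<Rightarrow> complex ^ (3 \<times> 3) ^ (3 \<times> 3)" where
  "kron M = (\<chi> x y. M $ fst x $ fst y * M $ snd x $ snd y)"

lemma sum_UNIV_pairs: "(\<Sum>x\<in>(UNIV :: (3 \<times> 3) set). h x) = (\<Sum>p\<in>UNIV. \<Sum>q\<in>UNIV. h (p, q))"
  by (simp add: sum.cartesian_product)

lemma flat_act: "flat (act M T) = transpose (kron M) ** flat T ** kron M"
proof -
  have "act M T i j k l = (\<Sum>r\<in>UNIV. \<Sum>s\<in>UNIV. (\<Sum>p\<in>UNIV. \<Sum>q\<in>UNIV.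
      M $ p $ i * M $ q $ j * T p q r s) * (M $ r $ k * M $ s $ l))" for i j k l
    by (simp add: act_def act1_def act2_def act3_def act4_def sum_3 algebra_simps)
  then show ?thesis
    by (simp add: vec_eq_iff flat_def kron_def matrix_matrix_mult_def transpose_def sum_UNIV_pairs)
qed

lemma mat_mult_left: "(mat c ** A) $ i $ j = c * A $ i $ j" for A :: "complex ^ 'n::finite ^ 'n"
  by (auto simp: matrix_matrix_mult_def mat_def if_distrib if_distribR sum.delta'[OF finite] cong: if_cong)

lemma mat_mult_right: "(A ** mat c) $ i $ j = c * A $ i $ j" for A :: "complex ^ 'n::finite ^ 'n"
  by (auto simp: matrix_matrix_mult_def mat_def if_distrib if_distribR sum.delta[OF finite] mult.commute cong: if_cong)

lemma mat_commute: "A ** mat c = mat c ** A" for A :: "complex ^ 'n::finite ^ 'n"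
  by (simp add: vec_eq_iff mat_mult_left mat_mult_right)

lemma trace_mat_mult: "trace (mat c ** A) = c * trace A" for A :: "complex ^ 'n::finite ^ 'n"
  by (simp add: trace_def mat_mult_left sum_distrib_left)

lemma cofactors_det: "(\<Sum>i\<in>UNIV. M $ p $ i * cofactors M $ q $ i) = (if p = q then det M else 0)"
proof -
  have "\<forall>p q. (\<Sum>i\<in>UNIV. M $ p $ i * cofactors M $ q $ i) = (if p = q then det M else 0)"
    unfolding forall_3 by (simp add: sum_3 cofactors_def det_3 algebra_simps)
  then show ?thesis by blast
qed

lemma kron_cof: "kron M ** transpose (kron (cofactors M)) = mat ((det M)\<^sup>2)"
proof -
  have "(kron M ** transpose (kron (cofactors M))) $ x $ y =
      (\<Sum>i\<in>UNIV. M $ fst x $ i * cofactors M $ fst y $ i) * (\<Sum>i\<in>UNIV. M $ snd x $ i * cofactors M $ snd y $ i)" for x y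
    by (simp add: matrix_matrix_mult_def kron_def transpose_def sum_UNIV_pairs sum_product mult_ac)
  then show ?thesis
    by (auto simp: vec_eq_iff cofactors_det mat_def power2_eq_square prod_eq_iff)
qed

definition clebsch :: "tensor \<Rightarrow> complex ^ (3 \<times> 3) ^ (3 \<times> 3)" where
  "clebsch T = flat T ** flat (contravariant T T)"

definition inv3 :: "tensor \<Rightarrow> complex" where
  "inv3 T = trace (clebsch T)"

definition inv6 :: "tensor \<Rightarrow> complex" where
  "inv6 T = trace (clebsch T ** clebsch T)"

text \<open>The quartic transforms by M and its contravariant by the cofactors, so the two inner
  Kronecker squares cancel to a power of the determinant. The two outer ones cancel in the same way
  under a trace.\<close>

lemma clebsch_act:
  "clebsch (act M T) = mat ((det M)\<^sup>2) ** (transpose (kron M) ** clebsch T ** kron (cofactors M))"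
proof -
  have "clebsch (act M T) = transpose (kron M) ** flat T **
      (kron M ** transpose (kron (cofactors M))) ** flat (contravariant T T) ** kron (cofactors M)"
    by (simp add: clebsch_def contravariant_act flat_act matrix_mul_assoc)
  also have "\<dots> = mat ((det M)\<^sup>2) ** (transpose (kron M) ** clebsch T ** kron (cofactors M))"
    unfolding kron_cof mat_commute by (simp add: clebsch_def matrix_mul_assoc)
  finally show ?thesis .
qed

lemma kron_cof': "kron (cofactors M) ** transpose (kron M) = mat ((det M)\<^sup>2)"
  using arg_cong[OF kron_cof[of M], of transpose] by (simp add: matrix_transpose_mul)

lemma inv3_act: "inv3 (act M T) = det M ^ 4 * inv3 T"
proof -
  have "trace (transpose (kron M) ** clebsch T ** kron (cofactors M)) = trace (kron (cofactors M) ** transpose (kron M) ** clebsch T)"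
    by (subst trace_mul_sym) (simp add: matrix_mul_assoc)
  then show ?thesis
    unfolding inv3_def clebsch_act trace_mat_mult kron_cof' by (simp add: power2_eq_square power4_eq_xxxx)
qed

lemma inv6_act: "inv6 (act M T) = det M ^ 8 * inv6 T"
proof -
  let ?D = "mat ((det M)\<^sup>2)" and ?K = "transpose (kron M)" and ?L = "kron (cofactors M)" and ?N = "clebsch T"
  have "clebsch (act M T) ** clebsch (act M T) = ?D ** (?K ** ?N ** (?L ** ?D ** ?K) ** ?N ** ?L)"
    by (simp add: clebsch_act matrix_mul_assoc)
  also have "?L ** ?D ** ?K = ?D ** ?D"
    unfolding mat_commute[of ?L] by (simp add: matrix_mul_assoc[symmetric] kron_cof')
  also have "?D ** (?K ** ?N ** (?D ** ?D) ** ?N ** ?L) = ?D ** (?D ** (?D ** (?K ** ?N ** ?N ** ?L)))"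
    by (simp only: matrix_mul_assoc mat_commute[of "?K ** ?N"] mat_commute[of "?D ** ?K ** ?N"])
  finally have "inv6 (act M T) = ((det M)\<^sup>2 * ((det M)\<^sup>2 * (det M)\<^sup>2)) * trace (?K ** ?N ** ?N ** ?L)"
    by (simp add: inv6_def trace_mat_mult)
  also have "trace (?K ** ?N ** ?N ** ?L) = trace (?L ** ?K ** (?N ** ?N))"
    by (subst trace_mul_sym) (simp add: matrix_mul_assoc)
  also have "\<dots> = (det M)\<^sup>2 * inv6 T"
    by (simp add: kron_cof' trace_mat_mult inv6_def)
  finally show ?thesis
    by (simp add: power_mult[symmetric] power_add[symmetric] mult.assoc[symmetric])
qed

lemma clebsch_scale: "clebsch (\<lambda>i j k l. c * T i j k l) = mat (c ^ 3) ** clebsch T"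
proof -
  have "contravariant (\<lambda>i j k l. c * T i j k l) (\<lambda>i j k l. c * T i j k l) i j k l = c ^ 2 * contravariant T T i j k l" for i j k l
    by (simp add: contravariant_def wedge_def algebra_simps power2_eq_square)
  then have "clebsch (\<lambda>i j k l. c * T i j k l) $ x $ y = c ^ 3 * clebsch T $ x $ y" for x y
    by (simp add: clebsch_def flat_def matrix_matrix_mult_def sum_distrib_left
        power3_eq_cube power2_eq_square mult_ac)
  then show ?thesis
    by (simp add: vec_eq_iff mat_mult_left)
qed

lemma inv3_scale: "inv3 (\<lambda>i j k l. c * T i j k l) = c ^ 3 * inv3 T"
  by (simp add: inv3_def clebsch_scale trace_mat_mult)

lemma inv6_scale: "inv6 (\<lambda>i j k l. c * T i j k l) = c ^ 6 * inv6 T"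
proof -
  have "mat (c ^ 3) ** clebsch T ** (mat (c ^ 3) ** clebsch T)
      = mat (c ^ 3) ** (mat (c ^ 3) ** (clebsch T ** clebsch T))"
    by (simp only: matrix_mul_assoc mat_commute[of "mat (c ^ 3) ** clebsch T"])
  then show ?thesis
    by (simp add: inv6_def clebsch_scale trace_mat_mult power_add[symmetric] mult.assoc[symmetric])
qed

section \<open>Polarization and the absolute invariant\<close>

definition form4 :: "tensor \<Rightarrow> complex ^ 3 \<Rightarrow> complex ^ 3 \<Rightarrow> complex ^ 3 \<Rightarrow> complex ^ 3 \<Rightarrow> complex" where
  "form4 T a b c d = (\<Sum>i\<in>UNIV. a $ i * (\<Sum>j\<in>UNIV. b $ j * (\<Sum>k\<in>UNIV. c $ k * (\<Sum>l\<in>UNIV. d $ l * T i j k l))))"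

text \<open>The three adjacent transpositions generate all permutations of the slots.\<close>

definition symmetric_tensor :: "tensor \<Rightarrow> bool" where
  "symmetric_tensor T \<longleftrightarrow> (\<forall>i j k l. T i j k l = T j i k l \<and> T i j k l = T i k j l \<and> T i j k l = T i j l k)"

lemma form4_diff: "form4 (\<lambda>i j k l. T i j k l - U i j k l) a b c d = form4 T a b c d - form4 U a b c d"
  by (simp add: form4_def sum_3 algebra_simps)

lemma form4_lin:
  "form4 T (a + s *s x) b c d = form4 T a b c d + s * form4 T x b c d"
  "form4 T a (b + s *s x) c d = form4 T a b c d + s * form4 T a x c d"
  "form4 T a b (c + s *s x) d = form4 T a b c d + s * form4 T a b x d"
  "form4 T a b c (d + s *s x) = form4 T a b c d + s * form4 T a b c x"
  by (simp_all add: form4_def algebra_simps sum.distrib sum_distrib_left)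

lemma form4_sym:
  assumes "symmetric_tensor T"
  shows "form4 T a b c d = form4 T b a c d" "form4 T a b c d = form4 T a c b d" "form4 T a b c d = form4 T a b d c"
proof -
  have s: "T i j k l = T j i k l" "T i j k l = T i k j l" "T i j k l = T i j l k" for i j k l
    using assms unfolding symmetric_tensor_def by blast+
  show "form4 T a b c d = form4 T b a c d"
    unfolding form4_def sum_distrib_left by (subst sum.swap) (simp add: s(1) mult_ac)
  show "form4 T a b c d = form4 T a c b d"
    unfolding form4_def sum_distrib_left
    by (rule sum.cong[OF refl], subst sum.swap) (simp add: s(2) mult_ac)
  show "form4 T a b c d = form4 T a b d c"
    unfolding form4_def sum_distrib_left
    by (rule sum.cong[OF refl], rule sum.cong[OF refl], subst sum.swap) (simp add: s(3) mult_ac)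
qed

text \<open>The arguments are set free one after another: v is replaced by v + s u, and a polynomial
  in s that vanishes identically has zero coefficients.\<close>

lemma polarization:
  assumes sym: "symmetric_tensor T" and diag: "\<And>v. form4 T v v v v = 0"
  shows "T = (\<lambda>i j k l. 0)"
proof -
  let ?f = "form4 T"
  note sy = form4_sym[OF sym] and lin = form4_lin[of T]
  have 1: "?f u v v v = 0" for u v
  proof -
    have e: "?f v u v v = ?f u v v v" "?f v v u v = ?f v u v v" "?f v v v u = ?f v v u v"
      "?f u v u v = ?f u u v v" "?f u v v u = ?f u v u v" "?f v u u v = ?f u v u v"
      "?f v u v u = ?f v u u v" "?f v v u u = ?f v u v u"
      "?f u u v u = ?f u u u v" "?f u v u u = ?f u u v u" "?f v u u u = ?f u v u u"
      by (rule sy)+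
    have *: "4 * s * ?f u v v v + 6 * s ^ 2 * ?f u u v v + 4 * s ^ 3 * ?f u u u v = 0" for s
    proof -
      have "?f (v + s *s u) (v + s *s u) (v + s *s u) (v + s *s u)
          = ?f v v v v + 4 * s * ?f u v v v + 6 * s ^ 2 * ?f u u v v + 4 * s ^ 3 * ?f u u u v + s ^ 4 * ?f u u u u"
        unfolding lin e by (simp add: algebra_simps power2_eq_square power3_eq_cube power4_eq_xxxx)
      then show ?thesis
        by (simp add: diag)
    qed
    \<comment> \<open>Three values of s determine the three unknown coefficients.\<close>
    have "24 * ?f u v v v = 0"
      using *[of 1] *[of "-1"] *[of 2] by (simp, algebra)
    then show ?thesis
      by simp
  qed
  have 2: "?f u w v v = 0" for u w v
  proof -
    have e: "?f u v w v = ?f u w v v" "?f u v v w = ?f u v w v" "?f u w v w = ?f u w w v" "?f u v w w = ?f u w v w"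
      by (rule sy)+
    have *: "3 * s * ?f u w v v + 3 * s ^ 2 * ?f u w w v = 0" for s
    proof -
      have "?f u (v + s *s w) (v + s *s w) (v + s *s w)
          = ?f u v v v + 3 * s * ?f u w v v + 3 * s ^ 2 * ?f u w w v + s ^ 3 * ?f u w w w"
        unfolding lin e by (simp add: algebra_simps power2_eq_square power3_eq_cube)
      then show ?thesis
        by (simp add: 1)
    qed
    have "6 * ?f u w v v = (3 * 1 * ?f u w v v + 3 * 1 ^ 2 * ?f u w w v)
        - (3 * (- 1) * ?f u w v v + 3 * (- 1) ^ 2 * ?f u w w v)"
      by simp
    also have "\<dots> = 0"
      unfolding * by simp
    finally show ?thesis
      by simp
  qed
  have 3: "?f u w v x = 0" for u w v x
  proof -
    have "?f u w (v + 1 *s x) (v + 1 *s x) = ?f u w v v + 2 * ?f u w v x + ?f u w x x"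
      unfolding lin sy(3)[of u w x v] by (simp add: algebra_simps)
    then show ?thesis
      by (simp add: 2)
  qed
  show ?thesis
  proof (intro ext)
    fix i j k l
    have "form4 T (axis i 1) (axis j 1) (axis k 1) (axis l 1) = T i j k l"
      by (simp add: form4_def axis_def if_distrib if_distribR sum.delta' cong: if_cong)
    then show "T i j k l = 0"
      by (simp add: 3)
  qed
qed

lemma act_eq_form4: "act M T i j k l = form4 T (column i M) (column j M) (column k M) (column l M)"
  by (simp add: act_def act1_def act2_def act3_def act4_def form4_def column_def)

lemma form4_act:
  assumes "symmetric_tensor T"
  shows "form4 (act M T) v v v v = form4 T (M *v v) (M *v v) (M *v v) (M *v v)"
proof -
  note sy = form4_sym[OF assms]
  have 1: "form4 T (M *v a) b c d = (\<Sum>i\<in>UNIV. a $ i * form4 T (column i M) b c d)" for a b c d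
    unfolding form4_def matrix_vector_mult_def vec_lambda_beta column_def sum_distrib_right
    by (subst sum.swap) (simp add: sum_distrib_left mult_ac)
  have 2: "form4 T b (M *v a) c d = (\<Sum>i\<in>UNIV. a $ i * form4 T b (column i M) c d)" for a b c d
    unfolding sy(1)[of b] by (rule 1)
  have 3: "form4 T b c (M *v a) d = (\<Sum>i\<in>UNIV. a $ i * form4 T b c (column i M) d)" for a b c d
    unfolding sy(2)[of b c] by (rule 2)
  have 4: "form4 T b c d (M *v a) = (\<Sum>i\<in>UNIV. a $ i * form4 T b c d (column i M))" for a b c d
    unfolding sy(3)[of b c d] by (rule 3)
  show ?thesis
    unfolding 1 unfolding 2 unfolding 3 unfolding 4 by (simp add: form4_def[of "act M T"] act_eq_form4)
qed

lemma symmetric_tensor_act: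
  assumes "symmetric_tensor T"
  shows "symmetric_tensor (act M T)"
  unfolding symmetric_tensor_def act_eq_form4 using form4_sym[OF assms] by blast

text \<open>Polarization upgrades the equality of quartic functions to one of tensors. The square of
  \<open>inv3\<close> has the same degree 6 and the same determinant weight 8 as
  \<open>inv6\<close>.\<close>

lemma inv_ratio:
  assumes sym: "symmetric_tensor T" "symmetric_tensor U" and c: "c \<noteq> 0"
    and eq: "\<And>v. form4 T (M *v v) (M *v v) (M *v v) (M *v v) = c * form4 U v v v v"
    and nz: "inv3 U \<noteq> 0"
  shows "inv6 T * inv3 U ^ 2 = inv6 U * inv3 T ^ 2"
proof -
  define V where "V i j k l = act M T i j k l - c * U i j k l" for i j k l
  have V: "V = (\<lambda>i j k l. act M T i j k l - c * U i j k l)"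
    by (intro ext) (simp add: V_def)
  have cU: "form4 (\<lambda>i j k l. c * U i j k l) v v v v = c * form4 U v v v v" for v
    by (simp add: form4_def sum_distrib_left mult_ac)
  have "V = (\<lambda>i j k l. 0)"
  proof (rule polarization)
    show "symmetric_tensor V"
      using symmetric_tensor_act[OF sym(1), of M] sym(2) unfolding symmetric_tensor_def V_def by metis
    show "form4 V v v v v = 0" for v
      unfolding V form4_diff cU by (simp add: form4_act[OF sym(1)] eq)
  qed
  then have act: "act M T = (\<lambda>i j k l. c * U i j k l)"
    unfolding V by (simp add: fun_eq_iff)
  have 3: "det M ^ 4 * inv3 T = c ^ 3 * inv3 U"
    unfolding inv3_act[symmetric] act by (rule inv3_scale)
  have 6: "det M ^ 8 * inv6 T = c ^ 6 * inv6 U"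
    unfolding inv6_act[symmetric] act by (rule inv6_scale)
  \<comment> \<open>Invertibility of M is a consequence of the nonvanishing invariant of U.\<close>
  have "det M \<noteq> 0"
    using 3 c nz by auto
  have "c ^ 6 * det M ^ 8 * (inv6 T * inv3 U ^ 2) = (det M ^ 8 * inv6 T) * (c ^ 3 * inv3 U) ^ 2"
    by (simp add: power_mult_distrib flip: power_mult)
  also have "\<dots> = (c ^ 6 * inv6 U) * (det M ^ 4 * inv3 T) ^ 2"
    unfolding 3 6 ..
  also have "\<dots> = c ^ 6 * det M ^ 8 * (inv6 U * inv3 T ^ 2)"
    by (simp add: power_mult_distrib flip: power_mult)
  finally show ?thesis
    using c \<open>det M \<noteq> 0\<close> by simp
qed

section \<open>Invariants of the members of the pencil\<close>

text \<open>\<open>ones\<close> and \<open>twos\<close> are the exponents of x and y in the monomial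
  that belongs to four indices; the exponent of z is what remains up to 4.\<close>

definition ones :: "3 \<Rightarrow> 3 \<Rightarrow> 3 \<Rightarrow> 3 \<Rightarrow> nat" where
  "ones i j k l = of_bool (i = 1) + of_bool (j = 1) + of_bool (k = 1) + of_bool (l = 1)"

definition twos :: "3 \<Rightarrow> 3 \<Rightarrow> 3 \<Rightarrow> 3 \<Rightarrow> nat" where
  "twos i j k l = of_bool (i = 2) + of_bool (j = 2) + of_bool (k = 2) + of_bool (l = 2)"

text \<open>The coefficient tensor of \<open>F + t G\<close>, multiplied by 12 to clear denominators.\<close>

definition member_tensor :: "complex \<Rightarrow> tensor" where
  "member_tensor t i j k l = (let a = ones i j k l; b = twos i j k l in
     if a = 4 \<or> b = 4 then 12 * t else if a = 3 \<and> b = 0 then 6 else if a = 2 \<and> b = 2 then - 2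
     else if a = 1 \<and> b = 2 then - t else if a = 1 \<and> b = 0 then - 3 else if a = 0 \<and> b = 2 then 2 else 0)"

definition dual_tensor :: "complex \<Rightarrow> tensor" where
  "dual_tensor t i j k l = (let a = ones i j k l; b = twos i j k l in
     if a = 4 then 24 else if a = 3 \<and> b = 0 then 84 * t else if a = 2 \<and> b = 2 then - 12 * t
     else if a = 2 \<and> b = 0 then 4 * t\<^sup>2 - 8 else if a = 1 \<and> b = 2 then - 36
     else if a = 1 \<and> b = 0 then - 156 * t else if b = 4 then 144 else if a = 0 \<and> b = 2 then 72 * t
     else if a = 0 \<and> b = 0 then 24 + 288 * t\<^sup>2 else 0)"

lemma symmetric_tensor_member_tensor: "symmetric_tensor (member_tensor t)"
  by (simp add: symmetric_tensor_def member_tensor_def ones_def twos_def add_ac)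

lemma contravariant_member_tensor: "contravariant (member_tensor t) (member_tensor t) = dual_tensor t"
proof -
  have "\<forall>i j k l. contravariant (member_tensor t) (member_tensor t) i j k l = dual_tensor t i j k l"
    unfolding forall_3
    by (simp add: contravariant_def wedge_def member_tensor_def dual_tensor_def ones_def twos_def power2_eq_square)
  then show ?thesis
    by (intro ext) blast
qed

text \<open>An entry depends only on the quadratic monomials of its row and its column, whose
  exponents of x and y are a, b and c, d.\<close>

definition member_clebsch :: "complex \<Rightarrow> tensor" where
  "member_clebsch t i j m n = (
     let a = of_bool (i = 1) + of_bool (j = 1) :: nat; b = of_bool (i = 2) + of_bool (j = 2) :: nat;
         c = of_bool (m = 1) + of_bool (n = 1) :: nat; d = of_bool (m = 2) + of_bool (n = 2) :: nat in
     if a = 2 \<and> b = 0 \<and> c = 2 \<and> d = 0 then 1320 * t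
     else if a = 2 \<and> b = 0 \<and> c = 1 \<and> d = 0 then - 24 + 1056 * t ^ 2
     else if a = 2 \<and> b = 0 \<and> c = 0 \<and> d = 2 then - 720 - 144 * t ^ 2
     else if a = 2 \<and> b = 0 \<and> c = 0 \<and> d = 0 then - 2112 * t + 48 * t ^ 3
     else if a = 1 \<and> b = 1 \<and> c = 1 \<and> d = 1 then 120 * t
     else if a = 1 \<and> b = 1 \<and> c = 0 \<and> d = 1 then 144 - 144 * t ^ 2
     else if a = 1 \<and> b = 0 \<and> c = 2 \<and> d = 0 then 168
     else if a = 1 \<and> b = 0 \<and> c = 1 \<and> d = 0 then 1008 * t
     else if a = 1 \<and> b = 0 \<and> c = 0 \<and> d = 2 then - 432 * t
     else if a = 1 \<and> b = 0 \<and> c = 0 \<and> d = 0 then - 120 - 912 * t ^ 2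
     else if a = 0 \<and> b = 2 \<and> c = 2 \<and> d = 0 then - 64 - 304 * t ^ 2
     else if a = 0 \<and> b = 2 \<and> c = 1 \<and> d = 0 then - 896 * t - 8 * t ^ 3
     else if a = 0 \<and> b = 2 \<and> c = 0 \<and> d = 2 then 1968 * t
     else if a = 0 \<and> b = 2 \<and> c = 0 \<and> d = 0 then 64 + 1744 * t ^ 2
     else if a = 0 \<and> b = 1 \<and> c = 1 \<and> d = 1 then - 144 + 24 * t ^ 2
     else if a = 0 \<and> b = 1 \<and> c = 0 \<and> d = 1 then 360 * t
     else if a = 0 \<and> b = 0 \<and> c = 2 \<and> d = 0 then - 528 * t
     else if a = 0 \<and> b = 0 \<and> c = 1 \<and> d = 0 then - 24 - 24 * t ^ 2
     else if a = 0 \<and> b = 0 \<and> c = 0 \<and> d = 2 then 504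
     else if a = 0 \<and> b = 0 \<and> c = 0 \<and> d = 0 then 1080 * t
     else 0)"

lemma clebsch_member_tensor: "clebsch (member_tensor t) = flat (member_clebsch t)"
proof -
  have "\<forall>i j m n. clebsch (member_tensor t) $ (i, j) $ (m, n) = member_clebsch t i j m n"
    unfolding forall_3 clebsch_def contravariant_member_tensor matrix_matrix_mult_def flat_def sum_UNIV_pairs
    by (simp add: sum_3 member_tensor_def dual_tensor_def ones_def twos_def member_clebsch_def
        algebra_simps power2_eq_square power3_eq_cube)
  then show ?thesis
    by (simp add: vec_eq_iff flat_def)
qed

lemma inv3_member: "inv3 (member_tensor t) = 7344 * t"
  unfolding inv3_def clebsch_member_tensor trace_def flat_def sum_UNIV_pairs
  by (simp add: sum_3 member_clebsch_def)

text \<open>Division by 13824 = 24^3 gives the polynomial of the overview.\<close>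

lemma inv6_member: "inv6 (member_tensor t) = 110592 * t ^ 4 + 18417024 * t\<^sup>2 - 13824"
  unfolding inv6_def clebsch_member_tensor trace_def matrix_matrix_mult_def flat_def sum_UNIV_pairs
  by (simp add: sum_3 member_clebsch_def algebra_simps power2_eq_square power3_eq_cube power4_eq_xxxx)

section \<open>Irreducibility\<close>

lemma eval_poly_3: "eval_poly p v = (\<Sum>m\<in>Poly_Mapping.keys p. Poly_Mapping.lookup p m *
    (v $ 1 ^ Poly_Mapping.lookup m 1 * v $ 2 ^ Poly_Mapping.lookup m 2 * v $ 3 ^ Poly_Mapping.lookup m 3))"
  for v :: "complex ^ 3"
  by (simp add: eval_poly_def UNIV_3_prod)

text \<open>For fixed x the polynomial in y and z vanishes identically; each of its coefficients is
  then a polynomial in x with only zero values.\<close>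

lemma eval_poly_eq_0_imp:
  fixes p :: "3 cpoly"
  assumes "\<And>v. eval_poly p v = 0"
  shows "p = 0"
proof (rule poly_mapping_eqI)
  fix m0 :: "3 \<Rightarrow>\<^sub>0 nat"
  let ?i = "Poly_Mapping.lookup m0 1" and ?j = "Poly_Mapping.lookup m0 2" and ?k = "Poly_Mapping.lookup m0 3"
  let ?P = "\<lambda>m :: 3 \<Rightarrow>\<^sub>0 nat. Poly_Mapping.lookup m 3 = ?k \<and> Poly_Mapping.lookup m 2 = ?j"
  define R where "R x = (\<Sum>m\<in>Poly_Mapping.keys p. monom (monom (Poly_Mapping.lookup p m *
      x ^ Poly_Mapping.lookup m 1) (Poly_Mapping.lookup m 2)) (Poly_Mapping.lookup m 3))" for x
  define q where "q = (\<Sum>m\<in>Poly_Mapping.keys p. if ?P m then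
      monom (Poly_Mapping.lookup p m) (Poly_Mapping.lookup m 1) else 0)"
  have "R x = 0" for x
  proof (rule ev2_eq_0_imp)
    fix y z
    have "ev2 (R x) y z = eval_poly p (vector [x, y, z])"
      by (simp add: R_def eval_poly_3 poly_monom mult_ac)
    then show "ev2 (R x) y z = 0"
      using assms by simp
  qed
  moreover have "coeff (coeff (R x) ?k) ?j = poly q x" for x
    unfolding R_def q_def coeff_sum poly_sum by (rule sum.cong) (auto simp: poly_monom)
  ultimately have "poly q x = 0" for x
    by (metis coeff_0)
  then have "q = 0"
    using poly_all_0_iff_0[of q] by blast
  then have "0 = coeff q ?i"
    by simp
  also have "\<dots> = (\<Sum>m\<in>Poly_Mapping.keys p. if m = m0 then Poly_Mapping.lookup p m else 0)"
    unfolding q_def coeff_sum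
  proof (rule sum.cong)
    fix m :: "3 \<Rightarrow>\<^sub>0 nat"
    have "m = m0 \<longleftrightarrow> ?P m \<and> Poly_Mapping.lookup m 1 = ?i"
      by (auto simp: poly_mapping_eq_iff fun_eq_iff forall_3)
    then show "coeff (if ?P m then monom (Poly_Mapping.lookup p m) (Poly_Mapping.lookup m 1) else 0) ?i =
        (if m = m0 then Poly_Mapping.lookup p m else 0)"
      by auto
  qed simp
  also have "\<dots> = Poly_Mapping.lookup p m0"
    by (simp add: in_keys_iff)
  finally show "Poly_Mapping.lookup p m0 = Poly_Mapping.lookup 0 m0"
    by simp
qed

lemma is_unit_cpolyI:
  fixes p :: "3 cpoly"
  assumes "c \<noteq> 0" "\<And>v. eval_poly p v = c"
  shows "p dvd 1"
proof -
  have "p * const_poly (1 / c) - 1 = 0"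
    by (rule eval_poly_eq_0_imp) (use assms in simp)
  then have "1 = p * const_poly (1 / c)"
    by simp
  then show ?thesis ..
qed

text \<open>Units described by their values can be carried through changes of variables.\<close>

lemma is_unit_poly_poly_iff: "A dvd 1 \<longleftrightarrow> (\<exists>c. c \<noteq> 0 \<and> (\<forall>x y. ev2 A x y = c))"
proof
  assume "A dvd 1"
  then obtain c where "A = [:[:c:]:]" "c \<noteq> 0"
    by (auto simp: is_unit_poly_iff dvd_field_iff)
  then show "\<exists>c. c \<noteq> 0 \<and> (\<forall>x y. ev2 A x y = c)"
    by auto
next
  assume "\<exists>c. c \<noteq> 0 \<and> (\<forall>x y. ev2 A x y = c)"
  then obtain c where c: "c \<noteq> 0" "\<And>x y. ev2 A x y = c"
    by blast
  have "A = [:[:c:]:]"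
    by (rule ev2_eq_imp) (simp add: c(2))
  then show "A dvd 1"
    using c(1) by (simp add: is_unit_const_poly_iff dvd_field_iff)
qed

text \<open>Needed because irreducibility is proved with main variable z, whereas the charts have
  main variable y.\<close>

lemma irreducible_swap:
  assumes C: "irreducible C" and swap: "\<And>x y. ev2 D x y = ev2 C y x"
  shows "irreducible D"
proof (rule irreducibleI)
  show "D \<noteq> 0"
  proof
    assume "D = 0"
    then have "C = 0"
      using swap by (intro ev2_eq_0_imp) simp
    then show False
      using C by simp
  qed
  show "\<not> D dvd 1"
    using irreducible_not_unit[OF C] swap unfolding is_unit_poly_poly_iff by metis
  fix A B assume "D = A * B"
  obtain A' where A': "\<And>x y. ev2 A' x y = ev2 A y x"
    using is_poly2_swap[OF is_poly2_ev2[of A]] by (auto simp: is_poly2_def)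
  obtain B' where B': "\<And>x y. ev2 B' x y = ev2 B y x"
    using is_poly2_swap[OF is_poly2_ev2[of B]] by (auto simp: is_poly2_def)
  have "C = A' * B'"
    by (rule ev2_eq_imp) (simp add: A' B' \<open>D = A * B\<close> flip: swap)
  then have "A' dvd 1 \<or> B' dvd 1"
    using irreducibleD[OF C] by blast
  then show "A dvd 1 \<or> B dvd 1"
    unfolding is_unit_poly_poly_iff A' B' by metis
qed

text \<open>
  One of two factors restricts to a constant on infinitely many of the planes \<open>v $ 1 = s\<close>, so it
  depends on \<open>v $ 1\<close> only, and then a zero of it would make \<open>p\<close> vanish on a whole plane.
\<close>

lemma irreducible_form:
  fixes p :: "3 cpoly"
  assumes form: "is_form d p" and C: "irreducible C" "\<And>y z. ev2 C y z = eval_poly p (vector [1, y, z])"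
    and slices: "\<And>x. \<exists>y z. eval_poly p (vector [x, y, z]) \<noteq> 0"
  shows "irreducible p"
proof (rule irreducibleI)
  show "p \<noteq> 0"
    using slices by force
  show "\<not> p dvd 1"
  proof
    assume "p dvd 1"
    then obtain q where q: "1 = p * q" ..
    have "eval_poly p v * eval_poly q v = 1" for v
      using arg_cong[OF q, of "\<lambda>p. eval_poly p v"] by simp
    moreover obtain A B where "\<And>y z. ev2 A y z = eval_poly p (vector [1, y, z])"
      "\<And>y z. ev2 B y z = eval_poly q (vector [1, y, z])"
    proof -
      have v: "is_poly2 (\<lambda>y z. vector [1, y, z] $ i)" for i :: 3
        using exhaust_3[of i] by (elim disjE) (simp_all add: is_poly2_intros)
      show ?thesis
        using that is_poly2_eval_poly[OF v, of p] is_poly2_eval_poly[OF v, of q] by (auto simp: is_poly2_def)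
    qed
    ultimately have "C * B = 1"
      using C(2) by (intro ev2_eq_imp) simp
    then show False
      using irreducible_not_unit[OF C(1)] by (metis dvd_triv_left)
  qed
  fix a b assume p: "p = a * b"
  have prime: "prime_elem C"
    using C(1) by (rule irreducible_imp_prime_elem)
  define const where "const q s \<longleftrightarrow> (\<forall>y z. eval_poly q (vector [s, y, z]) = eval_poly q (vector [s, 0, 0]))"
    for q :: "3 cpoly" and s
  have v2: "is_poly2 (\<lambda>y z. vector [s, s * y, s * z] $ i)" for s and i :: 3
    using exhaust_3[of i] by (elim disjE) (simp_all add: is_poly2_intros)
  have aux: "const b' s" if "C dvd A" "smult [:s ^ d:] C = A * B" "s \<noteq> 0"
    "\<And>y z. ev2 B y z = eval_poly b' (vector [s, s * y, s * z])" for A B b' s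
  proof -
    obtain E where "A = C * E"
      using \<open>C dvd A\<close> ..
    then have "C * [:[:s ^ d:]:] = C * (E * B)"
      using that(2) by (simp add: mult_ac)
    then have "[:[:s ^ d:]:] = E * B"
      using C(1) by (simp only: mult_cancel_left) auto
    moreover have "[:[:s ^ d:]:] dvd 1"
      using \<open>s \<noteq> 0\<close> by (simp add: is_unit_const_poly_iff dvd_field_iff)
    ultimately have "B dvd 1"
      by (metis dvd_mult_right)
    then obtain c where c: "\<And>y z. ev2 B y z = c"
      using is_unit_poly_poly_iff by blast
    have "eval_poly b' (vector [s, y, z]) = c" for y z
      using c[of "y / s" "z / s"] that(4)[of "y / s" "z / s"] \<open>s \<noteq> 0\<close> by simp
    then show ?thesis
      by (simp add: const_def)
  qed
  \<comment> \<open>In coordinates scaled by s, the restriction of p to the plane v_1 = s is s^d C.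
    The prime C divides the restriction of one factor, so that of the other is a unit.\<close>
  have split: "const a s \<or> const b s" if s: "s \<noteq> 0" for s
  proof -
    obtain A where A: "\<And>y z. ev2 A y z = eval_poly a (vector [s, s * y, s * z])"
      using is_poly2_eval_poly[OF v2, of a s] by (auto simp: is_poly2_def)
    obtain B where B: "\<And>y z. ev2 B y z = eval_poly b (vector [s, s * y, s * z])"
      using is_poly2_eval_poly[OF v2, of b s] by (auto simp: is_poly2_def)
    have eq: "smult [:s ^ d:] C = A * B"
    proof (rule ev2_eq_imp)
      fix y z
      have "vector [s, s * y, s * z] = s *s (vector [1, y, z] :: complex ^ 3)"
        by (simp add: vec3_eq_iff)
      then have "eval_poly p (vector [s, s * y, s * z]) = s ^ d * eval_poly p (vector [1, y, z])"
        by (simp only: eval_form_scale[OF form])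
      then show "ev2 (smult [:s ^ d:] C) y z = ev2 (A * B) y z"
        by (simp add: C(2) A B p)
    qed
    have "C dvd A * B"
      unfolding eq[symmetric] by (simp add: dvd_smult)
    then have "C dvd A \<or> C dvd B"
      using prime prime_elem_dvd_multD by blast
    moreover have "smult [:s ^ d:] C = B * A"
      using eq by (simp only: mult.commute)
    ultimately show ?thesis
      using aux[OF _ eq s B] aux[OF _ _ s A] by blast
  qed
  have key: "q dvd 1" if inf: "infinite {s. const q s}" and r: "p = q * r" for q r
  proof -
    have v1: "is_poly2 (\<lambda>x y. vector [x, a, b] $ i)" for a b and i :: 3
      using exhaust_3[of i] by (elim disjE) (simp_all add: is_poly2_intros)
    have slice: "\<exists>P. \<forall>x. eval_poly q (vector [x, y, z]) = poly P x" for y z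
    proof -
      obtain A where A: "\<And>x w. eval_poly q (vector [x, y, z]) = ev2 A x w"
        using is_poly2_eval_poly[OF v1, of q y z] by (auto simp: is_poly2_def)
      show ?thesis
        by (rule exI[of _ "poly A 0"]) (use A[of _ 0] in \<open>simp add: ev2_def\<close>)
    qed
    obtain Q where Q: "\<And>x. eval_poly q (vector [x, 0, 0]) = poly Q x"
      using slice by blast
    have ev: "eval_poly q (vector [x, y, z]) = poly Q x" for x y z
    proof -
      obtain P where P: "\<And>x. eval_poly q (vector [x, y, z]) = poly P x"
        using slice by blast
      \<comment> \<open>For fixed y and z two polynomials in x agree at infinitely many
        points.\<close>
      have "{s. const q s} \<subseteq> {s. poly (P - Q) s = 0}"
        by (auto simp: const_def simp flip: P Q)
      then have "P - Q = 0"
        using inf poly_roots_finite finite_subset by blast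
      then show ?thesis
        by (simp add: P)
    qed
    have "poly Q x \<noteq> 0" for x
      using slices[of x] r ev by auto
    then have "degree Q = 0"
      using fundamental_theorem_of_algebra[of Q] by (auto simp: constant_degree)
    then obtain c where c: "Q = [:c:]"
      using degree_eq_zeroE by blast
    have "eval_poly q v = c" for v
    proof -
      have "v = vector [v $ 1, v $ 2, v $ 3]"
        by (simp add: vec3_eq_iff)
      then show ?thesis
        using ev[of "v $ 1" "v $ 2" "v $ 3"] c by simp
    qed
    moreover have "c \<noteq> 0"
      using \<open>\<And>x. poly Q x \<noteq> 0\<close>[of 0] c by simp
    ultimately show ?thesis
      by (intro is_unit_cpolyI)
  qed
  have "UNIV - {0} \<subseteq> {s. const a s} \<union> {s. const b s}"
    using split by blast
  moreover have "infinite (UNIV - {0 :: complex})"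
    using infinite_UNIV_char_0 by simp
  ultimately have "infinite {s. const a s} \<or> infinite {s. const b s}"
    using finite_subset by blast
  then show "a dvd 1 \<or> b dvd 1"
    using key[of a b] key[of b a] p by (auto simp: mult.commute)
qed

text \<open>A factorization in the chart z = 1 becomes one in the chart x = 1 up to powers of z. The
  prime equation there absorbs one factor, and the other one has no zeros off the line x =
  0.\<close>

lemma irreducible_other_chart:
  assumes form: "is_form d p" and prime: "prime_elem (chart 1 p)" and deg: "degree (chart 1 p) > 0"
    and slice: "eval_poly p (chart_pt 3 0 y0) \<noteq> 0"
  shows "irreducible (chart 3 p)"
proof (rule irreducibleI)
  have p13: "eval_poly p (chart_pt 1 z y) = z ^ d * eval_poly p (chart_pt 3 (1 / z) (y / z))" if "z \<noteq> 0" for z y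
  proof -
    have "chart_pt 1 z y = z *s chart_pt 3 (1 / z) (y / z)"
      using that by (simp add: vec3_eq_iff)
    then show ?thesis
      by (metis eval_form_scale[OF form])
  qed
  have unit: "B dvd 1" if AB: "chart 3 p = A * B" and hat: "\<And>z y. z \<noteq> 0 \<Longrightarrow> ev2 A' z y = z ^ N * ev2 A (1 / z) (y / z)"
    "\<And>z y. z \<noteq> 0 \<Longrightarrow> ev2 B' z y = z ^ N' * ev2 B (1 / z) (y / z)" and dvd: "chart 1 p dvd A'" for A B A' B' N N'
  proof -
    obtain E where E: "A' = chart 1 p * E"
      using dvd ..
    have prod: "ev2 A (1 / z) (y / z) * ev2 B (1 / z) (y / z) * z ^ d = ev2 (chart 1 p) z y" if "z \<noteq> 0" for z y
      using arg_cong[OF AB, of "\<lambda>C. ev2 C (1 / z) (y / z)"] p13[OF that]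
      by (simp add: ev2_chart)
    have "chart 1 p * (smult (monom 1 d) (E * B') - [:monom 1 (N + N'):]) * [:[:0, 1:]:] = 0"
    proof (rule ev2_eq_0_imp)
      fix z y
      show "ev2 (chart 1 p * (smult (monom 1 d) (E * B') - [:monom 1 (N + N'):]) * [:[:0, 1:]:]) z y = 0"
      proof (cases "z = 0")
        case False
        have "ev2 (chart 1 p) z y * ev2 E z y * ev2 B' z y * z ^ d = z ^ (N + N') * ev2 (chart 1 p) z y"
          using hat[OF False, of y] prod[OF False, of y] by (simp add: E power_add mult_ac)
        then show ?thesis
          by (simp add: poly_monom algebra_simps)
      qed simp
    qed
    \<comment> \<open>So B' divides a power of z and cannot vanish for nonzero z.\<close>
    then have eq: "smult (monom 1 d) (E * B') = [:monom 1 (N + N'):]"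
      using prime by (auto simp: prime_elem_def)
    have B'nz: "ev2 B' z y \<noteq> 0" if "z \<noteq> 0" for z y
      using arg_cong[OF eq, of "\<lambda>C. ev2 C z y"] that by (auto simp: poly_monom)
    have Bnz: "ev2 B x y \<noteq> 0" if "x \<noteq> 0" for x y
      using B'nz[of "1 / x" "y / x"] hat(2)[of "1 / x" "y / x"] that by auto
    have "coeff B j = 0" if "j > 0" for j
    proof -
      have "poly (coeff B j) x = poly 0 x" if x: "x \<noteq> 0" for x
      proof -
        have "degree (spec x B) = 0"
          using Bnz[OF x] fundamental_theorem_of_algebra[of "spec x B"]
          by (auto simp: constant_degree poly_spec)
        then have "coeff (spec x B) j = 0"
          using \<open>j > 0\<close> by (simp only: coeff_eq_0)
        then show ?thesis
          by simp
      qed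
      then show ?thesis
        by (rule poly_eq_nonzero)
    qed
    then have B0: "B = [:coeff B 0:]"
      by (intro poly_eqI) (auto simp: coeff_pCons split: nat.splits)
    have "poly (coeff B 0) x \<noteq> 0" for x
    proof (cases "x = 0")
      case True
      \<comment> \<open>A power of x would be invisible in the chart x = 1; the assumption on the
        line x = 0 excludes it.\<close>
      have "ev2 A 0 y0 * ev2 B 0 y0 \<noteq> 0"
        using slice arg_cong[OF AB, of "\<lambda>C. ev2 C 0 y0"] by (simp add: ev2_chart)
      then have "ev2 B 0 y0 \<noteq> 0"
        by simp
      then show ?thesis
        using True B0 by (metis add.right_neutral ev2_simps(1,8) mult_zero_right)
    next
      case False
      then show ?thesis
        using Bnz[of x 0] B0 by (metis add.right_neutral ev2_simps(1,8) mult_zero_right)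
    qed
    then have "degree (coeff B 0) = 0"
      using fundamental_theorem_of_algebra[of "coeff B 0"] by (auto simp: constant_degree)
    then obtain c where c: "coeff B 0 = [:c:]"
      using degree_eq_zeroE by blast
    then have "c \<noteq> 0"
      using \<open>\<And>x. poly (coeff B 0) x \<noteq> 0\<close>[of 0] by simp
    moreover have "B = [:[:c:]:]"
      using B0 c by simp
    ultimately show ?thesis
      by (simp add: is_unit_const_poly_iff dvd_field_iff)
  qed
  show "chart 3 p \<noteq> 0"
    using slice by (metis ev2_chart ev2_simps(1))
  show "\<not> chart 3 p dvd 1"
  proof
    assume "chart 3 p dvd 1"
    then obtain c where c: "\<And>x y. eval_poly p (chart_pt 3 x y) = c" "c \<noteq> 0"
      using is_unit_poly_poly_iff ev2_chart by metis
    have "chart 1 p = [:monom c d:]"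
    proof -
      have "[:[:0, 1:]:] * (chart 1 p - [:monom c d:]) = 0"
      proof (rule ev2_eq_0_imp)
        fix z y
        show "ev2 ([:[:0, 1:]:] * (chart 1 p - [:monom c d:])) z y = 0"
          using p13[of z y] c(1) by (cases "z = 0") (simp_all add: ev2_chart poly_monom)
      qed
      then show ?thesis
        by simp
    qed
    then show False
      using deg by simp
  qed
  fix A B assume AB: "chart 3 p = A * B"
  obtain N A' where A': "\<And>z y. z \<noteq> 0 \<Longrightarrow> ev2 A' z y = z ^ N * ev2 A (1 / z) (y / z)"
    using ex_chart_change_eval by blast
  obtain N' B' where B': "\<And>z y. z \<noteq> 0 \<Longrightarrow> ev2 B' z y = z ^ N' * ev2 B (1 / z) (y / z)"
    using ex_chart_change_eval by blast
  have "smult (monom 1 d) (A' * B') = smult (monom 1 (N + N')) (chart 1 p)"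
  proof -
    have "[:[:0, 1:]:] * (smult (monom 1 d) (A' * B') - smult (monom 1 (N + N')) (chart 1 p)) = 0"
    proof (rule ev2_eq_0_imp)
      fix z y
      show "ev2 ([:[:0, 1:]:] * (smult (monom 1 d) (A' * B') - smult (monom 1 (N + N')) (chart 1 p))) z y = 0"
      proof (cases "z = 0")
        case False
        have "ev2 A (1 / z) (y / z) * ev2 B (1 / z) (y / z) * z ^ d = ev2 (chart 1 p) z y"
          using arg_cong[OF AB, of "\<lambda>C. ev2 C (1 / z) (y / z)"] p13[OF False]
          by (simp add: ev2_chart)
        then show ?thesis
          using A'[OF False] B'[OF False] by (simp add: poly_monom power_add algebra_simps)
      qed simp
    qed
    then show ?thesis
      by simp
  qed
  then have "chart 1 p dvd smult (monom 1 d) (A' * B')"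
    by (simp add: dvd_smult)
  then have "chart 1 p dvd A' * B'"
    by (rule dvd_mult_const_poly_poly[OF prime deg, rotated]) simp
  then have "chart 1 p dvd A' \<or> chart 1 p dvd B'"
    using prime prime_elem_dvd_multD by blast
  then show "A dvd 1 \<or> B dvd 1"
    using unit[OF AB A' B'] unit[of B A B' N' A' N, OF _ B' A'] AB by (auto simp: mult.commute)
qed

section \<open>The pencil\<close>

definition quartic_F :: "3 cpoly" where
  "quartic_F = var_poly 2 ^ 2 * var_poly 3 ^ 2 - var_poly 1 ^ 2 * var_poly 2 ^ 2
     - var_poly 1 * var_poly 3 ^ 3 + const_poly 2 * (var_poly 1 ^ 3 * var_poly 3)"

definition quartic_G :: "3 cpoly" where
  "quartic_G = var_poly 2 ^ 4 - var_poly 1 * var_poly 2 ^ 2 * var_poly 3 + var_poly 1 ^ 4"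

definition member :: "complex \<Rightarrow> complex \<Rightarrow> 3 cpoly" where
  "member a b = const_poly a * quartic_F + const_poly b * quartic_G"

lemma pencil_member_eq: "pencil_member quartic_F quartic_G t = member (t $ 1) (t $ 2)"
  by (simp add: pencil_member_def member_def)

lemma eval_quartic_F: "eval_poly quartic_F v = (v $ 2)\<^sup>2 * (v $ 3)\<^sup>2 - (v $ 1)\<^sup>2 * (v $ 2)\<^sup>2
    - v $ 1 * v $ 3 ^ 3 + 2 * (v $ 1 ^ 3 * v $ 3)"
  by (simp add: quartic_F_def)

lemma eval_quartic_G: "eval_poly quartic_G v = v $ 2 ^ 4 - v $ 1 * (v $ 2)\<^sup>2 * v $ 3 + v $ 1 ^ 4"
  by (simp add: quartic_G_def)

lemma eval_member: "eval_poly (member a b) v =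
    a * ((v $ 2)\<^sup>2 * (v $ 3)\<^sup>2 - (v $ 1)\<^sup>2 * (v $ 2)\<^sup>2 - v $ 1 * v $ 3 ^ 3 + 2 * (v $ 1 ^ 3 * v $ 3))
    + b * (v $ 2 ^ 4 - v $ 1 * (v $ 2)\<^sup>2 * v $ 3 + v $ 1 ^ 4)"
  by (simp add: member_def eval_quartic_F eval_quartic_G)

lemma form_quartic_F: "is_form 4 quartic_F"
proof -
  have "is_form (2 * 1 + 2 * 1) (var_poly 2 ^ 2 * var_poly 3 ^ 2 :: 3 cpoly)"
    "is_form (2 * 1 + 2 * 1) (var_poly 1 ^ 2 * var_poly 2 ^ 2 :: 3 cpoly)"
    "is_form (1 + 3 * 1) (var_poly 1 * var_poly 3 ^ 3 :: 3 cpoly)"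
    "is_form (3 * 1 + 1) (var_poly 1 ^ 3 * var_poly 3 :: 3 cpoly)"
    by (intro is_form_mult is_form_power is_form_var)+
  then show ?thesis
    unfolding quartic_F_def by (intro is_form_add is_form_diff is_form_const_mult) simp_all
qed

lemma form_quartic_G: "is_form 4 quartic_G"
proof -
  have "is_form (4 * 1) (var_poly 2 ^ 4 :: 3 cpoly)" "is_form (4 * 1) (var_poly 1 ^ 4 :: 3 cpoly)"
    "is_form (1 + 2 * 1 + 1) (var_poly 1 * var_poly 2 ^ 2 * var_poly 3 :: 3 cpoly)"
    by (intro is_form_mult is_form_power is_form_var)+
  then show ?thesis
    unfolding quartic_G_def by (intro is_form_add is_form_diff) (simp_all add: eval_nat_numeral)
qed

lemma form_member: "is_form 4 (member a b)"
  unfolding member_def by (intro is_form_add is_form_const_mult form_quartic_F form_quartic_G)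

lemma is_pencil_quartics: "is_pencil 4 quartic_F quartic_G"
  unfolding is_pencil_def
proof (intro conjI form_quartic_F form_quartic_G allI impI)
  fix a b assume "const_poly a * quartic_F + const_poly b * quartic_G = 0"
  then have "eval_poly (member a b) v = 0" for v
    by (simp add: member_def)
  from this[of "vector [0, 1, 0]"] this[of "vector [0, 1, 1]"] show "a = 0" "b = 0"
    by (simp_all add: eval_member)
qed

text \<open>
  Substituting \<open>x y^2 z = y^4 + x^4\<close> into \<open>x^2 y^6\<close> times the first form leaves \<open>- x^12\<close>.
\<close>

lemma base_point:
  assumes "eval_poly quartic_F v = 0" "eval_poly quartic_G v = 0"
  shows "v $ 1 = 0 \<and> v $ 2 = 0"
proof -
  define x y z where "x = v $ 1" and "y = v $ 2" and "z = v $ 3"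
  have F: "y^2 * z^2 - x^2 * y^2 - x * z^3 + 2 * (x^3 * z) = 0"
    and G: "y^4 - x * y^2 * z + x^4 = 0"
    using assms by (simp_all add: eval_quartic_F eval_quartic_G x_def y_def z_def)
  define w where "w = x * y^2 * z"
  have w: "w = y^4 + x^4"
    using G unfolding w_def by (simp add: algebra_simps)
  have "x^2 * y^6 * (y^2 * z^2 - x^2 * y^2 - x * z^3 + 2 * (x^3 * z)) =
      y^4 * w^2 - x^4 * y^8 - w^3 + 2 * x^4 * y^4 * w"
    unfolding w_def by algebra
  also have "\<dots> = - (x ^ 12)"
    unfolding w by algebra
  finally have "x = 0"
    using F by simp
  with G show ?thesis
    by (simp add: x_def y_def)
qed

lemma base_locus_quartics: "base_locus quartic_F quartic_G = {proj_pt (vector [0, 0, 1])}"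
proof
  show "base_locus quartic_F quartic_G \<subseteq> {proj_pt (vector [0, 0, 1])}"
  proof
    fix P assume P: "P \<in> base_locus quartic_F quartic_G"
    then obtain v where v: "P = proj_pt v" "v \<noteq> 0" "eval_poly quartic_F v = 0"
      by (auto simp: base_locus_def zero_locus_def)
    have "eval_poly quartic_G v = 0"
      using P proj_pt_in_zero_locus[OF form_quartic_G v(2)] by (simp add: base_locus_def v(1))
    then have "v $ 1 = 0" "v $ 2 = 0"
      using base_point v(3) by blast+
    then have "v = v $ 3 *s vector [0, 0, 1]" "v $ 3 \<noteq> 0"
      using v(2) by (auto simp: vec3_eq_iff)
    then have "proj_pt v = proj_pt (vector [0, 0, 1])"
      using proj_pt_scale by metis
    then show "P \<in> {proj_pt (vector [0, 0, 1])}"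
      by (simp add: v(1))
  qed
  have "vector [0, 0, 1] \<noteq> (0 :: complex ^ 3)"
    by (simp add: vec3_eq_iff)
  then show "{proj_pt (vector [0, 0, 1])} \<subseteq> base_locus quartic_F quartic_G"
    unfolding base_locus_def zero_locus_def by (auto simp: eval_quartic_F eval_quartic_G)
qed

text \<open>The chart \<open>x = 1\<close> with main variable \<open>z\<close>, in which the members are cubics.\<close>

definition cubic :: "complex \<Rightarrow> complex \<Rightarrow> complex poly poly" where
  "cubic a b = [:[:b, 0, - a, 0, b:], [:2 * a, 0, - b:], [:0, 0, a:], [:- a:]:]"

lemma ev2_cubic: "ev2 (cubic a b) y z = eval_poly (member a b) (vector [1, y, z])"
  unfolding cubic_def eval_member by (simp add: power2_eq_square power3_eq_cube power4_eq_xxxx algebra_simps)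

text \<open>If r had degree above 2, the cube would dominate every other term. So r is at most
  quadratic in y, and comparing coefficients leaves an inconsistent system for its three
  coefficients and t = b / a.\<close>

lemma cubic_no_root:
  fixes r :: "complex poly"
  assumes a: "a \<noteq> 0"
  shows "poly (cubic a b) r \<noteq> 0"
proof
  assume "poly (cubic a b) r = 0"
  then have eq: "smult a (r ^ 3) = [:b, 0, - a, 0, b:] + [:2 * a, 0, - b:] * r + [:0, 0, a:] * r ^ 2"
    by (simp add: cubic_def algebra_simps power2_eq_square power3_eq_cube)
  have "degree r \<le> 2"
  proof (rule ccontr)
    assume r: "\<not> degree r \<le> 2"
    have "3 * degree r = degree (smult a (r ^ 3))"
      using a r by (subst degree_smult_eq, subst degree_power_eq) auto
    also have "\<dots> \<le> max (max 4 (2 + degree r)) (2 + 2 * degree r)"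
      unfolding eq
      by (intro degree_add_le_max[THEN order.trans] max.mono order.trans[OF degree_mult_le])
        (auto simp: degree_power_le intro: order.trans[OF degree_power_le])
    finally show False
      using r by simp
  qed
  then have "r = [:coeff r 0, coeff r 1, coeff r 2:]"
    by (intro poly_eqI) (auto simp: coeff_pCons coeff_eq_0 numeral_2_eq_2 split: nat.splits)
  then obtain p q s where r: "r = [:p, q, s:]"
    by blast
  define t where "t = b / a"
  have b: "b = a * t"
    using a by (simp add: t_def)
  have c: "a * poly (r ^ 3) y = a * (t - y^2 + t * y^4 + (2 - t * y^2) * poly r y + y^2 * poly r y ^ 2)" for y
    using arg_cong[OF eq, of "\<lambda>p. poly p y"] by (simp add: b algebra_simps power2_eq_square power4_eq_xxxx)
  \<comment> \<open>The entries are the coefficients of 1, y, ..., y^6 in the right-hand side minus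
    the cube of r.\<close>
  have "poly [:t + 2 * p - p^3, 2 * q - 3 * p^2 * q, - 1 + 2 * s - t * p + p^2 - 3 * p^2 * s - 3 * p * q^2,
      - t * q + 2 * p * q - 6 * p * q * s - q^3, t - t * s + q^2 + 2 * p * s - 3 * p * s^2 - 3 * q^2 * s,
      2 * q * s - 3 * q * s^2, s^2 - s^3:] y = 0" for y
  proof -
    have "poly r y ^ 3 = t - y^2 + t * y^4 + (2 - t * y^2) * poly r y + y^2 * poly r y ^ 2"
      using c[of y] a by simp
    then show ?thesis
      unfolding r by simp algebra
  qed
  then have "[:t + 2 * p - p^3, 2 * q - 3 * p^2 * q, - 1 + 2 * s - t * p + p^2 - 3 * p^2 * s - 3 * p * q^2,
      - t * q + 2 * p * q - 6 * p * q * s - q^3, t - t * s + q^2 + 2 * p * s - 3 * p * s^2 - 3 * q^2 * s,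
      2 * q * s - 3 * q * s^2, s^2 - s^3:] = 0"
    using poly_all_0_iff_0 by blast
  then have e: "t + 2 * p - p^3 = 0" "2 * q - 3 * p^2 * q = 0"
    "- 1 + 2 * s - t * p + p^2 - 3 * p^2 * s - 3 * p * q^2 = 0"
    "- t * q + 2 * p * q - 6 * p * q * s - q^3 = 0"
    "t - t * s + q^2 + 2 * p * s - 3 * p * s^2 - 3 * q^2 * s = 0"
    "2 * q * s - 3 * q * s^2 = 0" "s^2 - s^3 = 0"
    by (simp_all only: pCons_eq_0_iff)
  have "s = 0 \<or> s = 1"
    using e(7) by algebra
  then show False
  proof
    assume s: "s = 1"
    then have "q = 0"
      using e(6) by simp
    then have "p = 0"
      using e(5) s by simp
    then show False
      using e(3) s \<open>q = 0\<close> by simp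
  next
    assume s: "s = 0"
    then have t: "t = - (q^2)"
      using e(5) by (simp add: eq_neg_iff_add_eq_0)
    then have "p * q = 0"
      using e(4) s by (simp add: power2_eq_square power3_eq_cube)
    then show False
    proof (cases "p = 0")
      case True
      then show False
        using e(3) s by simp
    next
      case False
      then have "q = 0"
        using \<open>p * q = 0\<close> by simp
      then have "p^2 = 1" "p * (2 - p^2) = 0"
        using e(1,3) s t by (simp_all add: algebra_simps power2_eq_square power3_eq_cube)
      then show False
        using False by simp
    qed
  qed
qed

text \<open>For a = 0 the polynomial is linear in z with coprime coefficients. Otherwise its leading
  coefficient is a unit, so a proper factorization would contain a linear factor with unit leading
  coefficient, hence a root in the polynomials in y.\<close>

lemma irreducible_cubic:
  assumes "a \<noteq> 0 \<or> b \<noteq> 0"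
  shows "irreducible (cubic a b)"
proof (cases "a = 0")
  case True
  then have b: "b \<noteq> 0"
    using assms by simp
  have C: "cubic a b = [:[:b, 0, 0, 0, b:], [:0, 0, - b:]:]"
    using True by (simp add: cubic_def)
  have const: "A dvd 1" if AB: "[:[:b, 0, 0, 0, b:], [:0, 0, - b:]:] = A * B" and dA: "degree A = 0" for A B :: "complex poly poly"
  proof -
    obtain p where p: "A = [:p:]"
      using dA degree_eq_zeroE by blast
    have "[:p:] dvd [:[:b, 0, 0, 0, b:], [:0, 0, - b:]:]"
      unfolding AB p by (rule dvd_triv_left)
    then have d: "p dvd coeff [:[:b, 0, 0, 0, b:], [:0, 0, - b:]:] n" for n
      by (simp only: const_poly_dvd_iff)
    have "p dvd [:b, 0, 0, 0, b:]" "p dvd [:0, 0, - b:]"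
      using d[of 0] d[of 1] by simp_all
    \<comment> \<open>The multiplier y^2 turns the two coefficients into the nonzero constant
      b.\<close>
    then have "p dvd [:b, 0, 0, 0, b:] + [:0, 0, 1:] * [:0, 0, - b:]"
      by (intro dvd_add dvd_mult)
    also have "[:b, 0, 0, 0, b:] + [:0, 0, 1:] * [:0, 0, - b:] = [:b:]"
      by simp
    also have "\<dots> dvd 1"
      using b by (simp add: is_unit_const_poly_iff dvd_field_iff)
    finally show ?thesis
      by (simp add: p is_unit_const_poly_iff)
  qed
  show ?thesis
    unfolding C
  proof (rule irreducibleI)
    show "[:[:b, 0, 0, 0, b:], [:0, 0, - b:]:] \<noteq> 0"
      using b by simp
    show "\<not> [:[:b, 0, 0, 0, b:], [:0, 0, - b:]:] dvd 1"
      using b by (auto simp: is_unit_poly_iff)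
    fix A B assume AB: "[:[:b, 0, 0, 0, b:], [:0, 0, - b:]:] = A * B"
    then have "A \<noteq> 0" "B \<noteq> 0"
      using b by auto
    then have "degree A + degree B = 1"
      using arg_cong[OF AB, of degree] b by (simp add: degree_mult_eq)
    then have "degree A = 0 \<or> degree B = 0"
      by auto
    then show "A dvd 1 \<or> B dvd 1"
      using const[OF AB] const[of B A] AB by (auto simp: mult.commute)
  qed
next
  case False
  have deg: "degree (cubic a b) = 3"
    using False by (simp add: cubic_def)
  have lead: "coeff (cubic a b) 3 = [:- a:]"
    by (simp add: cubic_def numeral_3_eq_3)
  have fac: "A dvd 1" if AB: "cubic a b = A * B" and d: "degree A \<le> degree B" for A B
  proof -
    have nz: "A \<noteq> 0" "B \<noteq> 0"
      using AB deg by auto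
    have sum: "degree A + degree B = 3"
      using nz deg AB by (simp add: degree_mult_eq)
    have "lead_coeff A * lead_coeff B = [:- a:]"
      using lead_coeff_mult[of A B] lead deg AB by simp
    then have "lead_coeff A dvd [:- a:]"
      by (metis dvd_triv_left)
    moreover have "[:- a:] dvd 1"
      using False by (simp add: is_unit_const_poly_iff dvd_field_iff)
    ultimately have lu: "lead_coeff A dvd 1"
      by (rule dvd_trans)
    consider "degree A = 0" | "degree A = 1"
      using sum d by linarith
    then show ?thesis
    proof cases
      case 1
      then show ?thesis
        using lu by (metis degree_eq_zeroE is_unit_const_poly_iff lead_coeff_pCons(2))
    next
      case 2
      then have A: "A = [:coeff A 0, lead_coeff A:]"
        by (intro poly_eqI) (auto simp: coeff_pCons coeff_eq_0 split: nat.splits)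
      obtain u where u: "1 = lead_coeff A * u"
        using lu ..
      have "poly A (- coeff A 0 * u) = 0"
        by (subst A) (use u in \<open>simp add: algebra_simps\<close>)
      then have "poly (cubic a b) (- coeff A 0 * u) = 0"
        by (simp add: AB)
      then show ?thesis
        using cubic_no_root[OF False] by blast
    qed
  qed
  show ?thesis
  proof (rule irreducibleI)
    show "cubic a b \<noteq> 0"
      using deg by auto
    show "\<not> cubic a b dvd 1"
      using deg by (auto simp: is_unit_poly_iff)
    fix A B assume "cubic a b = A * B"
    then show "A dvd 1 \<or> B dvd 1"
      using fac[of A B] fac[of B A] by (metis linear mult.commute)
  qed
qed

lemma irreducible_member:
  assumes "a \<noteq> 0 \<or> b \<noteq> 0"
  shows "irreducible (member a b)"
proof (rule irreducible_form[OF form_member irreducible_cubic[OF assms] ev2_cubic])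
  fix x
  \<comment> \<open>The second difference in z isolates a. If a = 0, a difference in y isolates
    b.\<close>
  have "eval_poly (member a b) (vector [x, 1, 1]) + eval_poly (member a b) (vector [x, 1, - 1])
      - 2 * eval_poly (member a b) (vector [x, 1, 0]) = 2 * a"
    by (simp add: eval_member algebra_simps power2_eq_square power3_eq_cube power4_eq_xxxx)
  moreover have "eval_poly (member 0 b) (vector [x, 1, 0]) - eval_poly (member 0 b) (vector [x, 0, 0]) = b"
    by (simp add: eval_member algebra_simps)
  ultimately show "\<exists>y z. eval_poly (member a b) (vector [x, y, z]) \<noteq> 0"
    using assms by (metis diff_zero add_0 mult_zero_right mult_eq_0_iff zero_neq_numeral)
qed

lemma prime_chart_member:
  assumes b: "b \<noteq> 0"
  shows "prime_elem (chart 1 (member a b))" "prime_elem (chart 3 (member a b))"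
proof -
  have "irreducible (chart 1 (member a b))"
  proof (rule irreducible_swap[OF irreducible_cubic])
    show "a \<noteq> 0 \<or> b \<noteq> 0"
      using b by simp
    fix z y
    have "chart_pt 1 z y = vector [1, y, z]"
      by (simp add: vec3_eq_iff)
    then show "ev2 (chart 1 (member a b)) z y = ev2 (cubic a b) y z"
      by (simp add: ev2_cubic ev2_chart)
  qed
  then show 1: "prime_elem (chart 1 (member a b))"
    by (rule irreducible_imp_prime_elem)
  have "coeff (chart 1 (member a b)) 4 = [:b:]"
    using coeff_chart[OF form_member] by (simp add: eval_member axis3)
  then have "degree (chart 1 (member a b)) \<ge> 4"
    using b by (intro le_degree) simp
  moreover have "\<exists>y. eval_poly (member a b) (chart_pt 3 0 y) \<noteq> 0"
  proof -
    \<comment> \<open>On x = 0, z = 1 the member is a y^2 + b y^4; the combination eliminates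
      a.\<close>
    have "eval_poly (member a b) (chart_pt 3 0 2) - 4 * eval_poly (member a b) (chart_pt 3 0 1) = 12 * b"
      by (simp add: eval_member algebra_simps)
    then show ?thesis
      using b by (metis diff_zero mult_eq_0_iff mult_zero_right zero_neq_numeral)
  qed
  ultimately show "prime_elem (chart 3 (member a b))"
    using irreducible_other_chart[OF form_member 1] by (metis irreducible_imp_prime_elem le_zero_eq not_gr_zero
        zero_neq_numeral)
qed

section \<open>Smoothness\<close>

text \<open>At t = 4 and t = -4 a factor of the discriminant in y^2 has a double root, and 27 t^2 =
  32 gives singular points with y = 0. For t = 0 the curve passes through (0:1:0) and the y^4 term
  disappears.\<close>

definition singular_params :: "complex set" where
  "singular_params = {t. t = 0 \<or> t = 4 \<or> t = - 4 \<or> 27 * t\<^sup>2 = 32}"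

lemma finite_singular_params: "finite singular_params"
proof -
  have roots: "finite {t. poly [:- 32, 0, 27 :: complex:] t = 0}"
    by (rule poly_roots_finite) simp
  have eq: "singular_params = {0, 4, - 4} \<union> {t. poly [:- 32, 0, 27:] t = 0}"
    by (auto simp: singular_params_def power2_eq_square algebra_simps)
  show ?thesis
    unfolding eq by (rule finite_UnI[OF _ roots]) simp
qed

text \<open>
  The members are quadratic in \<open>y\<^sup>2\<close>, with discriminant \<open>Q1 Q2\<close>. A singular point with \<open>y \<noteq> 0\<close> lies
  over a double root of the discriminant.
\<close>

lemma discriminant_square_free:
  fixes x z t :: complex
  assumes 1: "- 2 * z^3 - 3 * t * x * z^2 + (2 - t^2) * x^2 * z + 3 * t * x^3 = 0"
    and 2: "- t * z^3 + (2 - t^2) * x * z^2 + 9 * t * x^2 * z + (8 * t^2 - 2) * x^3 = 0"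
    and t: "t \<noteq> 0" "t \<noteq> 4" "t \<noteq> - 4"
  shows "x = 0 \<and> z = 0"
proof -
  define Q1 where "Q1 = z^2 + t * x * z + x^2 - 2 * x * z - 2 * t * x^2"
  define Q2 where "Q2 = z^2 + t * x * z + x^2 + 2 * x * z + 2 * t * x^2"
  have diff: "Q2 - Q1 = 4 * x * (z + t * x)"
    unfolding Q1_def Q2_def by algebra
  \<comment> \<open>Up to the factor -2 the two hypotheses are the partial derivatives of Q1 Q2 in z
    and x; this is Euler's relation.\<close>
  have "2 * (Q1 * Q2) = 0"
    using 1 2 unfolding Q1_def Q2_def by algebra
  then have prod: "Q1 = 0 \<or> Q2 = 0"
    by simp
  have z1: "(2 * z + (t - 2) * x) * Q2 + Q1 * (2 * z + (t + 2) * x) = 0"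
    using 1 unfolding Q1_def Q2_def by algebra
  have x1: "((t - 2) * z + 2 * (1 - 2 * t) * x) * Q2 + Q1 * ((t + 2) * z + 2 * (1 + 2 * t) * x) = 0"
    using 2 unfolding Q1_def Q2_def by algebra
  have both: "x = 0 \<and> z = 0" if "Q1 = 0" "Q2 = 0"
  proof -
    have "x * (z + t * x) = 0"
      using diff that by simp
    then have "x\<^sup>2 = 0"
      using that(1) unfolding Q1_def by algebra
    then show ?thesis
      using that(1) by (simp add: Q1_def)
  qed
  from prod show ?thesis
  proof
    assume Q1: "Q1 = 0"
    show ?thesis
    proof (cases "Q2 = 0")
      case False
      then have l: "2 * z + (t - 2) * x = 0" "(t - 2) * z + 2 * (1 - 2 * t) * x = 0"
        using z1 x1 Q1 by simp_all
      \<comment> \<open>Up to sign, t (t + 4) is the determinant of the two linear equations for a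
        double root of Q1; Q2 gives t (t - 4) below.\<close>
      then have "t * (t + 4) * x = 0"
        by algebra
      moreover have "t + 4 \<noteq> 0"
        using t(3) by (simp add: add_eq_0_iff2)
      ultimately show ?thesis
        using t l(1) by simp
    qed (use both Q1 in blast)
  next
    assume Q2: "Q2 = 0"
    show ?thesis
    proof (cases "Q1 = 0")
      case False
      then have l: "2 * z + (t + 2) * x = 0" "(t + 2) * z + 2 * (1 + 2 * t) * x = 0"
        using z1 x1 Q2 by simp_all
      then have "t * (t - 4) * x = 0"
        by algebra
      then show ?thesis
        using t l(1) by simp
    qed (use both Q2 in blast)
  qed
qed

lemma smooth_member_1:
  assumes t: "t \<notin> singular_params"
    and d: "dir_deriv (member 1 t) v (axis 1 1) = 0" "dir_deriv (member 1 t) v (axis 2 1) = 0" "dir_deriv (member 1 t) v (axis 3 1) = 0"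
  shows "v = 0"
proof -
  have t': "t \<noteq> 0" "t \<noteq> 4" "t \<noteq> - 4" "27 * t^2 \<noteq> 32"
    using t by (auto simp: singular_params_def)
  define x y z where "x = v $ 1" and "y = v $ 2" and "z = v $ 3"
  have X: "- 2 * x * y^2 - z^3 + 6 * x^2 * z + t * (4 * x^3 - y^2 * z) = 0"
    using d(1) by (simp add: member_def quartic_F_def quartic_G_def axis3 x_def y_def z_def algebra_simps)
  have Y: "y * (2 * z^2 - 2 * x^2 + t * (4 * y^2 - 2 * x * z)) = 0"
    using d(2) by (simp add: member_def quartic_F_def quartic_G_def axis3 x_def y_def z_def
        power2_eq_square power3_eq_cube algebra_simps)
  have Z: "2 * y^2 * z - 3 * x * z^2 + 2 * x^3 - t * x * y^2 = 0"
    using d(3) by (simp add: member_def quartic_F_def quartic_G_def axis3 x_def y_def z_def algebra_simps)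
  have "x = 0 \<and> y = 0 \<and> z = 0"
  proof (cases "y = 0")
    \<comment> \<open>On y = 0 the derivative in y vanishes identically; the other two have a common
      zero only if 27 t^2 = 32.\<close>
    case True
    have zx: "z = 0" if "x = 0"
      using X True that by simp
    have "x = 0"
    proof (rule ccontr)
      assume x: "x \<noteq> 0"
      have "x * (2 * x^2 - 3 * z^2) = 0"
        using Z True by algebra
      then have 1: "2 * x^2 = 3 * z^2"
        using x by simp
      have "x^2 * (16 * z + 12 * t * x) = 0"
        using X True 1 by algebra
      then have 2: "4 * z = - (3 * t * x)"
        using x by algebra
      have "x^2 * (27 * t^2 - 32) = 0"
        using 1 2 by algebra
      then show False
        using x t'(4) by simp
    qed
    then show ?thesis
      using zx True by simp
  next
    case False
    \<comment> \<open>The derivative in y, divided by 2 y, determines y^2; substituting it gives the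
      two hypotheses of \<open>discriminant_square_free\<close>.\<close>
    then have A: "2 * t * y^2 = x^2 + t * x * z - z^2"
      using Y by algebra
    have "- 2 * z^3 - 3 * t * x * z^2 + (2 - t^2) * x^2 * z + 3 * t * x^3 = 0"
      using Z A by algebra
    moreover have "- t * z^3 + (2 - t^2) * x * z^2 + 9 * t * x^2 * z + (8 * t^2 - 2) * x^3 = 0"
      using X A by algebra
    ultimately have "x = 0 \<and> z = 0"
      using discriminant_square_free t' by blast
    then show ?thesis
      using A t'(1) by simp
  qed
  then show ?thesis
    by (simp add: vec3_eq_iff x_def y_def z_def)
qed

lemma smooth_member:
  assumes a: "a \<noteq> 0" and t: "b / a \<notin> singular_params"
  shows "smooth_form (member a b)"
  unfolding smooth_form_def
proof (intro allI impI, rule ccontr)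
  fix v assume v: "v \<noteq> 0" and H: "\<nexists>i. eval_poly (partial_deriv i (member a b)) v \<noteq> 0"
  have "dir_deriv (member a b) v (axis i 1) = a * dir_deriv (member 1 (b / a)) v (axis i 1)" for i
    using a by (simp add: member_def distrib_left)
  then have "dir_deriv (member 1 (b / a)) v (axis i 1) = 0" for i
    using H a by (simp add: dir_deriv_axis)
  then show False
    using smooth_member_1[OF t] v by blast
qed

definition param :: "complex \<Rightarrow> complex ^ 2" where
  "param t = vector [1, t]"

lemma param_nth [simp]: "param t $ 1 = 1" "param t $ 2 = t"
  by (simp_all add: param_def)

lemma param_nz [simp]: "param t \<noteq> 0"
  by (metis param_nth(1) zero_index zero_neq_one)

lemma inj_param: "inj (\<lambda>t. proj_pt (param t))"
proof (rule injI)
  fix s t assume "proj_pt (param s) = proj_pt (param t)"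
  then obtain c where "param t = c *s param s"
    using proj_pt_eq_imp param_nz by blast
  then have "1 = c" "t = c * s"
    by (metis param_nth(1) vector_smult_component mult_1_right, metis param_nth(2) vector_smult_component)
  then show "s = t"
    by simp
qed

lemma general_member_smooth_quartics: "general_member_smooth quartic_F quartic_G"
  unfolding general_member_smooth_def
proof (intro exI conjI allI impI)
  \<comment> \<open>\<open>axis 2 1\<close> is the parameter of G, the only member not of the form F
    + t G.\<close>
  let ?S = "insert (proj_pt (axis 2 1)) ((\<lambda>t. proj_pt (param t)) ` singular_params)"
  have "(axis 2 1 :: complex ^ 2) \<noteq> 0"
    by (simp add: axis_eq_0_iff)
  then show "?S \<subseteq> proj_space"
    unfolding proj_space_def using param_nz by blast
  show "finite ?S"
    using finite_singular_params by simp
  fix s :: "complex ^ 2" assume s: "s \<noteq> 0" "proj_pt s \<notin> ?S"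
  have s1: "s $ 1 \<noteq> 0"
  proof
    assume "s $ 1 = 0"
    then have "s = s $ 2 *s axis 2 1"
      by (simp add: vec_eq_iff forall_2 axis_def)
    moreover from this have "s $ 2 \<noteq> 0"
      using s(1) by auto
    ultimately have "proj_pt s = proj_pt (axis 2 1)"
      by (metis proj_pt_scale)
    then show False
      using s(2) by simp
  qed
  have "s = s $ 1 *s param (s $ 2 / s $ 1)"
    using s1 by (simp add: vec_eq_iff forall_2)
  then have "proj_pt s = proj_pt (param (s $ 2 / s $ 1))"
    using s1 by (metis proj_pt_scale)
  then have "s $ 2 / s $ 1 \<notin> singular_params"
    using s(2) by auto
  then show "smooth_form (pencil_member quartic_F quartic_G s)"
    unfolding pencil_member_eq by (rule smooth_member[OF s1])
qed


section \<open>Non-isotriviality\<close>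

lemma plane_quartic_member:
  assumes "t \<notin> singular_params"
  shows "plane_quartic (member 1 t)"
proof
  have "t \<noteq> 0"
    using assms by (auto simp: singular_params_def)
  then show "prime_elem (chart 1 (member 1 t))" "prime_elem (chart 3 (member 1 t))"
    by (rule prime_chart_member)+
  show "eval_poly (member 1 t) (axis 2 1) \<noteq> 0"
    using \<open>t \<noteq> 0\<close> by (simp add: eval_member axis3)
  show "smooth_form (member 1 t)"
    by (rule smooth_member) (use assms in simp_all)
qed (rule form_member)

text \<open>The base point, a point on x = 0 and a point on y = 0 give a triangular basis; the last
  two come from solving z^2 = - t and z^3 = 2 z + t.\<close>

lemma span_member: "vec.span (affine_cone (member 1 t)) = UNIV"
proof -
  let ?S = "vec.span (affine_cone (member 1 t))"
  obtain w where w: "w\<^sup>2 = - t"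
    using power2_csqrt by blast
  obtain z where z: "z ^ 3 = 2 * z + t"
  proof -
    have "\<not> constant (poly [:- t, - 2, 0, 1:])"
      by (simp add: constant_degree)
    then obtain z where "poly [:- t, - 2, 0, 1:] z = 0"
      using fundamental_theorem_of_algebra by blast
    then have "z ^ 3 = 2 * z + t"
      by (simp add: power3_eq_cube algebra_simps)
    then show ?thesis
      by (rule that)
  qed
  have c: "vector [0, 0, 1] \<in> affine_cone (member 1 t)" "vector [0, 1, w] \<in> affine_cone (member 1 t)"
    "vector [1, 0, z] \<in> affine_cone (member 1 t)"
    using w z by (simp_all add: affine_cone_def eval_member vec3_eq_iff)
  have "v \<in> ?S" for v
  proof -
    have "v = v $ 1 *s vector [1, 0, z] + (v $ 2 *s vector [0, 1, w] +
        (v $ 3 - v $ 1 * z - v $ 2 * w) *s vector [0, 0, 1])"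
      by (simp add: vec3_eq_iff)
    moreover have "v $ 1 *s vector [1, 0, z] + (v $ 2 *s vector [0, 1, w] +
        (v $ 3 - v $ 1 * z - v $ 2 * w) *s vector [0, 0, 1]) \<in> ?S"
      by (intro vec.span_add vec.span_scale vec.span_base c)
    ultimately show ?thesis
      by simp
  qed
  then show ?thesis
    by blast
qed

lemma form4_member_tensor: "form4 (member_tensor t) v v v v = 12 * eval_poly (member 1 t) v"
  unfolding form4_def eval_member
  by (simp add: sum_3 member_tensor_def ones_def twos_def algebra_simps
      power2_eq_square power3_eq_cube power4_eq_xxxx)

lemma isomorphic_members:
  assumes s: "s \<notin> singular_params" and t: "t \<notin> singular_params"
    and iso: "proj_isomorphic (zero_locus (member 1 s)) (zero_locus (member 1 t))"
  shows "inv6 (member_tensor t) * inv3 (member_tensor s) ^ 2 = inv6 (member_tensor s) * inv3 (member_tensor t) ^ 2"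
proof -
  obtain M c where M: "c \<noteq> 0" "\<And>v. eval_poly (member 1 t) (M *v v) = c * eval_poly (member 1 s) v"
    using isomorphic_imp_linear_equivalence[OF plane_quartic_member[OF s] plane_quartic_member[OF t] span_member iso]
    by blast
  have "s \<noteq> 0"
    using s by (auto simp: singular_params_def)
  show ?thesis
    by (rule inv_ratio[where M = M, OF symmetric_tensor_member_tensor symmetric_tensor_member_tensor M(1)])
      (use \<open>s \<noteq> 0\<close> in \<open>simp_all add: form4_member_tensor M(2) inv3_member\<close>)
qed

lemma finite_isomorphic_members:
  assumes s: "s \<notin> singular_params"
  shows "finite {t. t \<notin> singular_params \<and> proj_isomorphic (zero_locus (member 1 s)) (zero_locus (member 1 t))}"
proof -
  have "s \<noteq> 0"
    using s by (auto simp: singular_params_def)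
  define q :: "complex poly" where "q = smult ((7344 * s)\<^sup>2) [:- 13824, 0, 18417024, 0, 110592:]
     - smult (inv6 (member_tensor s)) [:0, 0, 7344\<^sup>2:]"
  \<comment> \<open>\<open>inv3\<close> vanishes at t = 0 and \<open>inv6\<close> does not, so the
    relation between the invariants of s and t cannot hold identically in t.\<close>
  have "coeff q 0 \<noteq> 0"
    using \<open>s \<noteq> 0\<close> by (simp add: q_def)
  then have "q \<noteq> 0"
    by auto
  then have fin: "finite {t. poly q t = 0}"
    by (rule poly_roots_finite)
  have "poly q t = 0" if "t \<notin> singular_params"
    "proj_isomorphic (zero_locus (member 1 s)) (zero_locus (member 1 t))" for t
    using isomorphic_members[OF s that]
    by (simp add: q_def inv3_member inv6_member[of t] power2_eq_square power4_eq_xxxx algebra_simps)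
  then show ?thesis
    by (intro finite_subset[OF _ fin]) blast
qed

lemma not_isotrivial_quartics: "\<not> isotrivial quartic_F quartic_G"
proof
  assume "isotrivial quartic_F quartic_G"
  then obtain S where S: "finite S" and iso: "\<And>s t. s \<noteq> 0 \<Longrightarrow> t \<noteq> 0 \<Longrightarrow> proj_pt s \<notin> S \<Longrightarrow> proj_pt t \<notin> S \<Longrightarrow>
      smooth_form (pencil_member quartic_F quartic_G s) \<Longrightarrow> smooth_form (pencil_member quartic_F quartic_G t) \<Longrightarrow>
      proj_isomorphic (zero_locus (pencil_member quartic_F quartic_G s)) (zero_locus (pencil_member quartic_F quartic_G t))"
    unfolding isotrivial_def by blast
  define bad where "bad = singular_params \<union> {t. proj_pt (param t) \<in> S}"
  have "finite {t. proj_pt (param t) \<in> S}"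
    using finite_vimageI[OF S inj_param] by (simp add: vimage_def)
  then have bad: "finite bad"
    by (simp add: bad_def finite_singular_params)
  then obtain s where s: "s \<notin> bad"
    using ex_new_if_finite[OF infinite_UNIV_char_0] by blast
  let ?I = "{t. t \<notin> singular_params \<and> proj_isomorphic (zero_locus (member 1 s)) (zero_locus (member 1 t))}"
  have "finite (bad \<union> ?I)"
    using bad finite_isomorphic_members s by (simp add: bad_def)
  then obtain t where t: "t \<notin> bad \<union> ?I"
    using ex_new_if_finite[OF infinite_UNIV_char_0] by blast
  have "smooth_form (member 1 u)" if "u \<notin> bad" for u
    by (rule smooth_member) (use that in \<open>simp_all add: bad_def\<close>)
  then have "proj_isomorphic (zero_locus (member 1 s)) (zero_locus (member 1 t))"
    using iso[of "param s" "param t"] s t by (simp add: pencil_member_eq bad_def)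
  then show False
    using t by (auto simp: bad_def)
qed

theorem theorem1p8:
  shows "\<exists>F G :: 3 cpoly. is_pencil 4 F G \<and>
    (\<exists>P. base_locus F G = {P}) \<and>
    (\<forall>t. t \<noteq> 0 \<longrightarrow> irreducible (pencil_member F G t)) \<and>
    general_member_smooth F G \<and>
    \<not> isotrivial F G"
proof (intro exI conjI allI impI)
  fix t :: "complex ^ 2" assume "t \<noteq> 0"
  then have "t $ 1 \<noteq> 0 \<or> t $ 2 \<noteq> 0"
    by (auto simp: vec_eq_iff forall_2)
  then show "irreducible (pencil_member quartic_F quartic_G t)"
    unfolding pencil_member_eq by (rule irreducible_member)
qed (rule is_pencil_quartics base_locus_quartics general_member_smooth_quartics not_isotrivial_quartics)+

end
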